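(* For any set $S$ of positive integers of asymptotic density zero, the set $\mathcal{U}\cup S$ is not a union of finitely many infinite arithmetic progressions $\{m_ih+a_i : h=0,1,2,\dots\}$ (with $m_i,a_i$ positive integers) and a set of asymptotic density zero.
   Context: $\mathcal{U}$ denotes the set of positive odd integers $n$ that cannot be written as $n=p+2^k$ with $p$ a prime and $k$ a positive integer. A set $A$ of positive integers has asymptotic density $\delta$ if $|A\cap[1,x]|/x\to\delta$ as $x\to\infty$. *)

theory Defs
  imports Complex_Main "HOL-Computational_Algebra.Primes"
begin

definition has_asymp_density :: "nat set \<Rightarrow> real \<Rightarrow> bool" where
  "has_asymp_density A \<delta> \<longleftrightarrow>
     ((\<lambda>x::real. real (card {n \<in> A. 1 \<le> n \<and> real n \<le> x}) / x) \<longlongrightarrow> \<delta>) at_top"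

definition \<U> :: "nat set" where
  "\<U> = {n. 0 < n \<and> odd n \<and> \<not> (\<exists>p k. prime p \<and> 0 < k \<and> n = p + 2 ^ k)}"

definition arith_prog :: "nat \<Rightarrow> nat \<Rightarrow> nat set" where
  "arith_prog m a = {m * h + a | h. True}"

end

theory Submission
  imports Defs "HOL-Number_Theory.Number_Theory" "HOL-Analysis.Analysis" "HOL-Real_Asymp.Real_Asymp"
begin

text \<open>
  Let \<open>m\<close> be twice the product of the moduli. If every odd residue class modulo \<open>m\<close> met the
  progressions, almost all odd numbers would lie in \<open>\<U> \<union> S\<close>, contradicting Romanoff's theorem that the
  sums \<open>p + 2 ^ k\<close> have positive lower density. Otherwise some odd class \<open>a\<close> modulo \<open>m\<close> is disjoint
  from the progressions, and almost all of its elements are of the form \<open>p + 2 ^ k\<close>. For many primes \<open>l\<close>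
  choose a prime \<open>q l\<close> dividing \<open>2 ^ l - 1\<close>; fixing \<open>b\<close> suitably modulo the \<open>q l\<close> makes
  \<open>b - 2 ^ k\<close> divisible by some \<open>q l\<close> for all \<open>k\<close> outside a set of density \<open>\<Prod>(1 - 1 / l)\<close>, which can be
  made arbitrarily small. By the Brun-Titchmarsh bound the subclass of \<open>b\<close> then has too few elements
  \<open>p + 2 ^ k\<close>.

  Both ingredients rest on an upper bound sieve. Romanoff's theorem follows from the Cauchy-Schwarz
  inequality, the sieve bound for prime pairs with difference \<open>2 ^ k - 2 ^ l\<close>, and Erdos's proof that
  \<open>n / \<phi> n\<close> is bounded on average over \<open>n = 2 ^ j - 1\<close>.
\<close>

section \<open>Selberg weights on families of finite sets\<close>

text \<open>The obstacle is the constant lost in the sieve. Up to \<open>x\<close> there are about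
  \<open>ln x\<close> exponents, and the sieve bounds the primes belonging to one exponent by a
  constant times the class size over \<open>ln x\<close>; summed over all exponents this gives only
  some constant multiple of the class size, which excludes nothing. A complete covering of the
  exponents would settle it, but one compatible with a prescribed class modulo \<open>m\<close> need
  not be at hand. A near covering suffices: the exceptional set has density zero, so only a fixed
  proportion must be gained. The \<open>l\<close> are primes above \<open>m\<close>, which makes the
  \<open>q l\<close> distinct and coprime to \<open>m\<close>, and residues modulo them can be
  prescribed freely. Every new modulus also inflates the sieve bound by
  \<open>q l / (q l - 1)\<close>, and this loss has to stay below the gain. In Romanoff's theorem
  the differences \<open>2 ^ k - 2 ^ l\<close> grow with \<open>N\<close>, so the bound for prime
  pairs must be uniform in the difference \<open>H\<close>, which may enter only through
  \<open>H / \<phi> H\<close>.\<close>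

lemma sum_Pow_prod:
  fixes f :: "'a \<Rightarrow> real"
  assumes "finite A"
  shows "(\<Sum>X\<in>Pow A. \<Prod>x\<in>X. f x) = (\<Prod>x\<in>A. 1 + f x)"
  using prod_add[OF assms, of f "\<lambda>_. 1"] by (simp add: add.commute)

text \<open>Moebius inversion on the lattice of finite sets; \<open>(-1) ^ card D\<close> is the
  Moebius function of the squarefree number with prime set \<open>D\<close>.\<close>

lemma sum_neg_one_power_card_interval:
  assumes "finite E" "T \<subseteq> E"
  shows "(\<Sum>D | T \<subseteq> D \<and> D \<subseteq> E. (-1::real) ^ card D) = (if E = T then (-1) ^ card T else 0)"
proof -
  have finT: "finite T" using assms finite_subset by blast
  have bij: "bij_betw (\<lambda>X. T \<union> X) (Pow (E - T)) {D. T \<subseteq> D \<and> D \<subseteq> E}"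
    by (rule bij_betwI[where g = "\<lambda>D. D - T"]) (use assms in auto)
  have card: "card (T \<union> X) = card T + card X" if "X \<in> Pow (E - T)" for X
    using that finT assms by (intro card_Un_disjoint) (auto intro: finite_subset)
  have "(\<Sum>D | T \<subseteq> D \<and> D \<subseteq> E. (-1::real) ^ card D) = (\<Sum>X\<in>Pow (E - T). (-1) ^ card (T \<union> X))"
    using sum.reindex_bij_betw[OF bij, of "\<lambda>D. (-1::real) ^ card D"] by simp
  also have "\<dots> = (\<Sum>X\<in>Pow (E - T). (-1) ^ card T * (\<Prod>x\<in>X. -1))"
    by (intro sum.cong) (auto simp: card power_add)
  also have "\<dots> = (-1) ^ card T * (\<Prod>x\<in>E - T. 1 + (-1))"
    using sum_Pow_prod[of "E - T" "\<lambda>_. -1"] assms by (simp flip: sum_distrib_left)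
  also have "\<dots> = (if E = T then (-1) ^ card T else 0)"
    using assms by (auto simp: power_0_left card_eq_0_iff)
  finally show ?thesis .
qed

text \<open>The quadratic form is diagonalised by \<open>y T\<close>, the sum of
  \<open>G D * w D\<close> over all \<open>D\<close> containing \<open>T\<close>: it becomes the sum
  of \<open>(y T)\<^sup>2 / H T\<close>. Under the constraint \<open>w {} = 1\<close> its minimum
  has \<open>y T\<close> proportional to \<open>(-1) ^ card T * H T\<close>, and these are the
  weights used.\<close>

lemma selberg_weights:
  fixes \<D> :: "'a set set" and g :: "'a \<Rightarrow> real"
  assumes fin: "finite \<D>" and finD: "\<And>D. D \<in> \<D> \<Longrightarrow> finite D"
    and down: "\<And>D E. D \<in> \<D> \<Longrightarrow> E \<subseteq> D \<Longrightarrow> E \<in> \<D>" and ne: "{} \<in> \<D>"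
    and g: "\<And>D q. D \<in> \<D> \<Longrightarrow> q \<in> D \<Longrightarrow> 0 < g q \<and> g q < 1"
  defines "L \<equiv> \<Sum>D\<in>\<D>. \<Prod>q\<in>D. g q / (1 - g q)"
  shows "\<exists>w. w {} = 1 \<and> (\<forall>D\<in>\<D>. \<bar>w D\<bar> \<le> 1 / (\<Prod>q\<in>D. g q)) \<and>
    (\<Sum>D\<in>\<D>. \<Sum>E\<in>\<D>. w D * w E * (\<Prod>q\<in>D \<union> E. g q)) = 1 / L"
proof -
  define h where "h q = g q / (1 - g q)" for q
  define G where "G D = (\<Prod>q\<in>D. g q)" for D
  define H where "H D = (\<Prod>q\<in>D. h q)" for D
  have L: "L = (\<Sum>D\<in>\<D>. H D)" by (simp add: L_def H_def h_def)
  have Hpos: "H D > 0" if "D \<in> \<D>" for D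
    unfolding H_def h_def using g[OF that] by (intro prod_pos) auto
  have Gpos: "G D > 0" if "D \<in> \<D>" for D
    unfolding G_def using g[OF that] by (intro prod_pos) auto
  have Lpos: "L > 0"
    unfolding L using fin ne Hpos by (intro sum_pos) auto
  have invG: "1 / G S = (\<Sum>T\<in>Pow S. 1 / H T)" if "S \<in> \<D>" for S
  proof -
    have "(\<Sum>T\<in>Pow S. 1 / H T) = (\<Sum>T\<in>Pow S. \<Prod>q\<in>T. 1 / h q)"
      by (simp add: H_def prod_dividef)
    also have "\<dots> = (\<Prod>q\<in>S. 1 + 1 / h q)" using sum_Pow_prod finD that by blast
    also have "\<dots> = (\<Prod>q\<in>S. 1 / g q)"
    proof (intro prod.cong refl)
      fix q assume "q \<in> S"
      then have "0 < g q" "g q < 1" using g that by auto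
      then show "1 + 1 / h q = 1 / g q" by (simp add: h_def field_simps)
    qed
    also have "\<dots> = 1 / G S" by (simp add: G_def prod_dividef)
    finally show ?thesis by simp
  qed
  \<comment> \<open>Moebius inversion of the intended values of \<open>y T\<close>. The last factor
    is the part of \<open>L\<close> carried by the supersets of \<open>D\<close>, so it lies between
    0 and 1, whence the crude bound on the weights.\<close>
  define w where "w D = (-1) ^ card D / G D * ((\<Sum>E | E \<in> \<D> \<and> D \<subseteq> E. H E) / L)" for D
  have frac: "0 \<le> (\<Sum>E | E \<in> \<D> \<and> D \<subseteq> E. H E)" "(\<Sum>E | E \<in> \<D> \<and> D \<subseteq> E. H E) \<le> L" for D
  proof -
    show "0 \<le> (\<Sum>E | E \<in> \<D> \<and> D \<subseteq> E. H E)" by (intro sum_nonneg) (auto intro: less_imp_le Hpos)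
    show "(\<Sum>E | E \<in> \<D> \<and> D \<subseteq> E. H E) \<le> L" unfolding L
      by (intro sum_mono2 fin) (auto intro: less_imp_le Hpos)
  qed
  have "w {} = 1" using Lpos by (simp add: w_def G_def L)
  moreover have "\<bar>w D\<bar> \<le> 1 / G D" if "D \<in> \<D>" for D
  proof -
    have "\<bar>w D\<bar> = 1 / G D * ((\<Sum>E | E \<in> \<D> \<and> D \<subseteq> E. H E) / L)"
      using Gpos[OF that] Lpos frac(1)[of D] by (simp add: w_def abs_mult power_abs)
    also have "\<dots> \<le> 1 / G D * 1"
      using Gpos[OF that] Lpos frac(2)[of D] by (intro mult_left_mono) auto
    finally show ?thesis by simp
  qed
  moreover have "(\<Sum>D\<in>\<D>. \<Sum>E\<in>\<D>. w D * w E * G (D \<union> E)) = 1 / L"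
  proof -
    define y where "y T = (\<Sum>D | D \<in> \<D> \<and> T \<subseteq> D. G D * w D)" for T
    have y: "y T = (-1) ^ card T * H T / L" if T: "T \<in> \<D>" for T
    proof -
      have "y T = (\<Sum>D | D \<in> \<D> \<and> T \<subseteq> D. \<Sum>E | E \<in> \<D> \<and> D \<subseteq> E. (-1) ^ card D * H E / L)"
        unfolding y_def
      proof (intro sum.cong refl)
        fix D assume "D \<in> {D. D \<in> \<D> \<and> T \<subseteq> D}"
        then have "G D > 0" using Gpos by auto
        then show "G D * w D = (\<Sum>E | E \<in> \<D> \<and> D \<subseteq> E. (-1) ^ card D * H E / L)"
          by (simp add: w_def sum_distrib_left sum_divide_distrib)
      qed
      also have "\<dots> = (\<Sum>E\<in>\<D>. \<Sum>D | D \<in> {D \<in> \<D>. T \<subseteq> D} \<and> D \<subseteq> E. (-1) ^ card D * H E / L)"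
        using fin by (subst sum.swap_restrict) auto
      also have "\<dots> = (\<Sum>E\<in>\<D>. H E / L * (if E = T then (-1) ^ card T else 0))"
      proof (intro sum.cong refl)
        fix E assume E: "E \<in> \<D>"
        have eq: "{D. D \<in> {D \<in> \<D>. T \<subseteq> D} \<and> D \<subseteq> E} = {D. T \<subseteq> D \<and> D \<subseteq> E}"
          using E down by auto
        have "(\<Sum>D | T \<subseteq> D \<and> D \<subseteq> E. (-1::real) ^ card D) = (if E = T then (-1) ^ card T else 0)"
        proof (cases "T \<subseteq> E")
          case True
          then show ?thesis using sum_neg_one_power_card_interval finD E by blast
        next
          case False
          then have "{D. T \<subseteq> D \<and> D \<subseteq> E} = {}" "E \<noteq> T" by auto
          then show ?thesis by (simp only: sum.empty if_False)
        qed
        then show "(\<Sum>D | D \<in> {D \<in> \<D>. T \<subseteq> D} \<and> D \<subseteq> E. (-1) ^ card D * H E / L)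
            = H E / L * (if E = T then (-1) ^ card T else 0)"
          unfolding eq sum_divide_distrib[symmetric] sum_distrib_right[symmetric] by simp
      qed
      also have "\<dots> = H T / L * (-1) ^ card T"
        using fin T by (simp add: sum.delta if_distrib[of "(*) _"] cong: if_cong)
      finally show ?thesis by (simp add: mult_ac)
    qed
    \<comment> \<open>\<open>G\<close> is multiplicative, so \<open>G (D \<union> E)\<close> is
      \<open>G D * G E / G (D \<inter> E)\<close>; expanding the reciprocal over the common subsets
      \<open>T\<close> decouples \<open>D\<close> from \<open>E\<close>.\<close>
    have G: "G (D \<union> E) = G D * G E * (\<Sum>T\<in>Pow (D \<inter> E). 1 / H T)" if "D \<in> \<D>" "E \<in> \<D>" for D E
    proof -
      have I: "D \<inter> E \<in> \<D>" using that down by auto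
      have "G (D \<union> E) * G (D \<inter> E) = G D * G E"
        unfolding G_def using finD that by (intro prod.union_inter)
      then have "G (D \<union> E) = G D * G E * (1 / G (D \<inter> E))"
        using Gpos[OF I] by (simp add: field_simps)
      then show ?thesis using invG[OF I] by simp
    qed
    have "(\<Sum>D\<in>\<D>. \<Sum>E\<in>\<D>. w D * w E * G (D \<union> E)) =
      (\<Sum>D\<in>\<D>. \<Sum>E\<in>\<D>. \<Sum>T\<in>\<D>. if T \<subseteq> D \<and> T \<subseteq> E then (1 / H T) * (G D * w D) * (G E * w E) else 0)"
    proof (intro sum.cong refl)
      fix D E assume DE: "D \<in> \<D>" "E \<in> \<D>"
      have eq: "{T \<in> \<D>. T \<subseteq> D \<and> T \<subseteq> E} = Pow (D \<inter> E)" using DE down by auto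
      have "(\<Sum>T\<in>\<D>. if T \<subseteq> D \<and> T \<subseteq> E then (1 / H T) * (G D * w D) * (G E * w E) else 0)
        = (\<Sum>T\<in>Pow (D \<inter> E). (1 / H T) * (G D * w D) * (G E * w E))"
        using fin eq by (simp add: sum.If_cases Int_def)
      also have "\<dots> = w D * w E * G (D \<union> E)"
        unfolding G[OF DE] by (simp add: sum_distrib_left sum_distrib_right mult_ac)
      finally show "w D * w E * G (D \<union> E) = (\<Sum>T\<in>\<D>. if T \<subseteq> D \<and> T \<subseteq> E then (1 / H T) * (G D * w D) * (G E * w E) else 0)"
        by simp
    qed
    also have "\<dots> = (\<Sum>D\<in>\<D>. \<Sum>T\<in>\<D>. \<Sum>E\<in>\<D>. if T \<subseteq> D \<and> T \<subseteq> E then (1 / H T) * (G D * w D) * (G E * w E) else 0)"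
      by (intro sum.cong refl sum.swap)
    also have "\<dots> = (\<Sum>T\<in>\<D>. \<Sum>D\<in>\<D>. \<Sum>E\<in>\<D>. if T \<subseteq> D \<and> T \<subseteq> E then (1 / H T) * (G D * w D) * (G E * w E) else 0)"
      by (rule sum.swap)
    also have "\<dots> = (\<Sum>T\<in>\<D>. 1 / H T * (y T)\<^sup>2)"
    proof (intro sum.cong refl)
      fix T assume "T \<in> \<D>"
      have "(y T)\<^sup>2 = (\<Sum>D\<in>\<D>. \<Sum>E\<in>\<D>. (if T \<subseteq> D then G D * w D else 0) * (if T \<subseteq> E then G E * w E else 0))"
        unfolding y_def power2_eq_square sum_product[symmetric] using fin
        by (simp add: sum.If_cases Int_def)
      then show "(\<Sum>D\<in>\<D>. \<Sum>E\<in>\<D>. if T \<subseteq> D \<and> T \<subseteq> E then (1 / H T) * (G D * w D) * (G E * w E) else 0) = 1 / H T * (y T)\<^sup>2"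
        by (simp add: sum_distrib_left) (intro sum.cong refl, auto)
    qed
    also have "\<dots> = (\<Sum>T\<in>\<D>. H T / L\<^sup>2)"
    proof (intro sum.cong refl)
      fix T assume T: "T \<in> \<D>"
      have "((-1::real) ^ card T)\<^sup>2 = 1" by (simp flip: power_mult)
      then show "1 / H T * (y T)\<^sup>2 = H T / L\<^sup>2"
        using Hpos[OF T] unfolding y[OF T] by (simp add: power_mult_distrib power_divide power2_eq_square)
    qed
    also have "\<dots> = 1 / L"
      using Lpos by (simp add: L[symmetric] flip: sum_divide_distrib) (simp add: power2_eq_square)
    finally show ?thesis .
  qed
  ultimately show ?thesis unfolding G_def by blast
qed

section \<open>Selberg's sieve\<close>

lemma card_residue_class_less:
  fixes d N r :: nat
  assumes "r < d"
  shows "\<bar>real (card {n. n < N \<and> n mod d = r}) - real N / real d\<bar> \<le> 1"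
proof -
  define t where "t = N div d"
  have d: "d > 0" using assms by simp
  have N: "d * t \<le> N" "N < d * (t + 1)"
    using d unfolding t_def by (auto simp: dividend_less_times_div)
  have inj: "inj_on (\<lambda>i. d * i + r) A" for A using d by (auto intro!: inj_onI)
  have "(\<lambda>i. d * i + r) ` {..<t} \<subseteq> {n. n < N \<and> n mod d = r}"
  proof safe
    fix i assume "i < t"
    then have "d * (i + 1) \<le> d * t" by (intro mult_le_mono2) simp
    then show "d * i + r < N" using assms N by simp
  qed (use assms in simp)
  then have "card ((\<lambda>i. d * i + r) ` {..<t}) \<le> card {n. n < N \<and> n mod d = r}"
    by (intro card_mono) auto
  then have lo: "t \<le> card {n. n < N \<and> n mod d = r}" using card_image[OF inj] by simp
  have "{n. n < N \<and> n mod d = r} \<subseteq> (\<lambda>i. d * i + r) ` {..<t + 1}"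
  proof
    fix n assume n: "n \<in> {n. n < N \<and> n mod d = r}"
    then have "n = d * (n div d) + r" by auto
    moreover have "n div d < t + 1" using n N d by (auto simp: less_mult_imp_div_less mult.commute)
    ultimately show "n \<in> (\<lambda>i. d * i + r) ` {..<t + 1}" by blast
  qed
  then have "card {n. n < N \<and> n mod d = r} \<le> card ((\<lambda>i. d * i + r) ` {..<t + 1})"
    by (intro card_mono) auto
  then have hi: "card {n. n < N \<and> n mod d = r} \<le> t + 1" using card_image[OF inj] by simp
  have "real (d * t) \<le> real N" "real N \<le> real (d * (t + 1))"
    using N by (simp_all only: of_nat_le_iff less_imp_le)
  then have "real t \<le> real N / real d" "real N / real d \<le> real t + 1"
    using d by (simp_all add: field_simps)
  then show ?thesis using lo hi by linarith
qed

lemma card_residues_less: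
  fixes d N :: nat
  assumes "W \<subseteq> {..<d}"
  shows "\<bar>real (card {n. n < N \<and> n mod d \<in> W}) - real (card W) * (real N / real d)\<bar> \<le> card W"
proof -
  have fin: "finite W" using assms finite_subset by blast
  have "{n. n < N \<and> n mod d \<in> W} = (\<Union>r\<in>W. {n. n < N \<and> n mod d = r})" by auto
  then have "card {n. n < N \<and> n mod d \<in> W} = (\<Sum>r\<in>W. card {n. n < N \<and> n mod d = r})"
    using fin by (simp only:) (intro card_UN_disjoint, auto)
  then have "real (card {n. n < N \<and> n mod d \<in> W}) - real (card W) * (real N / real d)
      = (\<Sum>r\<in>W. real (card {n. n < N \<and> n mod d = r}) - real N / real d)"
    by (simp add: sum_subtractf)
  also have "\<bar>\<dots>\<bar> \<le> (\<Sum>r\<in>W. \<bar>real (card {n. n < N \<and> n mod d = r}) - real N / real d\<bar>)"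
    by (rule sum_abs)
  also have "\<dots> \<le> (\<Sum>r\<in>W. 1)"
    using assms by (intro sum_mono card_residue_class_less) auto
  finally show ?thesis by simp
qed

text \<open>The Chinese remainder theorem, read as a bijection from one period onto the product of
  the residue sets.\<close>

lemma card_sieved_residues:
  fixes D :: "nat set" and \<Omega> :: "nat \<Rightarrow> nat set"
  assumes fin: "finite D" and pr: "\<And>q. q \<in> D \<Longrightarrow> prime q" and \<Omega>: "\<And>q. q \<in> D \<Longrightarrow> \<Omega> q \<subseteq> {..<q}"
  shows "card {n. n < \<Prod>D \<and> (\<forall>q\<in>D. n mod q \<in> \<Omega> q)} = (\<Prod>q\<in>D. card (\<Omega> q))"
proof -
  have cop: "\<forall>i\<in>D. \<forall>j\<in>D. i \<noteq> j \<longrightarrow> coprime i j" using pr by (auto intro: primes_coprime)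
  have nz: "\<forall>i\<in>D. i \<noteq> 0" using pr not_prime_0 by metis
  let ?A = "{n. n < \<Prod>D \<and> (\<forall>q\<in>D. n mod q \<in> \<Omega> q)}"
  have "bij_betw (\<lambda>n. restrict (\<lambda>q. n mod q) D) ?A (PiE D \<Omega>)"
    unfolding bij_betw_def
  proof
    show "inj_on (\<lambda>n. restrict (\<lambda>q. n mod q) D) ?A"
    proof
      fix x y assume xy: "x \<in> ?A" "y \<in> ?A" and eq: "restrict (\<lambda>q. x mod q) D = restrict (\<lambda>q. y mod q) D"
      have "\<forall>q\<in>D. [y = x] (mod q)"
      proof
        fix q assume "q \<in> D"
        then show "[y = x] (mod q)" using fun_cong[OF eq, of q] by (simp add: Cong.cong_def)
      qed
      moreover have "\<forall>q\<in>D. [x = x] (mod q)" by simp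
      ultimately show "x = y"
        using chinese_remainder_unique_nat[OF fin nz cop, of "\<lambda>q. x"] xy by blast
    qed
    show "(\<lambda>n. restrict (\<lambda>q. n mod q) D) ` ?A = PiE D \<Omega>"
    proof
      show "(\<lambda>n. restrict (\<lambda>q. n mod q) D) ` ?A \<subseteq> PiE D \<Omega>" by auto
      show "PiE D \<Omega> \<subseteq> (\<lambda>n. restrict (\<lambda>q. n mod q) D) ` ?A"
      proof
        fix u assume u: "u \<in> PiE D \<Omega>"
        obtain x where x: "x < \<Prod>D" "\<forall>q\<in>D. [x = u q] (mod q)"
          using chinese_remainder_unique_nat[OF fin nz cop, of u] by auto
        have "x mod q = u q" if "q \<in> D" for q
        proof -
          have "u q < q" using u \<Omega>[OF that] that by (auto simp: PiE_iff)
          then show ?thesis using x(2) that by (simp add: Cong.cong_def)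
        qed
        then show "u \<in> (\<lambda>n. restrict (\<lambda>q. n mod q) D) ` ?A"
          using x(1) u by (intro image_eqI[of _ _ x]) (auto simp: PiE_iff extensional_def fun_eq_iff)
      qed
    qed
  qed
  then have "card ?A = card (PiE D \<Omega>)" by (rule bij_betw_same_card)
  then show ?thesis using card_PiE[OF fin, of \<Omega>] by simp
qed

lemma card_sieved_less:
  fixes D :: "nat set" and \<Omega> :: "nat \<Rightarrow> nat set"
  assumes fin: "finite D" and pr: "\<And>q. q \<in> D \<Longrightarrow> prime q" and \<Omega>: "\<And>q. q \<in> D \<Longrightarrow> \<Omega> q \<subseteq> {..<q}"
  shows "\<bar>real (card {n. n < N \<and> (\<forall>q\<in>D. n mod q \<in> \<Omega> q)}) - real N * (\<Prod>q\<in>D. real (card (\<Omega> q)) / real q)\<bar>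
    \<le> (\<Prod>q\<in>D. real (card (\<Omega> q)))"
proof -
  let ?W = "{n. n < \<Prod>D \<and> (\<forall>q\<in>D. n mod q \<in> \<Omega> q)}"
  have pos: "\<Prod>D > 0" using pr prime_gt_0_nat by (intro prod_pos) auto
  have mm: "n mod \<Prod>D mod q = n mod q" if "q \<in> D" for n q
    using dvd_prodI[OF fin that, of "\<lambda>x. x"] by (simp add: mod_mod_cancel)
  have "{n. n < N \<and> (\<forall>q\<in>D. n mod q \<in> \<Omega> q)} = {n. n < N \<and> n mod \<Prod>D \<in> ?W}"
    using pos mm by auto
  moreover have "\<bar>real (card {n. n < N \<and> n mod \<Prod>D \<in> ?W}) - real (card ?W) * (real N / real (\<Prod>D))\<bar> \<le> card ?W"
    by (rule card_residues_less) auto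
  ultimately show ?thesis using card_sieved_residues[OF assms]
    by (simp add: prod_dividef mult.commute[of "real N"])
qed

lemma prod_primes_inj:
  "inj_on (\<lambda>D. \<Prod>D) {D :: nat set. finite D \<and> (\<forall>q\<in>D. prime q)}"
proof (rule inj_on_inverseI[where g = prime_factors])
  fix D :: "nat set" assume "D \<in> {D. finite D \<and> (\<forall>q\<in>D. prime q)}"
  then have D: "finite D" "\<And>q. q \<in> D \<Longrightarrow> prime q" by auto
  have "prime_factors (\<Prod>D) = (\<Union>q\<in>D. prime_factors q)"
    using D by (subst prime_factors_prod) (auto dest: D(2))
  also have "\<dots> = (\<Union>q\<in>D. {q})" using D by (auto simp: prime_prime_factors)
  finally show "prime_factors (\<Prod>D) = D" by simp
qed

text \<open>A squarefree number is represented by the set of its prime factors, so that divisibility, gcd and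
  lcm become inclusion, intersection and union.\<close>

definition bounded_prime_sets :: "nat set \<Rightarrow> real \<Rightarrow> nat set set" where
  "bounded_prime_sets P z = {D. D \<subseteq> P \<and> real (\<Prod>D) \<le> z}"

lemma finite_bounded_prime_sets: "finite P \<Longrightarrow> finite (bounded_prime_sets P z)"
  by (rule finite_subset[of _ "Pow P"]) (auto simp: bounded_prime_sets_def)

lemma card_bounded_prime_sets:
  assumes P: "finite P" "\<And>q. q \<in> P \<Longrightarrow> prime q" and z: "z \<ge> 0"
  shows "real (card (bounded_prime_sets P z)) \<le> z"
proof -
  have pos: "\<Prod>D > 0" if "D \<subseteq> P" for D
    using that P(2) prime_gt_0_nat by (intro prod_pos) auto
  have "card (bounded_prime_sets P z) \<le> card {1..nat \<lfloor>z\<rfloor>}"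
  proof (rule card_inj_on_le[where f = "\<lambda>D. \<Prod>D"])
    show "inj_on (\<lambda>D. \<Prod>D) (bounded_prime_sets P z)"
      by (rule inj_on_subset[OF prod_primes_inj])
        (use P finite_subset in \<open>auto simp: bounded_prime_sets_def\<close>)
    show "(\<lambda>D. \<Prod>D) ` bounded_prime_sets P z \<subseteq> {1..nat \<lfloor>z\<rfloor>}"
    proof safe
      fix D assume "D \<in> bounded_prime_sets P z"
      then have D: "D \<subseteq> P" "real (\<Prod>D) \<le> z" by (auto simp: bounded_prime_sets_def)
      then show "\<Prod>D \<in> {1..nat \<lfloor>z\<rfloor>}"
        using pos[OF D(1)] z by (simp add: le_nat_iff le_floor_iff)
    qed
  qed simp
  then have "card (bounded_prime_sets P z) \<le> nat \<lfloor>z\<rfloor>" by simp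
  then show ?thesis using z by (meson le_nat_floor of_nat_floor of_nat_le_iff order_trans)
qed

text \<open>The trivial bounds \<open>\<bar>w D\<bar> \<le> 1 / g D\<close> and \<open>\<Prod>q\<in>D. \<omega> q\<close> for the remainder suffice, because the level is
  taken to be a small power of \<open>N\<close>.\<close>

lemma selberg_sieve:
  fixes P :: "nat set" and \<Omega> :: "nat \<Rightarrow> nat set" and z :: real
  assumes P: "finite P" "\<And>q. q \<in> P \<Longrightarrow> prime q"
    and \<Omega>: "\<And>q. q \<in> P \<Longrightarrow> \<Omega> q \<subseteq> {..<q}" "\<And>q. q \<in> P \<Longrightarrow> \<Omega> q \<noteq> {}" "\<And>q. q \<in> P \<Longrightarrow> card (\<Omega> q) < q"
    and z: "z \<ge> 1"
  shows "real (card {n. n < N \<and> (\<forall>q\<in>P. n mod q \<notin> \<Omega> q)}) \<le>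
    real N / (\<Sum>D\<in>bounded_prime_sets P z. \<Prod>q\<in>D. real (card (\<Omega> q)) / (real q - real (card (\<Omega> q)))) + z ^ 4"
proof -
  let ?D = "bounded_prime_sets P z"
  define \<omega> where "\<omega> q = real (card (\<Omega> q))" for q
  define g where "g q = \<omega> q / real q" for q
  define L where "L = (\<Sum>D\<in>?D. \<Prod>q\<in>D. g q / (1 - g q))"
  have fin\<Omega>: "finite (\<Omega> q)" if "q \<in> P" for q using \<Omega>(1)[OF that] finite_subset by blast
  have \<omega>: "\<omega> q \<ge> 1" "\<omega> q < real q" if "q \<in> P" for q
    using \<Omega>(2,3)[OF that] fin\<Omega>[OF that] by (auto simp: \<omega>_def Suc_le_eq card_gt_0_iff)
  have finD: "finite ?D" using P by (simp add: finite_bounded_prime_sets)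
  have sub: "D \<subseteq> P" "finite D" "real (\<Prod>D) \<le> z" if "D \<in> ?D" for D
    using that P finite_subset by (auto simp: bounded_prime_sets_def)
  have g: "0 < g q \<and> g q < 1" if "q \<in> P" for q
    using \<omega>[OF that] by (auto simp: g_def)
  have down: "E \<in> ?D" if "D \<in> ?D" "E \<subseteq> D" for D E
  proof -
    have "\<Prod>E \<le> \<Prod>D"
      using sub[OF that(1)] that P(2) by (intro dvd_imp_le prod_dvd_prod_subset prod_pos) (auto intro!: prime_gt_0_nat)
    then have "real (\<Prod>E) \<le> real (\<Prod>D)" by (simp only: of_nat_le_iff)
    then show ?thesis using that unfolding bounded_prime_sets_def by auto
  qed
  have L_eq: "L = (\<Sum>D\<in>?D. \<Prod>q\<in>D. real (card (\<Omega> q)) / (real q - real (card (\<Omega> q))))"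
    unfolding L_def
  proof (intro sum.cong prod.cong refl)
    fix D q assume "D \<in> ?D" "q \<in> D"
    then have "q \<in> P" using sub by auto
    from \<omega>[OF this] show "g q / (1 - g q) = real (card (\<Omega> q)) / (real q - real (card (\<Omega> q)))"
      by (simp add: g_def \<omega>_def field_simps)
  qed
  have ne: "{} \<in> ?D" using z by (auto simp: bounded_prime_sets_def)
  have weights: "\<exists>w. w {} = 1 \<and> (\<forall>D\<in>?D. \<bar>w D\<bar> \<le> 1 / (\<Prod>q\<in>D. g q)) \<and>
    (\<Sum>D\<in>?D. \<Sum>E\<in>?D. w D * w E * (\<Prod>q\<in>D \<union> E. g q)) = 1 / L"
    unfolding L_def
  proof (rule selberg_weights)
    fix D q assume "D \<in> ?D" "q \<in> D"
    then show "0 < g q \<and> g q < 1" using sub(1) g by blast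
  qed (use finD sub down ne in auto)
  obtain w where w: "w {} = 1" "\<And>D. D \<in> ?D \<Longrightarrow> \<bar>w D\<bar> \<le> 1 / (\<Prod>q\<in>D. g q)"
    and quad: "(\<Sum>D\<in>?D. \<Sum>E\<in>?D. w D * w E * (\<Prod>q\<in>D \<union> E. g q)) = 1 / L"
    using weights by blast
  define B where "B n = {q \<in> P. n mod q \<in> \<Omega> q}" for n
  define c where "c D = real (card {n. n < N \<and> D \<subseteq> B n})" for D
  have c: "\<bar>c D - real N * (\<Prod>q\<in>D. g q)\<bar> \<le> (\<Prod>q\<in>D. \<omega> q)" if "D \<subseteq> P" for D
  proof -
    have "{n. n < N \<and> D \<subseteq> B n} = {n. n < N \<and> (\<forall>q\<in>D. n mod q \<in> \<Omega> q)}"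
      using that by (auto simp: B_def)
    moreover have "\<bar>real (card {n. n < N \<and> (\<forall>q\<in>D. n mod q \<in> \<Omega> q)}) - real N * (\<Prod>q\<in>D. real (card (\<Omega> q)) / real q)\<bar>
      \<le> (\<Prod>q\<in>D. real (card (\<Omega> q)))"
      using that P \<Omega>(1) by (intro card_sieved_less) (auto intro: finite_subset)
    ultimately show ?thesis unfolding c_def g_def \<omega>_def by simp
  qed
  \<comment> \<open>Selberg's majorant: a survivor has \<open>B n = {}\<close>, so only
    \<open>D = {}\<close> contributes and the square is 1; for every other \<open>n\<close> the
    square is at least 0.\<close>
  have "real (card {n. n < N \<and> B n = {}}) \<le> (\<Sum>n<N. (\<Sum>D | D \<in> ?D \<and> D \<subseteq> B n. w D)\<^sup>2)"
  proof -
    have "real (card {n. n < N \<and> B n = {}}) = (\<Sum>n<N. if B n = {} then 1 else 0)"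
      by (simp add: sum.If_cases Int_def)
    also have "\<dots> \<le> (\<Sum>n<N. (\<Sum>D | D \<in> ?D \<and> D \<subseteq> B n. w D)\<^sup>2)"
    proof (intro sum_mono)
      fix n
      have "{D. D \<in> ?D \<and> D \<subseteq> B n} = {{}}" if "B n = {}" using that ne by auto
      then show "(if B n = {} then 1 else 0) \<le> (\<Sum>D | D \<in> ?D \<and> D \<subseteq> B n. w D)\<^sup>2"
        using w(1) by auto
    qed
    finally show ?thesis .
  qed
  also have "\<dots> = (\<Sum>n<N. \<Sum>D\<in>?D. \<Sum>E\<in>?D. if D \<union> E \<subseteq> B n then w D * w E else 0)"
  proof (intro sum.cong refl)
    fix n
    have "(\<Sum>D | D \<in> ?D \<and> D \<subseteq> B n. w D)\<^sup>2 = (\<Sum>D\<in>?D. \<Sum>E\<in>?D. (if D \<subseteq> B n then w D else 0) * (if E \<subseteq> B n then w E else 0))"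
      unfolding power2_eq_square sum_product[symmetric] using finD by (simp add: sum.If_cases Int_def)
    also have "\<dots> = (\<Sum>D\<in>?D. \<Sum>E\<in>?D. if D \<union> E \<subseteq> B n then w D * w E else 0)"
      by (intro sum.cong refl) auto
    finally show "(\<Sum>D | D \<in> ?D \<and> D \<subseteq> B n. w D)\<^sup>2 = (\<Sum>D\<in>?D. \<Sum>E\<in>?D. if D \<union> E \<subseteq> B n then w D * w E else 0)" .
  qed
  also have "\<dots> = (\<Sum>D\<in>?D. \<Sum>n<N. \<Sum>E\<in>?D. if D \<union> E \<subseteq> B n then w D * w E else 0)"
    by (rule sum.swap)
  also have "\<dots> = (\<Sum>D\<in>?D. \<Sum>E\<in>?D. \<Sum>n<N. if D \<union> E \<subseteq> B n then w D * w E else 0)"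
    by (intro sum.cong refl sum.swap)
  also have "\<dots> = (\<Sum>D\<in>?D. \<Sum>E\<in>?D. w D * w E * c (D \<union> E))"
    by (intro sum.cong refl) (simp add: c_def sum.If_cases Int_def)
  also have "\<dots> \<le> (\<Sum>D\<in>?D. \<Sum>E\<in>?D. w D * w E * (real N * (\<Prod>q\<in>D \<union> E. g q)) + z\<^sup>2)"
  proof (intro sum_mono)
    fix D E assume D: "D \<in> ?D" and E: "E \<in> ?D"
    let ?G = "\<lambda>D. \<Prod>q\<in>D. g q" and ?W = "\<lambda>D. \<Prod>q\<in>D. \<omega> q"
    have Gpos: "?G A > 0" "?W A \<ge> 1" if "A \<subseteq> P" for A
      using that g \<omega> by (auto intro!: prod_pos prod_ge_1)
    \<comment> \<open>Since \<open>\<omega> q / g q = q\<close>, the weight bounds and the remainder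
      bound collapse to products of primes, at most \<open>z\<close> for each of \<open>D\<close>
      and \<open>E\<close>. With at most \<open>z\<close> sets on either side the total error is
      \<open>z ^ 4\<close>.\<close>
    have WG: "?W A / ?G A = real (\<Prod>A)" if "A \<subseteq> P" for A
    proof -
      have "?W A / ?G A = (\<Prod>q\<in>A. \<omega> q / g q)" by (simp add: prod_dividef)
      also have "\<dots> = (\<Prod>q\<in>A. real q)"
      proof (intro prod.cong refl)
        fix q assume "q \<in> A"
        then show "\<omega> q / g q = real q" using \<omega>[of q] that by (auto simp: g_def)
      qed
      finally show ?thesis by simp
    qed
    have "?W (D \<union> E) * ?W (D \<inter> E) = ?W D * ?W E"
      using sub D E by (intro prod.union_inter) auto
    moreover have "1 \<le> ?W (D \<inter> E)" "1 \<le> ?W (D \<union> E)" using sub[OF D] sub[OF E] by (auto intro!: Gpos)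
    ultimately have WW: "?W (D \<union> E) \<le> ?W D * ?W E"
      by (metis mult.right_neutral mult_left_mono order_trans zero_le_one)
    have "w D * w E * (c (D \<union> E) - real N * ?G (D \<union> E)) \<le> \<bar>w D\<bar> * \<bar>w E\<bar> * \<bar>c (D \<union> E) - real N * ?G (D \<union> E)\<bar>"
      by (metis abs_ge_self abs_mult)
    also have "\<dots> \<le> (1 / ?G D) * (1 / ?G E) * (?W D * ?W E)"
      using w(2)[OF D] w(2)[OF E] c[of "D \<union> E"] WW sub[OF D] sub[OF E] Gpos
      by (intro mult_mono) (auto intro: order_trans less_imp_le)
    also have "\<dots> = real (\<Prod>D) * real (\<Prod>E)"
      using WG[OF sub(1)[OF D]] WG[OF sub(1)[OF E]] by (simp flip: times_divide_times_eq)
    also have "\<dots> \<le> z * z"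
      using sub[OF D] sub[OF E] z by (intro mult_mono) (auto intro: prod_nonneg)
    finally show "w D * w E * c (D \<union> E) \<le> w D * w E * (real N * ?G (D \<union> E)) + z\<^sup>2"
      by (simp add: algebra_simps power2_eq_square)
  qed
  also have "\<dots> = real N * (\<Sum>D\<in>?D. \<Sum>E\<in>?D. w D * w E * (\<Prod>q\<in>D \<union> E. g q)) + (real (card ?D))\<^sup>2 * z\<^sup>2"
    by (simp add: sum.distrib sum_distrib_left mult_ac power2_eq_square)
  also have "\<dots> = real N / L + (real (card ?D))\<^sup>2 * z\<^sup>2" by (simp add: quad)
  also have "\<dots> \<le> real N / L + z\<^sup>2 * z\<^sup>2"
    using card_bounded_prime_sets[OF P, of z] z by (intro add_left_mono mult_right_mono power_mono) auto
  also have "z\<^sup>2 * z\<^sup>2 = z ^ 4" by (simp flip: power_add)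
  also have "{n. n < N \<and> B n = {}} = {n. n < N \<and> (\<forall>q\<in>P. n mod q \<notin> \<Omega> q)}" by (auto simp: B_def)
  finally show ?thesis unfolding L_eq .
qed

section \<open>Lower bounds for the sieve density\<close>

lemma sum_geometric_inverse_le:
  fixes q :: nat
  assumes "q \<ge> 2"
  shows "(\<Sum>j=1..J. (1 / real q) ^ j) \<le> 1 / (real q - 1)"
proof (induction J)
  case (Suc J)
  have eq: "(\<Sum>j=1..J. (1 / real q) ^ j) = (1 - (1 / real q) ^ J) / (real q - 1)" for J
  proof (induction J)
    case (Suc J)
    have "(1 - y) / (real q - 1) + 1 / real q * y = (1 - 1 / real q * y) / (real q - 1)" for y
      using assms by (simp add: field_simps)
    from this[of "(1 / real q) ^ J"] show ?case using Suc by simp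
  qed simp
  show ?case unfolding eq using assms by (intro divide_right_mono) auto
qed (use assms in simp)

text \<open>An Euler product over numbers with prime support exactly \<open>D\<close>:
  \<open>1 / (real q - 1)\<close> is the geometric series over exponents at least 1. As
  \<open>A\<close> is finite, the exponents can be cut off at \<open>J\<close>.\<close>

lemma sum_inverse_fixed_prime_factors_le:
  fixes D A :: "nat set"
  assumes A: "finite A" "0 \<notin> A" and D: "finite D" "\<And>q. q \<in> D \<Longrightarrow> prime q"
  shows "(\<Sum>n | n \<in> A \<and> prime_factors n = D. 1 / real n) \<le> (\<Prod>q\<in>D. 1 / (real q - 1))"
proof -
  define J where "J = Max (insert 0 A)"
  have J: "n \<le> J" if "n \<in> A" for n unfolding J_def using A that by simp
  let ?S = "{n. n \<in> A \<and> prime_factors n = D}"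
  let ?u = "\<lambda>n. restrict (\<lambda>q. multiplicity q n) D"
  have fact: "n = (\<Prod>q\<in>D. q ^ multiplicity q n)" if "n \<in> ?S" for n
    using that A prime_factorization_nat[of n] by auto
  have inj: "inj_on ?u ?S"
  proof
    fix m n assume "m \<in> ?S" "n \<in> ?S" and eq: "?u m = ?u n"
    have "multiplicity q m = multiplicity q n" if "q \<in> D" for q
      using fun_cong[OF eq, of q] that by simp
    then show "m = n" using fact[OF \<open>m \<in> ?S\<close>] fact[OF \<open>n \<in> ?S\<close>] by (metis (no_types, lifting) prod.cong)
  qed
  have sub: "?u ` ?S \<subseteq> PiE D (\<lambda>_. {1..J})"
  proof
    fix v assume "v \<in> ?u ` ?S"
    then obtain n where n: "n \<in> A" "prime_factors n = D" "v = ?u n" by auto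
    have "multiplicity q n \<in> {1..J}" if qD: "q \<in> D" for q
    proof -
      have "n \<noteq> 0" using n(1) A(2) by metis
      then have q: "prime q" "q dvd n" "n \<noteq> 0" using qD n(2) by (auto simp: in_prime_factors_iff)
      have "multiplicity q n \<ge> 1"
        using qD n(2) by (auto simp: prime_factors_multiplicity)
      moreover have "multiplicity q n < 2 ^ multiplicity q n" by (rule less_exp)
      moreover have "2 ^ multiplicity q n \<le> q ^ multiplicity q n"
        using prime_ge_2_nat[OF q(1)] by (rule power_mono) simp
      moreover have "q ^ multiplicity q n \<le> n" using q by (intro dvd_imp_le multiplicity_dvd) auto
      ultimately have "1 \<le> multiplicity q n" "multiplicity q n \<le> J" using J[OF n(1)] by linarith+
      then show ?thesis by simp
    qed
    then show "v \<in> PiE D (\<lambda>_. {1..J})" unfolding n(3) by auto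
  qed
  have "(\<Sum>n\<in>?S. 1 / real n) = (\<Sum>n\<in>?S. \<Prod>q\<in>D. (1 / real q) ^ ?u n q)"
  proof (intro sum.cong refl)
    fix n assume n: "n \<in> ?S"
    have "real n = (\<Prod>q\<in>D. real q ^ multiplicity q n)"
      by (subst fact[OF n]) simp
    then show "1 / real n = (\<Prod>q\<in>D. (1 / real q) ^ ?u n q)"
      by (simp add: prod_dividef power_divide)
  qed
  also have "\<dots> = (\<Sum>v\<in>?u ` ?S. \<Prod>q\<in>D. (1 / real q) ^ v q)"
    using sum.reindex[OF inj, of "\<lambda>v. \<Prod>q\<in>D. (1 / real q) ^ v q"] by (simp add: o_def)
  also have "\<dots> \<le> (\<Sum>v\<in>PiE D (\<lambda>_. {1..J}). \<Prod>q\<in>D. (1 / real q) ^ v q)"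
    using sub D(1) by (intro sum_mono2) (auto intro!: finite_PiE prod_nonneg)
  also have "\<dots> = (\<Prod>q\<in>D. \<Sum>j=1..J. (1 / real q) ^ j)"
    using D(1) by (subst prod_sum_PiE) auto
  also have "\<dots> \<le> (\<Prod>q\<in>D. 1 / (real q - 1))"
    using D(2) by (intro prod_mono conjI sum_nonneg sum_geometric_inverse_le) (auto intro: prime_ge_2_nat)
  finally show ?thesis .
qed

text \<open>Sorting the integers up to \<open>z\<close> by their sets of prime factors shows that
  the sum dominates the harmonic sum: the radical of \<open>n\<close> is at most \<open>n\<close>,
  so every such set is in the family. The summand is the sieve density for one removed class per
  prime.\<close>

lemma ln_le_sum_bounded_prime_sets:
  fixes z :: real
  assumes z: "z \<ge> 1" and P: "finite P" "\<And>q. q \<in> P \<Longrightarrow> prime q" and sub: "\<And>q. prime q \<Longrightarrow> real q \<le> z \<Longrightarrow> q \<in> P"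
  shows "ln z \<le> (\<Sum>D\<in>bounded_prime_sets P z. \<Prod>q\<in>D. 1 / (real q - 1))"
proof -
  let ?Z = "nat \<lfloor>z\<rfloor>"
  have "prime_factors n \<in> bounded_prime_sets P z" if "n \<in> {1..?Z}" for n
  proof -
    have n: "n > 0" "real n \<le> z" using that z by (auto simp: le_nat_iff le_floor_iff)
    have "\<Prod>(prime_factors n) dvd n"
    proof -
      have "(\<Prod>q\<in>prime_factors n. q) dvd (\<Prod>q\<in>prime_factors n. q ^ multiplicity q n)"
        by (rule prod_dvd_prod) (auto simp: prime_factors_multiplicity dvd_power)
      then show ?thesis using n prime_factorization_nat[of n] by simp
    qed
    then have "\<Prod>(prime_factors n) \<le> n" using n by (auto intro: dvd_imp_le)
    then have "real (\<Prod>(prime_factors n)) \<le> z" using n(2) by (metis of_nat_le_iff order_trans)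
    moreover have "prime_factors n \<subseteq> P"
    proof
      fix q assume "q \<in> prime_factors n"
      then have "prime q" "q \<le> n" using n by (auto simp: prime_factors_dvd intro: dvd_imp_le)
      then show "q \<in> P" using n(2) by (intro sub) auto
    qed
    ultimately show ?thesis by (simp add: bounded_prime_sets_def)
  qed
  then have img: "prime_factors ` {1..?Z} \<subseteq> bounded_prime_sets P z" by blast
  have "ln z \<le> ln (real ?Z + 1)" using z by (intro ln_mono) linarith+
  also have "\<dots> \<le> harm ?Z" by (rule ln_le_harm)
  also have "\<dots> = (\<Sum>n\<in>{1..?Z}. 1 / real n)" by (simp add: harm_def inverse_eq_divide)
  also have "\<dots> = (\<Sum>D\<in>bounded_prime_sets P z. \<Sum>n | n \<in> {1..?Z} \<and> prime_factors n = D. 1 / real n)"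
    using P img by (subst sum.group[symmetric, OF _ _ img]) (auto simp: finite_bounded_prime_sets)
  also have "\<dots> \<le> (\<Sum>D\<in>bounded_prime_sets P z. \<Prod>q\<in>D. 1 / (real q - 1))"
  proof (intro sum_mono sum_inverse_fixed_prime_factors_le)
    fix D assume "D \<in> bounded_prime_sets P z"
    then have "D \<subseteq> P" by (simp add: bounded_prime_sets_def)
    then show "finite D" "\<And>q. q \<in> D \<Longrightarrow> prime q" using P finite_subset by auto
  qed auto
  finally show ?thesis .
qed

lemma prod_primes_subset_le:
  fixes D E :: "nat set"
  assumes "finite D" "E \<subseteq> D" "\<And>q. q \<in> D \<Longrightarrow> prime q"
  shows "\<Prod>E \<le> \<Prod>D"
  using assms by (intro dvd_imp_le prod_dvd_prod_subset prod_pos) (auto intro!: prime_gt_0_nat)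

text \<open>Split \<open>D\<close> into \<open>D \<inter> R\<close> and \<open>D - R\<close>: the
  first part is some subset of \<open>R\<close>, the second still has product at most
  \<open>z\<close>. This bounds the cost of not sieving by the primes in \<open>R\<close>.\<close>

lemma sum_bounded_prime_sets_remove:
  fixes h :: "nat \<Rightarrow> real"
  assumes P: "finite P" "\<And>q. q \<in> P \<Longrightarrow> prime q" and h: "\<And>q. q \<in> P \<Longrightarrow> 0 \<le> h q"
    and R: "R \<subseteq> P"
  shows "(\<Sum>D\<in>bounded_prime_sets P z. \<Prod>q\<in>D. h q)
    \<le> (\<Prod>q\<in>R. 1 + h q) * (\<Sum>D\<in>bounded_prime_sets (P - R) z. \<Prod>q\<in>D. h q)"
proof -
  let ?B = "bounded_prime_sets P z" and ?f = "\<lambda>D. (D \<inter> R, D - R)" and ?h = "\<lambda>D. \<Prod>q\<in>D. h q"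
  have finR: "finite R" using P R finite_subset by blast
  have inj: "inj_on ?f ?B" by (intro inj_onI) (simp, blast)
  have img: "?f ` ?B \<subseteq> Pow R \<times> bounded_prime_sets (P - R) z"
  proof safe
    fix D assume D: "D \<in> ?B"
    then have "D \<subseteq> P" "finite D" using P finite_subset by (auto simp: bounded_prime_sets_def)
    then have "\<Prod>(D - R) \<le> \<Prod>D" using P by (intro prod_primes_subset_le) auto
    then have "real (\<Prod>(D - R)) \<le> real (\<Prod>D)" by (simp only: of_nat_le_iff)
    then show "D - R \<in> bounded_prime_sets (P - R) z" using D by (auto simp: bounded_prime_sets_def)
  qed
  have "(\<Sum>D\<in>?B. ?h D) = (\<Sum>D\<in>?B. ?h (fst (?f D)) * ?h (snd (?f D)))"
  proof (intro sum.cong refl)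
    fix D assume "D \<in> ?B"
    then have "finite D" using P finite_subset by (auto simp: bounded_prime_sets_def)
    then show "?h D = ?h (fst (?f D)) * ?h (snd (?f D))"
      by (simp add: prod.Int_Diff[of D h R])
  qed
  also have "\<dots> = (\<Sum>x\<in>?f ` ?B. ?h (fst x) * ?h (snd x))"
    by (subst sum.reindex[OF inj]) (simp add: o_def)
  also have "\<dots> \<le> (\<Sum>x\<in>Pow R \<times> bounded_prime_sets (P - R) z. ?h (fst x) * ?h (snd x))"
  proof (rule sum_mono2[OF _ img])
    show "finite (Pow R \<times> bounded_prime_sets (P - R) z)" using P finR by (simp add: finite_bounded_prime_sets)
    show "0 \<le> ?h (fst x) * ?h (snd x)" if "x \<in> Pow R \<times> bounded_prime_sets (P - R) z - ?f ` ?B" for x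
    proof -
      from that have "x \<in> Pow R \<times> bounded_prime_sets (P - R) z" by (rule DiffD1)
      then have "fst x \<subseteq> P" "snd x \<subseteq> P" using R by (auto simp: bounded_prime_sets_def)
      then show ?thesis using h by (intro mult_nonneg_nonneg prod_nonneg) blast+
    qed
  qed
  also have "\<dots> = (\<Sum>X\<in>Pow R. ?h X) * (\<Sum>D\<in>bounded_prime_sets (P - R) z. ?h D)"
    unfolding sum_product sum.cartesian_product by (simp add: case_prod_unfold)
  finally show ?thesis by (simp add: sum_Pow_prod[OF finR])
qed

text \<open>A prime of \<open>D - R\<close> lies in \<open>A\<close> only, in \<open>B\<close> only,
  or in both, giving \<open>f + f + f\<^sup>2\<close>; a prime of \<open>D \<inter> R\<close> can
  lie only in \<open>A\<close>.\<close>

lemma sum_prod_union_eq: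
  fixes f :: "nat \<Rightarrow> real"
  assumes D: "finite D"
  shows "(\<Sum>B\<in>Pow (D - R). \<Sum>A | A \<union> B = D. (\<Prod>q\<in>A. f q) * (\<Prod>q\<in>B. f q))
    = (\<Prod>q\<in>D \<inter> R. f q) * (\<Prod>q\<in>D - R. 2 * f q + f q ^ 2)"
proof -
  let ?f = "\<lambda>A. \<Prod>q\<in>A. f q"
  have inner: "(\<Sum>A | A \<union> B = D. ?f A * ?f B) = ?f (D - B) * (\<Prod>q\<in>B. f q * (1 + f q))" if "B \<subseteq> D" for B
  proof -
    have finB: "finite B" using that D finite_subset by blast
    have bij: "bij_betw (\<lambda>X. (D - B) \<union> X) (Pow B) {A. A \<union> B = D}"
      by (rule bij_betwI[where g = "\<lambda>A. A \<inter> B"]) (use that in auto)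
    have "(\<Sum>A | A \<union> B = D. ?f A * ?f B) = (\<Sum>X\<in>Pow B. ?f ((D - B) \<union> X) * ?f B)"
      using sum.reindex_bij_betw[OF bij, of "\<lambda>A. ?f A * ?f B"] by simp
    also have "\<dots> = (\<Sum>X\<in>Pow B. ?f (D - B) * ?f B * ?f X)"
    proof (intro sum.cong refl)
      fix X assume "X \<in> Pow B"
      then have "?f ((D - B) \<union> X) = ?f (D - B) * ?f X"
        using D finB finite_subset by (intro prod.union_disjoint) auto
      then show "?f ((D - B) \<union> X) * ?f B = ?f (D - B) * ?f B * ?f X" by simp
    qed
    also have "\<dots> = ?f (D - B) * ?f B * (\<Prod>q\<in>B. 1 + f q)"
      using sum_Pow_prod[OF finB] by (simp flip: sum_distrib_left)
    finally show ?thesis by (simp add: prod.distrib mult_ac)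
  qed
  have "(\<Sum>B\<in>Pow (D - R). \<Sum>A | A \<union> B = D. ?f A * ?f B)
      = (\<Sum>B\<in>Pow (D - R). ?f (D \<inter> R) * ((\<Prod>q\<in>B. f q * (1 + f q)) * ?f (D - R - B)))"
  proof (intro sum.cong refl)
    fix B assume B: "B \<in> Pow (D - R)"
    then have BD: "B \<subseteq> D" by auto
    have "D - B = (D \<inter> R) \<union> (D - R - B)" using B by auto
    then have "?f (D - B) = ?f ((D \<inter> R) \<union> (D - R - B))" by simp
    also have "\<dots> = ?f (D \<inter> R) * ?f (D - R - B)"
      using D by (intro prod.union_disjoint) auto
    finally show "(\<Sum>A | A \<union> B = D. ?f A * ?f B) = ?f (D \<inter> R) * ((\<Prod>q\<in>B. f q * (1 + f q)) * ?f (D - R - B))"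
      using inner[of B] BD by (simp add: mult_ac)
  qed
  also have "\<dots> = ?f (D \<inter> R) * (\<Prod>q\<in>D - R. f q * (1 + f q) + f q)"
    using D by (subst prod_add) (auto simp: sum_distrib_left)
  finally show ?thesis by (simp add: algebra_simps power2_eq_square)
qed

text \<open>Two one-dimensional sums are multiplied and sorted by the union
  \<open>A \<union> B\<close>, whose product is at most \<open>y * y\<close>. The resulting local
  factor \<open>(1 + f)\<^sup>2 - 1\<close> is at most \<open>2 / (q - 2)\<close>, the density for
  two removed classes. Primes in \<open>R\<close> lose one class and are therefore left out of the
  second factor.\<close>

lemma sum_bounded_prime_sets_dimension_two:
  assumes P: "finite P" "\<And>q. q \<in> P \<Longrightarrow> prime q" and R: "\<And>q. q \<in> P - R \<Longrightarrow> q > 2" and y: "y \<ge> 0"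
  shows "(\<Sum>A\<in>bounded_prime_sets P y. \<Prod>q\<in>A. 1 / (real q - 1)) *
      (\<Sum>B\<in>bounded_prime_sets (P - R) y. \<Prod>q\<in>B. 1 / (real q - 1))
    \<le> (\<Sum>D\<in>bounded_prime_sets P (y * y). \<Prod>q\<in>D. if q \<in> R then 1 / (real q - 1) else 2 / (real q - 2))"
proof -
  define f where "f q = 1 / (real q - 1)" for q
  let ?f = "\<lambda>A. \<Prod>q\<in>A. f q" and ?h = "\<lambda>q. if q \<in> R then f q else 2 / (real q - 2)"
  let ?X = "bounded_prime_sets (P - R) y \<times> bounded_prime_sets P y"
  let ?T = "bounded_prime_sets P (y * y)"
  have fpos: "f q > 0" if "q \<in> P" for q
    using prime_ge_2_nat[OF P(2)[OF that]] by (simp add: f_def)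
  have img: "(\<lambda>(B, A). A \<union> B) ` ?X \<subseteq> ?T"
  proof safe
    fix A B assume AB: "B \<in> bounded_prime_sets (P - R) y" "A \<in> bounded_prime_sets P y"
    have "\<Prod>(A \<union> B) dvd \<Prod>A * \<Prod>B"
    proof -
      have "A \<union> B = A \<union> (B - A)" by auto
      moreover have "\<Prod>(A \<union> (B - A)) = \<Prod>A * \<Prod>(B - A)"
        using AB P by (intro prod.union_disjoint) (auto simp: bounded_prime_sets_def intro: finite_subset)
      moreover have "\<Prod>(B - A) dvd \<Prod>B"
        using AB P by (intro prod_dvd_prod_subset) (auto simp: bounded_prime_sets_def intro: finite_subset)
      ultimately show ?thesis by (simp add: mult_dvd_mono)
    qed
    moreover have "\<Prod>A * \<Prod>B > 0"
      using AB P(2) by (intro mult_pos_pos prod_pos) (auto simp: bounded_prime_sets_def intro!: prime_gt_0_nat)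
    ultimately have "\<Prod>(A \<union> B) \<le> \<Prod>A * \<Prod>B" by (intro dvd_imp_le)
    then have "real (\<Prod>(A \<union> B)) \<le> real (\<Prod>A * \<Prod>B)" by (simp only: of_nat_le_iff)
    also have "\<dots> = real (\<Prod>A) * real (\<Prod>B)" by (rule of_nat_mult)
    also have "\<dots> \<le> y * y"
      using AB y by (intro mult_mono) (auto simp: bounded_prime_sets_def simp del: of_nat_prod)
    finally show "A \<union> B \<in> ?T" using AB by (auto simp: bounded_prime_sets_def)
  qed
  have "(\<Sum>A\<in>bounded_prime_sets P y. ?f A) * (\<Sum>B\<in>bounded_prime_sets (P - R) y. ?f B)
      = (\<Sum>B\<in>bounded_prime_sets (P - R) y. ?f B) * (\<Sum>A\<in>bounded_prime_sets P y. ?f A)"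
    by (rule mult.commute)
  also have "\<dots> = (\<Sum>x\<in>?X. ?f (snd x) * ?f (fst x))"
    unfolding sum_product sum.cartesian_product by (simp add: case_prod_unfold mult.commute)
  also have "\<dots> = (\<Sum>D\<in>?T. \<Sum>x | x \<in> ?X \<and> (\<lambda>(B, A). A \<union> B) x = D. ?f (snd x) * ?f (fst x))"
    using P by (subst sum.group[symmetric, OF _ _ img]) (auto simp: finite_bounded_prime_sets)
  also have "\<dots> \<le> (\<Sum>D\<in>?T. \<Prod>q\<in>D. ?h q)"
  proof (intro sum_mono)
    fix D assume "D \<in> ?T"
    then have D: "D \<subseteq> P" "finite D" using P finite_subset by (auto simp: bounded_prime_sets_def)
    have fin: "finite {A. A \<union> B = D}" for B using D by (auto intro: finite_subset[of _ "Pow D"])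
    have "(\<Sum>x | x \<in> ?X \<and> (\<lambda>(B, A). A \<union> B) x = D. ?f (snd x) * ?f (fst x))
       \<le> (\<Sum>x\<in>(SIGMA B:Pow (D - R). {A. A \<union> B = D}). ?f (snd x) * ?f (fst x))"
    proof (rule sum_mono2)
      show "finite (SIGMA B:Pow (D - R). {A. A \<union> B = D})" using D fin by auto
      show "{x. x \<in> ?X \<and> (\<lambda>(B, A). A \<union> B) x = D} \<subseteq> (SIGMA B:Pow (D - R). {A. A \<union> B = D})"
        by (auto simp: bounded_prime_sets_def)
      show "0 \<le> ?f (snd x) * ?f (fst x)"
        if "x \<in> (SIGMA B:Pow (D - R). {A. A \<union> B = D}) - {x. x \<in> ?X \<and> (\<lambda>(B, A). A \<union> B) x = D}" for x
        using that D fpos by (intro mult_nonneg_nonneg prod_nonneg) (auto intro!: less_imp_le)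
    qed
    also have "\<dots> = (\<Sum>B\<in>Pow (D - R). \<Sum>A | A \<union> B = D. ?f A * ?f B)"
      using D fin by (subst sum.Sigma) (auto simp: case_prod_unfold)
    also have "\<dots> = ?f (D \<inter> R) * (\<Prod>q\<in>D - R. 2 * f q + f q ^ 2)"
      by (rule sum_prod_union_eq[OF D(2)])
    also have "\<dots> \<le> ?f (D \<inter> R) * (\<Prod>q\<in>D - R. 2 / (real q - 2))"
    proof (intro mult_left_mono prod_mono conjI prod_nonneg)
      fix q assume q: "q \<in> D - R"
      then have "q \<ge> 3" using R[of q] D by auto
      then have q3: "real q \<ge> 3" by simp
      have "2 * (1 / s) + (1 / s)\<^sup>2 \<le> 2 / (s - 1)" if "s > 1" for s :: real
        using that by (simp add: field_simps power2_eq_square)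
      from this[of "real q - 1"] show "2 * f q + f q ^ 2 \<le> 2 / (real q - 2)"
        using q3 by (simp add: f_def)
      show "0 \<le> 2 * f q + f q ^ 2" using fpos[of q] q D by auto
    next
      show "\<And>q. q \<in> D \<inter> R \<Longrightarrow> 0 \<le> f q" using fpos D by (auto intro: less_imp_le)
    qed
    also have "\<dots> = (\<Prod>q\<in>D. ?h q)"
      using D by (subst prod.Int_Diff[of D _ R]) (auto intro!: arg_cong2[where f = "(*)"] prod.cong)
    finally show "(\<Sum>x | x \<in> ?X \<and> (\<lambda>(B, A). A \<union> B) x = D. ?f (snd x) * ?f (fst x)) \<le> (\<Prod>q\<in>D. ?h q)" .
  qed
  finally show ?thesis unfolding f_def .
qed

section \<open>Primes in residue classes and prime pairs\<close>

text \<open>For positive \<open>n\<close> this is \<open>n / \<phi> n\<close>. The product form is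
  the one in which it arises: each prime dropped from a sieve costs the factor
  \<open>1 + 1 / (q - 1)\<close>.\<close>

definition totient_ratio :: "nat \<Rightarrow> real" where
  "totient_ratio n = (\<Prod>q\<in>prime_factors n. real q / (real q - 1))"

lemma prime_ratio_ge_1: "prime (q::nat) \<Longrightarrow> 1 \<le> real q / (real q - 1)"
  using prime_ge_2_nat[of q] by simp

lemma totient_ratio_ge_1: "totient_ratio n \<ge> 1"
  unfolding totient_ratio_def by (intro prod_ge_1 prime_ratio_ge_1) (auto simp: in_prime_factors_iff)

text \<open>The level \<open>z = N powr (1/8)\<close> makes the sieve error \<open>z ^ 4\<close>
  equal to \<open>sqrt N\<close>, which is negligible in dimensions one and two. The root
  \<open>N powr (1/16)\<close> serves the two-dimensional sum, where two sets of product at most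
  \<open>y\<close> only reach level \<open>y * y\<close>.\<close>

lemma sieve_level_bounds:
  fixes N :: nat
  assumes "N \<ge> 2"
  shows "sqrt N \<le> 2 * N / ln N" "sqrt N \<le> 16 * N / (ln N)\<^sup>2"
    "N powr (1/8) \<ge> 1" "N powr (1/16) \<ge> 1" "(N powr (1/8)) ^ 4 = sqrt N" "N powr (1/8) \<le> sqrt N"
    "N powr (1/16) * N powr (1/16) = N powr (1/8)"
proof -
  have N: "real N > 1" using assms by simp
  have ln: "ln N > 0" using N by simp
  have ss: "sqrt N * sqrt N = N" by simp
  have "ln N = 2 * ln (sqrt N)" using N by (simp add: ln_sqrt)
  also have "ln (sqrt N) \<le> sqrt N - 1" using N by (intro ln_le_minus_one) simp
  finally have "ln N \<le> 2 * sqrt N" by simp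
  then have "sqrt N * ln N \<le> sqrt N * (2 * sqrt N)" by (intro mult_left_mono) auto
  also have "\<dots> = 2 * N" using ss by (simp only: mult.left_commute[of "sqrt N"])
  finally show "sqrt N \<le> 2 * N / ln N" using ln by (simp add: field_simps)
  have r: "real N powr (1/4) \<ge> 1" using N by (intro ge_one_powr_ge_zero) auto
  have "ln N = 4 * ln (N powr (1/4))" using N by (simp add: ln_powr)
  also have "ln (N powr (1/4)) \<le> N powr (1/4) - 1" using N by (intro ln_le_minus_one) simp
  finally have "ln N \<le> 4 * N powr (1/4)" by simp
  then have "(ln N)\<^sup>2 \<le> (4 * N powr (1/4))\<^sup>2" using ln by (intro power_mono) auto
  also have "\<dots> = 16 * sqrt N"
    using N by (simp add: power_mult_distrib powr_half_sqrt[symmetric] power2_eq_square flip: powr_add)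
  finally have "sqrt N * (ln N)\<^sup>2 \<le> sqrt N * (16 * sqrt N)" by (intro mult_left_mono) auto
  also have "\<dots> = 16 * N" using ss by (simp only: mult.left_commute[of "sqrt N"])
  finally show "sqrt N \<le> 16 * N / (ln N)\<^sup>2" using ln by (simp add: field_simps)
  show "N powr (1/8) \<ge> 1" "N powr (1/16) \<ge> 1" using N by (auto intro: ge_one_powr_ge_zero)
  show "(N powr (1/8)) ^ 4 = sqrt N"
    using N by (simp add: powr_half_sqrt[symmetric] powr_power)
  show "N powr (1/8) \<le> sqrt N" using N by (simp add: powr_half_sqrt[symmetric] powr_mono)
  show "N powr (1/16) * N powr (1/16) = N powr (1/8)" by (simp flip: powr_add)
qed

lemma ln_div_totient_ratio_le_sum:
  fixes z :: real and M :: nat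
  assumes M: "M > 0" and z: "z \<ge> 1" and P: "finite P" "\<And>q. q \<in> P \<Longrightarrow> prime q" and sub: "\<And>q. prime q \<Longrightarrow> real q \<le> z \<Longrightarrow> q \<in> P"
  shows "ln z / totient_ratio M \<le>
    (\<Sum>D\<in>bounded_prime_sets (P - {q \<in> P. q dvd M}) z. \<Prod>q\<in>D. 1 / (real q - 1))"
proof -
  let ?R = "{q \<in> P. q dvd M}"
  let ?L = "\<Sum>D\<in>bounded_prime_sets (P - ?R) z. \<Prod>q\<in>D. 1 / (real q - 1)"
  have L0: "?L \<ge> 0"
  proof (intro sum_nonneg prod_nonneg)
    fix D q assume "D \<in> bounded_prime_sets (P - ?R) z" "q \<in> D"
    then have "prime q" using P(2) by (auto simp: bounded_prime_sets_def)
    then show "0 \<le> 1 / (real q - 1)" using prime_ge_2_nat[of q] by simp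
  qed
  have "ln z \<le> (\<Sum>D\<in>bounded_prime_sets P z. \<Prod>q\<in>D. 1 / (real q - 1))"
    using assms by (intro ln_le_sum_bounded_prime_sets) auto
  also have "\<dots> \<le> (\<Prod>q\<in>?R. 1 + 1 / (real q - 1)) * ?L"
  proof (rule sum_bounded_prime_sets_remove)
    show "0 \<le> 1 / (real q - 1)" if "q \<in> P" for q using prime_ge_2_nat[OF P(2)[OF that]] by simp
  qed (use P in auto)
  also have "(\<Prod>q\<in>?R. 1 + 1 / (real q - 1)) = (\<Prod>q\<in>?R. real q / (real q - 1))"
  proof (intro prod.cong refl)
    fix q assume "q \<in> ?R"
    then show "1 + 1 / (real q - 1) = real q / (real q - 1)" using prime_ge_2_nat[of q] P by (auto simp: field_simps)
  qed
  also have "\<dots> * ?L \<le> totient_ratio M * ?L"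
    unfolding totient_ratio_def using P(2) M
    by (intro mult_right_mono[OF _ L0] prod_mono2)
      (auto simp: in_prime_factors_iff intro: prime_ratio_ge_1 order_trans[OF zero_le_one prime_ratio_ge_1])
  finally show ?thesis using totient_ratio_ge_1[of M] by (simp add: field_simps)
qed

lemma card_linear_residue:
  fixes M b q :: nat
  assumes "coprime M q" "q > 0"
  shows "card {r. r < q \<and> q dvd b + M * r} = 1"
proof -
  let ?f = "\<lambda>r. (b + M * r) mod q"
  have inj: "inj_on ?f {..<q}"
  proof
    fix r s assume rs: "r \<in> {..<q}" "s \<in> {..<q}" "?f r = ?f s"
    then have "[b + M * r = b + M * s] (mod q)" by (simp add: Cong.cong_def)
    then have "[r = s] (mod q)" using assms by (simp add: cong_add_lcancel_nat cong_mult_lcancel_nat)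
    then show "r = s" using rs by (simp add: Cong.cong_def)
  qed
  have "?f ` {..<q} = {..<q}" using assms(2) by (intro endo_inj_surj inj) auto
  moreover have "0 \<in> {..<q}" using assms(2) by simp
  ultimately have "0 \<in> ?f ` {..<q}" by (simp only:)
  then obtain r where r: "r < q" "?f r = 0" by auto
  have "{r. r < q \<and> q dvd b + M * r} = {r}"
  proof (intro equalityI subsetI)
    fix s assume "s \<in> {r. r < q \<and> q dvd b + M * r}"
    then have s: "s < q" "?f s = ?f r" using r(2) dvd_imp_mod_0[of q "b + M * s"] by (simp_all only: mem_Collect_eq)
    show "s \<in> {r}" using inj_onD[OF inj s(2)] s(1) r(1) by simp
  next
    fix s assume "s \<in> {r}"
    then show "s \<in> {r. r < q \<and> q dvd b + M * r}" using r mod_0_imp_dvd[of "b + M * r" q] by simp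
  qed
  then show ?thesis by simp
qed

text \<open>Brun-Titchmarsh with a generous constant. The quotients \<open>n = p div M\<close> are
  sieved: each prime \<open>q\<close> up to \<open>z\<close> not dividing \<open>M\<close> forbids
  the one class with \<open>q dvd b + M * n\<close>. Primes up to \<open>z\<close> are struck out
  along with the composites and are counted separately.\<close>

lemma card_primes_residue_class_le:
  fixes M b x :: nat
  assumes M: "M > 0" and x: "x \<ge> 2" "x \<ge> M ^ 2"
  shows "real (card {p. prime p \<and> p \<le> x \<and> p mod M = b}) \<le> 48 * totient_ratio M * real x / (real M * ln x)"
proof -
  define N where "N = x div M + 1"
  have xM: "x \<ge> M" using x(2) M by (metis le_square order_trans power2_eq_square)
  have N2: "N \<ge> 2" using xM M unfolding N_def by (simp add: div_greater_zero_iff Suc_le_eq)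
  define z where "z = real N powr (1/8)"
  have z: "z \<ge> 1" "z ^ 4 = sqrt N" "z \<le> sqrt N" using sieve_level_bounds[OF N2] by (auto simp: z_def)
  define P where "P = {q. prime q \<and> real q \<le> z}"
  have finP: "finite P"
    by (rule finite_subset[of _ "{..nat \<lfloor>z\<rfloor>}"]) (auto simp: P_def le_nat_iff le_floor_iff)
  let ?Q = "P - {q \<in> P. q dvd M}"
  let ?\<Omega> = "\<lambda>q. {r. r < q \<and> q dvd b + M * r}"
  let ?L = "\<Sum>D\<in>bounded_prime_sets ?Q z. \<Prod>q\<in>D. 1 / (real q - 1)"
  have card1: "card (?\<Omega> q) = 1" if "q \<in> ?Q" for q
  proof (rule card_linear_residue)
    show "coprime M q" using that by (metis (no_types, lifting) DiffE P_def coprime_commute mem_Collect_eq prime_imp_coprime)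
    show "q > 0" using that by (auto simp: P_def intro: prime_gt_0_nat)
  qed
  have sieve: "real (card {n. n < N \<and> (\<forall>q\<in>?Q. n mod q \<notin> ?\<Omega> q)}) \<le> real N / ?L + z ^ 4"
  proof -
    have "real (card {n. n < N \<and> (\<forall>q\<in>?Q. n mod q \<notin> ?\<Omega> q)}) \<le>
      real N / (\<Sum>D\<in>bounded_prime_sets ?Q z. \<Prod>q\<in>D. real (card (?\<Omega> q)) / (real q - real (card (?\<Omega> q)))) + z ^ 4"
    proof (rule selberg_sieve)
      show "?\<Omega> q \<noteq> {}" if "q \<in> ?Q" for q using card1[OF that] by (metis card.empty zero_neq_one)
      show "card (?\<Omega> q) < q" if "q \<in> ?Q" for q
        unfolding card1[OF that] using that prime_gt_1_nat by (auto simp: P_def)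
    qed (use finP z in \<open>auto simp: P_def\<close>)
    also have "(\<Sum>D\<in>bounded_prime_sets ?Q z. \<Prod>q\<in>D. real (card (?\<Omega> q)) / (real q - real (card (?\<Omega> q)))) = ?L"
    proof (intro sum.cong prod.cong refl)
      fix D q assume "D \<in> bounded_prime_sets ?Q z" "q \<in> D"
      then have "q \<in> ?Q" by (auto simp: bounded_prime_sets_def)
      from card1[OF this] show "real (card (?\<Omega> q)) / (real q - real (card (?\<Omega> q))) = 1 / (real q - 1)" by simp
    qed
    finally show ?thesis .
  qed
  let ?A = "{p. prime p \<and> p \<le> x \<and> p mod M = b}"
  let ?S = "{n. n < N \<and> (\<forall>q\<in>?Q. n mod q \<notin> ?\<Omega> q)}"
  have "card {p \<in> ?A. real p > z} \<le> card ?S"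
  proof (rule card_inj_on_le[where f = "\<lambda>p. p div M"])
    show "inj_on (\<lambda>p. p div M) {p \<in> ?A. real p > z}"
    proof
      fix p p' assume "p \<in> {p \<in> ?A. real p > z}" "p' \<in> {p \<in> ?A. real p > z}" "p div M = p' div M"
      then have "p div M = p' div M" "p mod M = p' mod M" by auto
      then show "p = p'" by (metis div_mult_mod_eq)
    qed
    show "(\<lambda>p. p div M) ` {p \<in> ?A. real p > z} \<subseteq> ?S"
    proof
      fix n assume "n \<in> (\<lambda>p. p div M) ` {p \<in> ?A. real p > z}"
      then obtain p where n: "n = p div M" and p: "prime p" "p \<le> x" "z < real p" "p mod M = b" by auto
      have "n < N" using p(2) n by (simp add: N_def div_le_mono less_Suc_eq_le)
      moreover have "n mod q \<notin> ?\<Omega> q" if q: "q \<in> ?Q" for q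
      proof
        assume "n mod q \<in> ?\<Omega> q"
        then have dvd: "q dvd b + M * (n mod q)" by simp
        have "[b + M * (n mod q) = b + M * n] (mod q)"
          by (intro cong_add cong_mult) (auto simp: Cong.cong_def)
        then have "q dvd b + M * n" using dvd cong_dvd_iff by blast
        also have "b + M * n = p" unfolding n p(4)[symmetric] by simp
        finally have "q = p" using p(1) q primes_dvd_imp_eq by (auto simp: P_def)
        then show False using q p(3) by (auto simp: P_def)
      qed
      ultimately show "n \<in> ?S" by blast
    qed
  qed simp
  moreover have "card {p \<in> ?A. real p \<le> z} \<le> card {1..nat \<lfloor>z\<rfloor>}"
    by (intro card_mono) (auto simp: le_nat_iff le_floor_iff Suc_le_eq intro: prime_gt_0_nat)
  moreover have "real (nat \<lfloor>z\<rfloor>) \<le> z" using z by simp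
  moreover have "card ?A \<le> card {p \<in> ?A. real p > z} + card {p \<in> ?A. real p \<le> z}"
  proof -
    have "?A = {p \<in> ?A. real p > z} \<union> {p \<in> ?A. real p \<le> z}" by auto
    then show ?thesis by (metis (no_types, lifting) card_Un_le)
  qed
  ultimately have "real (card ?A) \<le> real N / ?L + z ^ 4 + z" using sieve by simp
  also have "\<dots> \<le> real N / ?L + 2 * sqrt N" using z by simp
  also have "real N / ?L \<le> 8 * totient_ratio M * N / ln N"
  proof -
    have "ln z / totient_ratio M \<le> ?L"
      using M z finP by (intro ln_div_totient_ratio_le_sum) (auto simp: P_def)
    moreover have "ln z = ln N / 8" using N2 by (simp add: z_def ln_powr)
    ultimately have "ln N / 8 / totient_ratio M \<le> ?L" by simp
    moreover have "ln N / 8 / totient_ratio M > 0" using N2 totient_ratio_ge_1[of M] by simp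
    ultimately have "real N / ?L \<le> real N / (ln N / 8 / totient_ratio M)"
      by (intro frac_le) simp_all
    then show ?thesis by (simp add: mult_ac)
  qed
  also have "2 * sqrt N \<le> 4 * totient_ratio M * N / ln N"
  proof -
    have "2 * sqrt N \<le> 1 * (4 * N / ln N)" using sieve_level_bounds(1)[OF N2] by simp
    also have "\<dots> \<le> totient_ratio M * (4 * N / ln N)"
      using totient_ratio_ge_1[of M] N2 by (intro mult_right_mono) auto
    finally show ?thesis by (simp add: mult_ac)
  qed
  also have "8 * totient_ratio M * N / ln N + 4 * totient_ratio M * N / ln N = 12 * totient_ratio M * (N / ln N)"
    by (simp add: field_simps)
  \<comment> \<open>The 12 is 8 from \<open>ln z = ln N / 8\<close> plus 4 from the error terms. It
    is doubled twice: for \<open>N\<close> against \<open>x / M\<close>, and for \<open>ln N\<close>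
    against \<open>ln x\<close>, where \<open>x \<ge> M ^ 2\<close> gives
    \<open>sqrt x \<le> N\<close>.\<close>
  also have "\<dots> \<le> 12 * totient_ratio M * (2 * real x / real M / (ln x / 2))"
  proof (intro mult_left_mono frac_le)
    have "real (x div M) \<le> real x / real M" by (rule of_nat_div_le_of_nat)
    moreover have "real x / real M \<ge> 1" using xM M by simp
    ultimately show "real N \<le> 2 * real x / real M" by (simp add: N_def)
    have "x < M * N" using M unfolding N_def by (simp add: dividend_less_times_div)
    moreover have "real M \<le> sqrt x" using x(2) by (intro real_le_rsqrt) (metis of_nat_le_iff of_nat_power)
    ultimately have "real x \<le> sqrt x * real N"
      by (smt (verit) mult_right_mono of_nat_0_le_iff of_nat_less_iff of_nat_mult)
    then have "sqrt x * sqrt x \<le> sqrt x * real N" by simp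
    then have "sqrt x \<le> real N" using x(1) by (simp only: mult_le_cancel_left_pos real_sqrt_gt_0_iff)
    then have "ln (sqrt x) \<le> ln N" using x(1) by (intro ln_mono) auto
    then show "ln x / 2 \<le> ln N" using x(1) by (simp add: ln_sqrt)
  qed (use x totient_ratio_ge_1[of M] in auto)
  also have "\<dots> = 48 * totient_ratio M * real x / (real M * ln x)" by simp
  finally show ?thesis by simp
qed

text \<open>Modulo \<open>q\<close> the prime \<open>p\<close> must avoid 0 and \<open>- H\<close>,
  which coincide exactly when \<open>q\<close> divides \<open>H\<close>. Evenness of
  \<open>H\<close> puts 2 into that case; otherwise both classes modulo 2 would be removed. The 288
  is \<open>16\<^sup>2\<close> from \<open>ln y = ln N / 16\<close>, plus 32 from the error
  terms.\<close>

lemma card_prime_pairs_le: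
  fixes H N :: nat
  assumes H: "H > 0" "even H" and N2: "N \<ge> 2"
  shows "real (card {p. p < N \<and> prime p \<and> prime (p + H)}) \<le> 288 * totient_ratio H * real N / (ln N)\<^sup>2"
proof -
  define z where "z = real N powr (1/8)"
  define y where "y = real N powr (1/16)"
  have z: "z \<ge> 1" "z ^ 4 = sqrt N" "z \<le> sqrt N" and y: "y \<ge> 1" "y * y = z"
    using sieve_level_bounds[OF N2] by (auto simp: z_def y_def)
  have yz: "y \<le> z" using y by (metis mult_left_mono mult.right_neutral order_trans zero_le_one)
  define P where "P = {q. prime q \<and> real q \<le> z}"
  have finP: "finite P"
    by (rule finite_subset[of _ "{..nat \<lfloor>z\<rfloor>}"]) (auto simp: P_def le_nat_iff le_floor_iff)
  define R where "R = {q \<in> P. q dvd H}"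
  define \<Omega> where "\<Omega> q = (if q \<in> R then {0} else {0, q - H mod q})" for q
  let ?L = "\<Sum>D\<in>bounded_prime_sets P z. \<Prod>q\<in>D. if q \<in> R then 1 / (real q - 1) else 2 / (real q - 2)"
  have R2: "q > 2" if "q \<in> P - R" for q
  proof -
    have "prime q" "\<not> q dvd H" using that by (auto simp: P_def R_def)
    then have "q \<ge> 2" "q \<noteq> 2" using H(2) prime_ge_2_nat by auto
    then show ?thesis by simp
  qed
  have Hmod: "0 < H mod q" "H mod q < q" if "q \<in> P - R" for q
    using that R2[OF that] by (auto simp: P_def R_def dvd_eq_mod_eq_0)
  have card\<Omega>: "card (\<Omega> q) = (if q \<in> R then 1 else 2)" if "q \<in> P" for q
    using that Hmod[of q] by (auto simp: \<Omega>_def)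
  have sieve: "real (card {n. n < N \<and> (\<forall>q\<in>P. n mod q \<notin> \<Omega> q)}) \<le> real N / ?L + z ^ 4"
  proof -
    have "real (card {n. n < N \<and> (\<forall>q\<in>P. n mod q \<notin> \<Omega> q)}) \<le>
      real N / (\<Sum>D\<in>bounded_prime_sets P z. \<Prod>q\<in>D. real (card (\<Omega> q)) / (real q - real (card (\<Omega> q)))) + z ^ 4"
    proof (rule selberg_sieve)
      show "\<Omega> q \<subseteq> {..<q}" if "q \<in> P" for q
        using that Hmod[of q] by (auto simp: \<Omega>_def P_def prime_gt_0_nat split: if_splits)
      show "card (\<Omega> q) < q" if "q \<in> P" for q
        unfolding card\<Omega>[OF that] using that R2[of q] prime_gt_1_nat[of q] by (auto simp: P_def)
    qed (use finP z in \<open>auto simp: P_def \<Omega>_def\<close>)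
    also have "(\<Sum>D\<in>bounded_prime_sets P z. \<Prod>q\<in>D. real (card (\<Omega> q)) / (real q - real (card (\<Omega> q)))) = ?L"
    proof (intro sum.cong prod.cong refl)
      fix D q assume "D \<in> bounded_prime_sets P z" "q \<in> D"
      then have "q \<in> P" by (auto simp: bounded_prime_sets_def)
      from card\<Omega>[OF this] show "real (card (\<Omega> q)) / (real q - real (card (\<Omega> q))) =
        (if q \<in> R then 1 / (real q - 1) else 2 / (real q - 2))" by simp
    qed
    finally show ?thesis .
  qed
  let ?A = "{p. p < N \<and> prime p \<and> prime (p + H)}"
  let ?S = "{n. n < N \<and> (\<forall>q\<in>P. n mod q \<notin> \<Omega> q)}"
  have "{p \<in> ?A. real p > z} \<subseteq> ?S"
  proof safe
    fix p q assume p: "prime p" "prime (p + H)" "z < real p" and q: "q \<in> P" and mem: "p mod q \<in> \<Omega> q"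
    have qp: "prime q" "q < p" using q p(3) by (auto simp: P_def)
    have "q dvd p \<or> q dvd p + H"
    proof (cases "p mod q = 0")
      case False
      then have "q \<notin> R" "p mod q = q - H mod q" using mem by (auto simp: \<Omega>_def split: if_splits)
      then have "(p mod q + H mod q) mod q = 0" using Hmod[of q] q by simp
      then have "(p + H) mod q = 0" by (simp add: mod_add_eq)
      then show ?thesis by (simp add: dvd_eq_mod_eq_0)
    qed auto
    then show False using qp p primes_dvd_imp_eq[of q p] primes_dvd_imp_eq[of q "p + H"] by auto
  qed
  then have "card {p \<in> ?A. real p > z} \<le> card ?S" by (intro card_mono) auto
  moreover have "card {p \<in> ?A. real p \<le> z} \<le> card {1..nat \<lfloor>z\<rfloor>}"
    by (intro card_mono) (auto simp: le_nat_iff le_floor_iff Suc_le_eq intro: prime_gt_0_nat)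
  moreover have "real (nat \<lfloor>z\<rfloor>) \<le> z" using z by simp
  moreover have "card ?A \<le> card {p \<in> ?A. real p > z} + card {p \<in> ?A. real p \<le> z}"
  proof -
    have "?A = {p \<in> ?A. real p > z} \<union> {p \<in> ?A. real p \<le> z}" by auto
    then show ?thesis by (metis (no_types, lifting) card_Un_le)
  qed
  ultimately have "real (card ?A) \<le> real N / ?L + z ^ 4 + z" using sieve by simp
  also have "\<dots> \<le> real N / ?L + 2 * sqrt N" using z by simp
  also have "real N / ?L \<le> 256 * totient_ratio H * N / (ln N)\<^sup>2"
  proof -
    have 1: "ln y \<le> (\<Sum>A\<in>bounded_prime_sets P y. \<Prod>q\<in>A. 1 / (real q - 1))"
      using y yz finP by (intro ln_le_sum_bounded_prime_sets) (auto simp: P_def)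
    have 2: "ln y / totient_ratio H \<le> (\<Sum>B\<in>bounded_prime_sets (P - R) y. \<Prod>q\<in>B. 1 / (real q - 1))"
      unfolding R_def using H y yz finP by (intro ln_div_totient_ratio_le_sum) (auto simp: P_def)
    have lny: "ln y = ln N / 16" "ln y > 0" using N2 by (simp_all add: y_def ln_powr)
    have "ln y * (ln y / totient_ratio H) \<le> (\<Sum>A\<in>bounded_prime_sets P y. \<Prod>q\<in>A. 1 / (real q - 1)) *
        (\<Sum>B\<in>bounded_prime_sets (P - R) y. \<Prod>q\<in>B. 1 / (real q - 1))"
      using lny(2) 1 totient_ratio_ge_1[of H] by (intro mult_mono[OF 1 2]) (auto intro: order_trans)
    also have "\<dots> \<le> ?L"
      unfolding y(2)[symmetric] using finP R2 y by (intro sum_bounded_prime_sets_dimension_two) (auto simp: P_def)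
    finally have "(ln N)\<^sup>2 / 256 / totient_ratio H \<le> ?L" by (simp add: lny power2_eq_square)
    moreover have "(ln N)\<^sup>2 / 256 / totient_ratio H > 0" using N2 totient_ratio_ge_1[of H] by simp
    ultimately have "real N / ?L \<le> real N / ((ln N)\<^sup>2 / 256 / totient_ratio H)"
      by (intro frac_le) simp_all
    then show ?thesis by (simp add: mult_ac)
  qed
  also have "2 * sqrt N \<le> 32 * totient_ratio H * N / (ln N)\<^sup>2"
  proof -
    have "2 * sqrt N \<le> 1 * (32 * N / (ln N)\<^sup>2)" using sieve_level_bounds(2)[OF N2] by simp
    also have "\<dots> \<le> totient_ratio H * (32 * N / (ln N)\<^sup>2)"
      using totient_ratio_ge_1[of H] N2 by (intro mult_right_mono) auto
    finally show ?thesis by (simp add: mult_ac)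
  qed
  also have "256 * totient_ratio H * N / (ln N)\<^sup>2 + 32 * totient_ratio H * N / (ln N)\<^sup>2 = 288 * totient_ratio H * N / (ln N)\<^sup>2"
    by (simp add: field_simps)
  finally show ?thesis by simp
qed

section \<open>Prime factors of Mersenne numbers\<close>

lemma harm_le_1_plus_ln:
  assumes "n \<ge> 1"
  shows "harm n \<le> 1 + ln (real n)"
  using euler_mascheroni_sequence_decreasing[of 1 n] assms by (simp add: harm_expand)

lemma prime_mod_6:
  fixes q :: nat
  assumes "prime q" "q > 3"
  shows "q mod 6 = 1 \<or> q mod 6 = 5"
proof -
  have "\<not> 2 dvd q" "\<not> 3 dvd q"
    using primes_dvd_imp_eq[of 2 q] primes_dvd_imp_eq[of 3 q] assms by auto
  then show ?thesis by presburger
qed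

text \<open>All integers \<open>6 * k - 1\<close> and \<open>6 * k + 1\<close> are summed in place
  of the primes; they contribute at most \<open>1 / (4 * k)\<close> and \<open>1 / (6 * k)\<close>.
  What matters is that 5/12 is below 1/2, because the lemma is applied with
  \<open>n = t ^ 2\<close>, which doubles the logarithm.\<close>

lemma sum_inverse_coprime_6_le:
  fixes Q :: "nat set" and n :: nat
  assumes "\<And>q. q \<in> Q \<Longrightarrow> prime q \<and> 3 < q \<and> q \<le> n" "n \<ge> 1"
  shows "(\<Sum>q\<in>Q. 1 / (real q - 1)) \<le> 5 / 12 * (1 + ln (real n))"
proof -
  let ?A = "(\<lambda>k::nat. 6 * k - 1) ` {1..n}" and ?B = "(\<lambda>k::nat. 6 * k + 1) ` {1..n}"
  let ?f = "\<lambda>q. 1 / (real q - 1)"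
  have "Q \<subseteq> ?A \<union> ?B"
  proof
    fix q assume "q \<in> Q"
    then have q: "q mod 6 = 1 \<or> q mod 6 = 5" "3 < q" "q \<le> n" using assms prime_mod_6 by auto
    show "q \<in> ?A \<union> ?B"
    proof (cases "q mod 6 = 1")
      case True
      then have "q = 6 * (q div 6) + 1" by (metis div_mult_mod_eq mult.commute)
      then show ?thesis using q by (intro UnI2 image_eqI[of _ _ "q div 6"]) auto
    next
      case False
      then have "q = 6 * (q div 6 + 1) - 1" using q by presburger
      then show ?thesis using q by (intro UnI1 image_eqI[of _ _ "q div 6 + 1"]) auto
    qed
  qed
  then have "(\<Sum>q\<in>Q. ?f q) \<le> (\<Sum>q\<in>?A \<union> ?B. ?f q)" by (intro sum_mono2) auto
  also have "\<dots> \<le> (\<Sum>q\<in>?A. ?f q) + (\<Sum>q\<in>?B. ?f q)"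
    by (subst sum.union_inter[symmetric]) (auto intro!: sum_nonneg)
  also have "(\<Sum>q\<in>?A. ?f q) = (\<Sum>k=1..n. ?f (6 * k - 1))"
    by (subst sum.reindex) (auto simp: inj_on_def)
  also have "\<dots> \<le> (\<Sum>k=1..n. 1 / 4 * inverse (real k))"
  proof (intro sum_mono)
    fix k assume "k \<in> {1..n}"
    then have "real (6 * k - 1) - 1 \<ge> 4 * real k" "k \<ge> 1" by (auto simp: of_nat_diff)
    then show "?f (6 * k - 1) \<le> 1 / 4 * inverse (real k)" by (simp add: field_simps)
  qed
  also have "(\<Sum>q\<in>?B. ?f q) = (\<Sum>k=1..n. 1 / 6 * inverse (real k))"
    by (subst sum.reindex) (auto simp: inj_on_def field_simps intro!: sum.cong)
  also have "(\<Sum>k=1..n. 1 / 4 * inverse (real k)) + (\<Sum>k=1..n. 1 / 6 * inverse (real k)) = 5 / 12 * harm n"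
    unfolding harm_def sum_distrib_left[symmetric] by simp
  also have "\<dots> \<le> 5 / 12 * (1 + ln n)" using harm_le_1_plus_ln[OF assms(2)] by simp
  finally show ?thesis by simp
qed

text \<open>Any exponent below \<open>1\<close> will do; \<open>5 / 6\<close> comes from primes above \<open>3\<close> being \<open>\<plusminus>1\<close> modulo \<open>6\<close>.\<close>

lemma prod_odd_primes_ratio_le:
  fixes Q :: "nat set" and t :: nat
  assumes Q: "finite Q" "\<And>q. q \<in> Q \<Longrightarrow> prime q" "2 \<notin> Q" "card Q \<le> t ^ 2" and t: "t \<ge> 1"
  shows "(\<Prod>q\<in>Q. real q / (real q - 1)) \<le> exp 2 * t powr (5 / 6)"
proof -
  let ?f = "\<lambda>q. 1 / (real q - 1)"
  have ge2: "q \<ge> 2" if "q \<in> Q" for q using Q(2)[OF that] by (rule prime_ge_2_nat)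
  have "(\<Prod>q\<in>Q. real q / (real q - 1)) \<le> (\<Prod>q\<in>Q. exp (?f q))"
  proof (intro prod_mono conjI)
    fix q assume "q \<in> Q"
    from ge2[OF this] have "real q / (real q - 1) = 1 + ?f q" by (simp add: field_simps)
    then show "real q / (real q - 1) \<le> exp (?f q)" using exp_ge_add_one_self[of "?f q"] by simp
    show "0 \<le> real q / (real q - 1)" using ge2[OF \<open>q \<in> Q\<close>] by simp
  qed
  also have "\<dots> = exp (\<Sum>q\<in>Q. ?f q)" by (simp add: exp_sum Q)
  also have "\<dots> \<le> exp (2 + 5 / 6 * ln t)"
  proof (subst exp_le_cancel_iff)
    \<comment> \<open>The at most \<open>t ^ 2\<close> primes beyond \<open>t ^ 2\<close> contribute
      at most 1 together and the prime 3 contributes 1/2; with the 5/12 from the middle range this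
      stays below 2.\<close>
    let ?A = "{q \<in> Q. q > t ^ 2}" and ?B = "{q \<in> Q. 3 < q \<and> q \<le> t ^ 2}"
    have f0: "?f q \<ge> 0" if "q \<in> Q" for q using ge2[OF that] by simp
    have "Q \<subseteq> ?A \<union> ?B \<union> {3}"
    proof
      fix q assume "q \<in> Q"
      then have "q \<ge> 2" "q \<noteq> 2" using ge2 Q(3) by auto
      then show "q \<in> ?A \<union> ?B \<union> {3}" using \<open>q \<in> Q\<close> by auto
    qed
    then have "(\<Sum>q\<in>Q. ?f q) \<le> (\<Sum>q\<in>?A \<union> ?B \<union> {3}. ?f q)"
      using Q f0 by (intro sum_mono2) auto
    also have "\<dots> \<le> (\<Sum>q\<in>?A \<union> ?B. ?f q) + ?f 3"
      using Q f0 by (subst sum_Un) auto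
    also have "(\<Sum>q\<in>?A \<union> ?B. ?f q) = (\<Sum>q\<in>?A. ?f q) + (\<Sum>q\<in>?B. ?f q)"
      using Q by (intro sum.union_disjoint) auto
    also have "(\<Sum>q\<in>?A. ?f q) \<le> 1"
    proof -
      have "(\<Sum>q\<in>?A. ?f q) \<le> (\<Sum>q\<in>?A. 1 / real (t ^ 2))"
      proof (intro sum_mono divide_left_mono)
        fix q assume "q \<in> ?A"
        then have "t ^ 2 + 1 \<le> q" by simp
        then have "real (t ^ 2 + 1) \<le> real q" by (simp only: of_nat_le_iff)
        then show "real (t ^ 2) \<le> real q - 1" by simp
        then show "0 < (real q - 1) * real (t ^ 2)" using t
          by (smt (verit) mult_pos_pos of_nat_0_less_iff zero_less_power less_le_trans zero_less_one)
      qed auto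
      also have "\<dots> = real (card ?A) / real (t ^ 2)" by simp
      also have "\<dots> \<le> 1"
      proof -
        have "card ?A \<le> card Q" using Q by (intro card_mono) auto
        then have "real (card ?A) \<le> real (t ^ 2)" using Q(4) by (simp only: of_nat_le_iff)
        then show ?thesis using t by (simp add: divide_le_eq)
      qed
      finally show ?thesis .
    qed
    also have "(\<Sum>q\<in>?B. ?f q) \<le> 5 / 12 * (1 + ln (real (t ^ 2)))"
      using Q t by (intro sum_inverse_coprime_6_le) auto
    also have "ln (real (t ^ 2)) = 2 * ln t" using t by (simp add: ln_realpow)
    finally show "(\<Sum>q\<in>Q. ?f q) \<le> 2 + 5 / 6 * ln t" by (simp add: add_divide_distrib)
  qed
  also have "\<dots> = exp 2 * t powr (5 / 6)" using t by (simp add: exp_add powr_def)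
  finally show ?thesis .
qed

lemma card_prime_factors_mersenne_le:
  assumes "j \<ge> 1"
  shows "card (prime_factors (2 ^ j - 1 :: nat)) \<le> j"
proof -
  let ?n = "2 ^ j - 1 :: nat"
  have n: "?n > 0" using assms one_less_power[of "2::nat" j] by simp
  have "(2::nat) ^ card (prime_factors ?n) = (\<Prod>q\<in>prime_factors ?n. 2)" by simp
  also have "\<dots> \<le> (\<Prod>q\<in>prime_factors ?n. q ^ multiplicity q ?n)"
  proof (intro prod_mono conjI)
    fix q assume q: "q \<in> prime_factors ?n"
    then have "q \<ge> 2" "multiplicity q ?n \<ge> 1" by (auto simp: prime_factors_multiplicity prime_ge_2_nat)
    then show "2 \<le> q ^ multiplicity q ?n" by (metis One_nat_def le_trans power_increasing power_one_right one_le_numeral)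
  qed auto
  also have "\<dots> = ?n" using prime_factorization_nat[OF n] by simp
  also have "\<dots> < 2 ^ j" by simp
  finally show ?thesis by simp
qed

text \<open>Equivalently, the odd primes modulo which 2 has order at most \<open>t\<close>. Written
  as a union, its size is visibly at most \<open>t ^ 2\<close>.\<close>

definition mersenne_prime_divisors_upto :: "nat \<Rightarrow> nat set" where
  "mersenne_prime_divisors_upto t = (\<Union>j\<in>{1..t}. prime_factors (2 ^ j - 1))"

lemma prod_mersenne_primes_ratio_le:
  assumes "t \<ge> 1"
  shows "(\<Prod>q\<in>mersenne_prime_divisors_upto t. real q / (real q - 1)) \<le> exp 2 * t powr (5 / 6)"
proof (rule prod_odd_primes_ratio_le[OF _ _ _ _ assms])
  show "2 \<notin> mersenne_prime_divisors_upto t"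
    by (auto simp: mersenne_prime_divisors_upto_def in_prime_factors_iff)
  have "card (mersenne_prime_divisors_upto t) \<le> (\<Sum>j\<in>{1..t}. card (prime_factors (2 ^ j - 1 :: nat)))"
    unfolding mersenne_prime_divisors_upto_def by (intro card_UN_le) auto
  also have "\<dots> \<le> (\<Sum>j\<in>{1..t}. t)"
    by (intro sum_mono) (meson atLeastAtMost_iff card_prime_factors_mersenne_le le_trans)
  finally show "card (mersenne_prime_divisors_upto t) \<le> t ^ 2" by (simp add: power2_eq_square)
qed (auto simp: mersenne_prime_divisors_upto_def)

section \<open>Orders of 2 and the average of \<open>n / \<phi> n\<close> over Mersenne
  numbers\<close>

lemma dvd_mersenne_iff_ord:
  fixes q j :: nat
  shows "q dvd 2 ^ j - 1 \<longleftrightarrow> ord q 2 dvd j"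
proof -
  have "q dvd 2 ^ j - 1 \<longleftrightarrow> [2 ^ j = 1] (mod q)"
    using cong_altdef_nat[of 1 "2 ^ j" q] cong_sym_eq by (simp add: cong_altdef_nat')
  then show ?thesis by (simp only: ord_divides)
qed

text \<open>Pointwise partial summation: a sum weighted by \<open>1 / e D\<close> turns into sums
  over the sets with \<open>e D \<le> t\<close>, for which a bound in terms of \<open>t\<close> is
  available.\<close>

lemma inverse_eq_telescope:
  fixes e K :: nat
  assumes "1 \<le> e" "e \<le> K"
  shows "1 / real e = (\<Sum>t=e..K. 1 / (real t * (real t + 1))) + 1 / (real K + 1)"
  using assms(2)
proof (induction K rule: dec_induct)
  case base
  have "1 / x = 1 / (x * (x + 1)) + 1 / (x + 1)" if "x > 0" for x :: real
    using that by (simp add: divide_simps)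
  from this[of "real e"] show ?case using assms(1) by simp
next
  case (step n)
  have "1 / (real n + 1) = 1 / ((real n + 1) * (real n + 2)) + 1 / (real n + 2)"
    by (simp add: divide_simps)
  then show ?case using step by (simp add: add_ac)
qed

text \<open>After expanding the products, a set \<open>D\<close> of primes contributes to one out of \<open>e D\<close> exponents, where
  \<open>e D\<close> is the least common multiple of the orders of \<open>2\<close>; partial summation over \<open>e D\<close> finishes.\<close>

lemma sum_totient_ratio_mersenne_le:
  "\<exists>C>0. \<forall>K. (\<Sum>j=1..K. totient_ratio (2 ^ j - 1)) \<le> C * real K"
proof -
  define Z where "Z = (\<Sum>t. real t powr (- 7 / 6))"
  have summ: "summable (\<lambda>t. real t powr (- 7 / 6))" by (simp add: summable_real_powr_iff)
  have Z0: "Z \<ge> 0" unfolding Z_def by (intro suminf_nonneg summ) simp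
  define w where "w D = (\<Prod>q\<in>D. 1 / (real q - 1))" for D :: "nat set"
  define e where "e D = Lcm ((\<lambda>q. ord q 2) ` D)" for D :: "nat set"
  have w0: "w D \<ge> 0" if "D \<subseteq> mersenne_prime_divisors_upto t" for D t
    unfolding w_def
  proof (rule prod_nonneg)
    fix q assume "q \<in> D"
    then have "prime q" using that by (auto simp: mersenne_prime_divisors_upto_def)
    then show "0 \<le> 1 / (real q - 1)" using prime_ge_2_nat[of q] by simp
  qed
  have sumw: "(\<Sum>D\<in>Pow Q. w D) = (\<Prod>q\<in>Q. real q / (real q - 1))"
    if "finite Q" "\<And>q. q \<in> Q \<Longrightarrow> prime q" for Q
  proof -
    have "(\<Sum>D\<in>Pow Q. w D) = (\<Prod>q\<in>Q. 1 + 1 / (real q - 1))"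
      unfolding w_def by (rule sum_Pow_prod[OF that(1)])
    also have "\<dots> = (\<Prod>q\<in>Q. real q / (real q - 1))"
    proof (intro prod.cong refl)
      fix q assume "q \<in> Q"
      then have "q \<ge> 2" using that(2) by (intro prime_ge_2_nat)
      then show "1 + 1 / (real q - 1) = real q / (real q - 1)" by (simp add: field_simps)
    qed
    finally show ?thesis .
  qed
  have bound: "(\<Sum>j=1..K. totient_ratio (2 ^ j - 1)) \<le> exp 2 * (Z + 1) * real K" if K: "K \<ge> 1" for K
  proof -
    let ?Q = "mersenne_prime_divisors_upto"
    have finQ: "finite (?Q t)" for t by (auto simp: mersenne_prime_divisors_upto_def)
    \<comment> \<open>If the least common multiple of the orders is positive and at most
      \<open>t\<close>, every prime of \<open>D\<close> has order at most \<open>t\<close>. So all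
      these \<open>D\<close> are subsets of \<open>?Q t\<close>, and the product bound for
      \<open>?Q t\<close> applies.\<close>
    define E where "E t = (\<Sum>D | D \<in> Pow (?Q K) \<and> 1 \<le> e D \<and> e D \<le> t. w D)" for t
    have E: "E t \<le> exp 2 * t powr (5 / 6)" if "t \<ge> 1" for t
    proof -
      have "E t \<le> (\<Sum>D\<in>Pow (?Q t). w D)" unfolding E_def
      proof (rule sum_mono2)
        show "finite (Pow (?Q t))" using finQ by simp
        show "{D. D \<in> Pow (?Q K) \<and> 1 \<le> e D \<and> e D \<le> t} \<subseteq> Pow (?Q t)"
        proof safe
          fix D q assume D: "D \<subseteq> ?Q K" "1 \<le> e D" "e D \<le> t" and q: "q \<in> D"
          have dvd: "ord q 2 dvd e D" unfolding e_def using q by (intro dvd_Lcm) auto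
          have "ord q 2 \<le> e D" using dvd D(2) by (intro dvd_imp_le) auto
          moreover have "ord q 2 \<noteq> 0" using dvd D(2) by (metis dvd_0_left not_one_le_zero)
          ultimately have o: "ord q 2 \<le> t" "ord q 2 \<ge> 1" using D(3) by linarith+
          moreover have "q dvd 2 ^ ord q 2 - 1" by (simp only: dvd_mersenne_iff_ord dvd_refl)
          moreover have "prime q" using D q by (auto simp: mersenne_prime_divisors_upto_def)
          moreover have "(2::nat) ^ ord q 2 > 1" using o by (intro one_less_power) auto
          ultimately show "q \<in> ?Q t" unfolding mersenne_prime_divisors_upto_def
            by (intro UN_I[of "ord q 2"]) (auto simp: in_prime_factors_iff)
        qed
        show "0 \<le> w D" if "D \<in> Pow (?Q t) - {D. D \<in> Pow (?Q K) \<and> 1 \<le> e D \<and> e D \<le> t}" for D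
          using that w0 by blast
      qed
      also have "\<dots> = (\<Prod>q\<in>?Q t. real q / (real q - 1))"
        by (intro sumw finQ) (auto simp: mersenne_prime_divisors_upto_def)
      also have "\<dots> \<le> exp 2 * t powr (5 / 6)" by (rule prod_mersenne_primes_ratio_le[OF that])
      finally show ?thesis .
    qed
    have "(\<Sum>j=1..K. totient_ratio (2 ^ j - 1)) = (\<Sum>j\<in>{1..K}. \<Sum>D | D \<in> Pow (?Q K) \<and> D \<subseteq> prime_factors (2 ^ j - 1). w D)"
    proof (intro sum.cong refl)
      fix j assume "j \<in> {1..K}"
      then have "{D. D \<in> Pow (?Q K) \<and> D \<subseteq> prime_factors (2 ^ j - 1)} = Pow (prime_factors (2 ^ j - 1))"
        by (auto simp: mersenne_prime_divisors_upto_def)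
      then show "totient_ratio (2 ^ j - 1) = (\<Sum>D | D \<in> Pow (?Q K) \<and> D \<subseteq> prime_factors (2 ^ j - 1). w D)"
        by (simp only:) (subst sumw, auto simp: totient_ratio_def)
    qed
    also have "\<dots> = (\<Sum>D\<in>Pow (?Q K). \<Sum>j | j \<in> {1..K} \<and> D \<subseteq> prime_factors (2 ^ j - 1). w D)"
      using finQ by (intro sum.swap_restrict) auto
    also have "\<dots> \<le> (\<Sum>D\<in>Pow (?Q K). if 1 \<le> e D \<and> e D \<le> K then w D * (real K / real (e D)) else 0)"
    proof (intro sum_mono)
      fix D assume D: "D \<in> Pow (?Q K)"
      let ?J = "{j. j \<in> {1..K} \<and> D \<subseteq> prime_factors (2 ^ j - 1)}"
      have ej: "e D dvd j" if "j \<in> ?J" for j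
        unfolding e_def
      proof (rule Lcm_least)
        fix a assume "a \<in> (\<lambda>q. ord q 2) ` D"
        then obtain q where q: "q \<in> D" "a = ord q 2" by auto
        then have "q dvd 2 ^ j - 1" using that by auto
        then show "a dvd j" by (simp only: q(2) dvd_mersenne_iff_ord)
      qed
      show "(\<Sum>j\<in>?J. w D) \<le> (if 1 \<le> e D \<and> e D \<le> K then w D * (real K / real (e D)) else 0)"
      proof (cases "?J = {}")
        case True
        then show ?thesis using w0 D by (simp only: sum.empty) (auto intro!: mult_nonneg_nonneg)
      next
        case False
        then obtain j where j: "j \<in> ?J" by blast
        have j1: "1 \<le> j" "j \<le> K" using j by auto
        have "e D \<le> j" using ej[OF j] j1 by (intro dvd_imp_le) auto
        moreover have "e D \<noteq> 0" using ej[OF j] j1(1) by (metis dvd_0_left not_one_le_zero)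
        ultimately have e1: "1 \<le> e D" "e D \<le> K" using j1 by linarith+
        have "?J \<subseteq> (\<lambda>i. e D * i) ` {1..K div e D}"
        proof
          fix i assume i: "i \<in> ?J"
          then obtain c where c: "i = e D * c" using ej by blast
          have "c \<le> K div e D" using i c e1 by (simp add: less_eq_div_iff_mult_less_eq mult.commute)
          moreover have "c \<ge> 1" using i c by (cases c) auto
          ultimately show "i \<in> (\<lambda>i. e D * i) ` {1..K div e D}" using c by auto
        qed
        then have "card ?J \<le> card ((\<lambda>i. e D * i) ` {1..K div e D})" by (intro card_mono) auto
        also have "\<dots> \<le> K div e D" using card_image_le[of "{1..K div e D}" "\<lambda>i. e D * i"] by simp
        finally have "real (card ?J) \<le> real (K div e D)" by (simp only: of_nat_le_iff)
        also have "\<dots> \<le> real K / real (e D)" by (rule of_nat_div_le_of_nat)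
        finally have "w D * real (card ?J) \<le> w D * (real K / real (e D))"
          using w0 D by (intro mult_left_mono) auto
        then show ?thesis using e1 by (simp add: mult.commute)
      qed
    qed
    also have "\<dots> = real K * (\<Sum>D | D \<in> Pow (?Q K) \<and> 1 \<le> e D \<and> e D \<le> K. w D * (1 / real (e D)))"
      using finQ by (simp add: sum.If_cases Int_def sum_distrib_left mult_ac)
    also have "(\<Sum>D | D \<in> Pow (?Q K) \<and> 1 \<le> e D \<and> e D \<le> K. w D * (1 / real (e D)))
      = (\<Sum>D | D \<in> Pow (?Q K) \<and> 1 \<le> e D \<and> e D \<le> K.
          (\<Sum>t | t \<in> {1..K} \<and> e D \<le> t. w D * (1 / (real t * (real t + 1)))) + w D * (1 / (real K + 1)))"
    proof (intro sum.cong refl)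
      fix D assume "D \<in> {D. D \<in> Pow (?Q K) \<and> 1 \<le> e D \<and> e D \<le> K}"
      then have D: "1 \<le> e D" "e D \<le> K" by auto
      then have "{t. t \<in> {1..K} \<and> e D \<le> t} = {e D..K}" by auto
      then show "w D * (1 / real (e D)) = (\<Sum>t | t \<in> {1..K} \<and> e D \<le> t. w D * (1 / (real t * (real t + 1)))) + w D * (1 / (real K + 1))"
        by (simp only: inverse_eq_telescope[OF D] distrib_left sum_distrib_left)
    qed
    also have "\<dots> = (\<Sum>t\<in>{1..K}. E t * (1 / (real t * (real t + 1)))) + E K * (1 / (real K + 1))"
    proof -
      have "(\<Sum>D | D \<in> Pow (?Q K) \<and> 1 \<le> e D \<and> e D \<le> K. \<Sum>t | t \<in> {1..K} \<and> e D \<le> t. w D * (1 / (real t * (real t + 1))))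
        = (\<Sum>t\<in>{1..K}. \<Sum>D | D \<in> {D. D \<in> Pow (?Q K) \<and> 1 \<le> e D \<and> e D \<le> K} \<and> e D \<le> t. w D * (1 / (real t * (real t + 1))))"
        using finQ by (intro sum.swap_restrict) auto
      also have "\<dots> = (\<Sum>t\<in>{1..K}. E t * (1 / (real t * (real t + 1))))"
      proof (intro sum.cong refl)
        fix t assume "t \<in> {1..K}"
        then have "{D. D \<in> {D. D \<in> Pow (?Q K) \<and> 1 \<le> e D \<and> e D \<le> K} \<and> e D \<le> t} = {D. D \<in> Pow (?Q K) \<and> 1 \<le> e D \<and> e D \<le> t}"
          by auto
        then show "(\<Sum>D | D \<in> {D. D \<in> Pow (?Q K) \<and> 1 \<le> e D \<and> e D \<le> K} \<and> e D \<le> t. w D * (1 / (real t * (real t + 1)))) = E t * (1 / (real t * (real t + 1)))"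
          by (simp only: E_def sum_distrib_right)
      qed
      finally show ?thesis by (simp only: sum.distrib E_def sum_distrib_right)
    qed
    \<comment> \<open>Here the exponent below 1 pays off: \<open>5 / 6 - 2 = - 7 / 6\<close> gives a
      convergent series.\<close>
    also have "\<dots> \<le> (\<Sum>t\<in>{1..K}. exp 2 * real t powr (- 7 / 6)) + exp 2"
    proof (intro add_mono sum_mono)
      have pw: "E t * (1 / (real t * (real t + 1))) \<le> exp 2 * real t powr (- 7 / 6)" if "t \<ge> 1" for t
      proof -
        have "E t * (1 / (real t * (real t + 1))) \<le> exp 2 * t powr (5 / 6) * (1 / (real t * real t))"
          using E[OF that] that by (intro mult_mono divide_left_mono) auto
        also have "1 / (real t * real t) = real t powr (- 2)"
          using that by (simp add: powr_minus powr_numeral power2_eq_square field_simps)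
        also have "exp 2 * t powr (5 / 6) * real t powr (- 2) = exp 2 * real t powr (- 7 / 6)"
          by (simp flip: powr_add)
        finally show ?thesis .
      qed
      then show "E t * (1 / (real t * (real t + 1))) \<le> exp 2 * real t powr (- 7 / 6)" if "t \<in> {1..K}" for t
        using that by simp
      have "E K * (1 / (real K + 1)) \<le> exp 2 * K powr (5 / 6) * (1 / real K)"
        using E[OF K] K by (intro mult_mono divide_left_mono) auto
      also have "\<dots> \<le> exp 2 * K powr 1 * (1 / real K)"
        using K by (intro mult_right_mono mult_left_mono powr_mono) auto
      also have "\<dots> = exp 2" using K by simp
      finally show "E K * (1 / (real K + 1)) \<le> exp 2" .
    qed
    also have "\<dots> \<le> exp 2 * (Z + 1)"
    proof -
      have "(\<Sum>t\<in>{1..K}. real t powr (- 7 / 6)) \<le> Z"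
        unfolding Z_def by (intro sum_le_suminf summ) auto
      then show ?thesis by (simp add: algebra_simps flip: sum_distrib_left)
    qed
    finally show ?thesis by (simp add: mult_ac mult_left_mono mult_right_mono)
  qed
  have "(\<Sum>j=1..K. totient_ratio (2 ^ j - 1)) \<le> exp 2 * (Z + 1) * real K" for K
    using bound[of K] by (cases "K = 0") auto
  moreover have "exp 2 * (Z + 1) > 0" using Z0 by (intro mult_pos_pos) auto
  ultimately show ?thesis by blast
qed

section \<open>Chebyshev's lower bound\<close>

text \<open>The entries \<open>1 / ((n + 1) * (n choose k))\<close> of Leibniz's harmonic triangle are differences of
  neighbouring entries, so \<open>Lcm {1..n + 1}\<close> clears all denominators of row \<open>n\<close>.\<close>

lemma Suc_times_binomial_dvd_Lcm:
  fixes n k :: nat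
  assumes "k \<le> n"
  shows "Suc n * (n choose k) dvd Lcm {1..Suc n}"
  using assms
proof (induction k arbitrary: n)
  case 0
  then show ?case by (auto intro: dvd_Lcm)
next
  case (Suc k)
  then obtain m where n: "n = Suc m" and km: "k \<le> m" by (cases n) auto
  define d where "d = Lcm {1..Suc n}"
  have "Suc m * (m choose k) dvd Lcm {1..Suc m}" using Suc.IH km by blast
  also have "\<dots> dvd d" unfolding n d_def by (rule Lcm_subset) auto
  finally obtain a where a: "d = Suc m * (m choose k) * a" by blast
  have "Suc n * (n choose k) dvd d" unfolding d_def using Suc.IH[of n] Suc.prems by simp
  then obtain b where b: "d = Suc n * (n choose k) * b" by blast
  \<comment> \<open>The identity behind the computation is \<open>1 / ((n + 1) * (n choose Suc k)) =
    1 / (n * (m choose k)) - 1 / ((n + 1) * (n choose k))\<close>, multiplied by \<open>d\<close>.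
    It is carried out over the integers because the cofactor is the difference
    \<open>a - b\<close>.\<close>
  define x y z where "x = int (m choose k)" and "y = int (n choose k)" and "z = int (n choose Suc k)"
  have "n * (m choose k) = (n choose Suc k) * Suc k" using Suc_times_binomial_eq[of m k] n by simp
  then have 1: "int n * x = z * (int k + 1)" unfolding x_def z_def by (metis of_nat_mult of_nat_Suc add.commute)
  have "(n - k) * (n choose k) = n * (m choose k)" using binomial_absorb_comp[of n k] n by simp
  then have "int (n - k) * y = int n * x" unfolding x_def y_def by (metis of_nat_mult)
  then have 2: "(int n - int k) * y = int n * x" using Suc.prems by (simp add: of_nat_diff)
  have "int d = int n * x * int a" using a n unfolding x_def by (metis of_nat_mult)
  then have da: "int d = z * (int k + 1) * int a" using 1 by simp
  have db: "int d = (int n + 1) * y * int b" using b unfolding y_def by (metis of_nat_mult of_nat_Suc add.commute)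
  have "(int n - int k) * int d = (int n + 1) * ((int n - int k) * y) * int b"
    unfolding db by (simp add: mult_ac)
  also have "\<dots> = (int n + 1) * (z * (int k + 1)) * int b" using 1 2 by simp
  finally have "(int n - int k) * int d = (int n + 1) * (z * (int k + 1)) * int b" .
  moreover have "(int n + 1) * int d = (int n + 1) * (z * (int k + 1) * int a)" using da by simp
  ultimately have "(int k + 1) * int d = (int k + 1) * ((int n + 1) * z * (int a - int b))"
    by (simp add: algebra_simps)
  then have "int d = (int n + 1) * z * (int a - int b)" by simp
  then have "(int n + 1) * z dvd int d" by simp
  then have "int (Suc n * (n choose Suc k)) dvd int d" by (simp add: z_def algebra_simps)
  then show ?case unfolding d_def by (simp only: of_nat_dvd_iff)
qed

text \<open>No power of \<open>p\<close> dividing a number up to \<open>N\<close> exceeds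
  \<open>p ^ e p \<le> N\<close>, so each prime contributes at most one factor
  \<open>N\<close>.\<close>

lemma Lcm_upto_le_power_card_primes:
  fixes N :: nat
  shows "Lcm {1..N} \<le> N ^ card {p. prime p \<and> p \<le> N}"
proof (cases "N = 0")
  case False
  define e where "e p = Max {j. p ^ j \<le> N}" for p
  let ?P = "{p. prime p \<and> p \<le> N}"
  have fin: "finite {j. p ^ j \<le> N}" if "p \<ge> 2" for p
  proof (rule finite_subset)
    show "{j. p ^ j \<le> N} \<subseteq> {..N}"
    proof
      fix j assume "j \<in> {j. p ^ j \<le> N}"
      then have "p ^ j \<le> N" by simp
      moreover have "2 ^ j \<le> p ^ j" using that by (rule power_mono) simp
      moreover have "j < 2 ^ j" by (rule less_exp)
      ultimately have "j \<le> N" by linarith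
      then show "j \<in> {..N}" by simp
    qed
  qed simp
  have e_le: "p ^ e p \<le> N" if "p \<ge> 2" for p
  proof -
    have "0 \<in> {j. p ^ j \<le> N}" using False by simp
    then have "e p \<in> {j. p ^ j \<le> N}" unfolding e_def using fin[OF that] by (intro Max_in) blast+
    then show ?thesis by simp
  qed
  have finP: "finite ?P" by (rule finite_subset[of _ "{..N}"]) auto
  have "Lcm {1..N} dvd (\<Prod>p\<in>?P. p ^ e p)"
  proof (rule Lcm_least)
    fix n assume n: "n \<in> {1..N}"
    then have n0: "n > 0" by simp
    have "n = (\<Prod>p\<in>prime_factors n. p ^ multiplicity p n)" using prime_factorization_nat[OF n0] .
    also have "\<dots> dvd (\<Prod>p\<in>prime_factors n. p ^ e p)"
    proof (rule prod_dvd_prod)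
      fix p assume p: "p \<in> prime_factors n"
      then have "p \<ge> 2" by (auto intro: prime_ge_2_nat)
      have "p ^ multiplicity p n \<le> n" using n0 by (intro dvd_imp_le multiplicity_dvd)
      then have "multiplicity p n \<le> e p" unfolding e_def using n fin[OF \<open>p \<ge> 2\<close>] by (intro Max_ge) auto
      then show "p ^ multiplicity p n dvd p ^ e p" by (rule le_imp_power_dvd)
    qed
    also have "\<dots> dvd (\<Prod>p\<in>?P. p ^ e p)"
    proof (rule prod_dvd_prod_subset[OF finP])
      show "prime_factors n \<subseteq> ?P"
        using n n0 by (auto simp: in_prime_factors_iff dest!: dvd_imp_le)
    qed
    finally show "n dvd (\<Prod>p\<in>?P. p ^ e p)" .
  qed
  moreover have "(\<Prod>p\<in>?P. p ^ e p) > 0" by (intro prod_pos) (auto intro!: prime_gt_0_nat)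
  ultimately have "Lcm {1..N} \<le> (\<Prod>p\<in>?P. p ^ e p)" by (intro dvd_imp_le)
  also have "\<dots> \<le> (\<Prod>p\<in>?P. N)"
    by (intro prod_mono) (auto intro: e_le prime_ge_2_nat)
  finally show ?thesis by simp
next
  case True
  have "{p. prime p \<and> p \<le> N} = {}" using True prime_gt_0_nat by fastforce
  then show ?thesis using True by (simp only:) simp
qed

text \<open>The least common multiple is squeezed between \<open>4 ^ n\<close>, by the central
  binomial coefficient, and \<open>N\<close> to the number of primes; logarithms are then compared,
  with \<open>ln 4 \<ge> 1\<close>.\<close>

lemma card_primes_ge:
  fixes N :: nat
  assumes "N \<ge> 3"
  shows "real N / (6 * ln N) \<le> real (card {p. prime p \<and> p \<le> N})"
proof -
  let ?\<pi> = "card {p. prime p \<and> p \<le> N}"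
  define n where "n = (N - 1) div 2"
  have n: "n > 0" "2 * n + 1 \<le> N" "N \<le> 2 * n + 2" using assms by (auto simp: n_def)
  have "(4::real) ^ n \<le> 2 * real n * real ((2 * n) choose n)"
    using central_binomial_lower_bound[OF n(1)] n(1) by (simp add: field_simps)
  also have "\<dots> \<le> real (Suc (2 * n) * ((2 * n) choose n))" by (simp add: algebra_simps)
  also have "\<dots> \<le> real (Lcm {1..N})"
  proof -
    have "Suc (2 * n) * ((2 * n) choose n) dvd Lcm {1..Suc (2 * n)}" by (rule Suc_times_binomial_dvd_Lcm) simp
    also have "\<dots> dvd Lcm {1..N}" using n(2) by (intro Lcm_subset) auto
    finally have dvd: "Suc (2 * n) * ((2 * n) choose n) dvd Lcm {1..N}" .
    have "Lcm {1..N} \<noteq> 0" by (subst Lcm_0_iff) auto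
    then have "Suc (2 * n) * ((2 * n) choose n) \<le> Lcm {1..N}" using dvd_imp_le[OF dvd] by blast
    then show ?thesis by (simp only: of_nat_le_iff)
  qed
  also have "\<dots> \<le> real (N ^ ?\<pi>)" using Lcm_upto_le_power_card_primes by (simp only: of_nat_le_iff)
  finally have "ln ((4::real) ^ n) \<le> ln (real N ^ ?\<pi>)" using assms by (intro ln_mono) auto
  then have "real n * ln 4 \<le> real ?\<pi> * ln N" using assms by (simp add: ln_realpow)
  moreover have "real n * 1 \<le> real n * ln 4"
  proof (intro mult_left_mono)
    have "ln (4::real) = ln (2 ^ 2)" by simp
    also have "\<dots> = 2 * ln 2" by (subst ln_realpow) auto
    finally show "1 \<le> ln (4::real)" using ln2_ge_two_thirds by simp
  qed simp
  moreover have "real N / 6 \<le> real n" using n assms by linarith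
  ultimately have "real N / 6 \<le> real ?\<pi> * ln N" by linarith
  then show ?thesis using assms by (simp add: field_simps)
qed

section \<open>Submultiplicativity of \<open>n / \<phi> n\<close> and the Cauchy-Schwarz inequality
  for collisions\<close>

lemma totient_ratio_mult_le:
  assumes "a > 0" "b > 0"
  shows "totient_ratio (a * b) \<le> totient_ratio a * totient_ratio b"
proof -
  let ?f = "\<lambda>q::nat. real q / (real q - 1)"
  have "(\<Prod>q\<in>prime_factors a \<union> prime_factors b. ?f q) * (\<Prod>q\<in>prime_factors a \<inter> prime_factors b. ?f q)
    = totient_ratio a * totient_ratio b"
    unfolding totient_ratio_def by (intro prod.union_inter) auto
  moreover have "1 \<le> (\<Prod>q\<in>prime_factors a \<inter> prime_factors b. ?f q)"
    by (intro prod_ge_1 prime_ratio_ge_1) auto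
  moreover have "prime_factors (a * b) = prime_factors a \<union> prime_factors b"
    using assms by (intro prime_factors_product) auto
  moreover from this have "(\<Prod>q\<in>prime_factors a \<union> prime_factors b. ?f q) = totient_ratio (a * b)"
    by (simp only: totient_ratio_def)
  ultimately show ?thesis
    using totient_ratio_ge_1[of "a * b"]
      mult_left_mono[of 1 "\<Prod>q\<in>prime_factors a \<inter> prime_factors b. ?f q" "totient_ratio (a * b)"]
    by simp
qed

lemma totient_ratio_power_2_le: "totient_ratio (2 ^ l) \<le> 2"
proof (cases "l = 0")
  case False
  then have "prime_factors (2 ^ l :: nat) = {2}"
    by (simp add: prime_factors_power prime_prime_factors)
  then show ?thesis by (simp add: totient_ratio_def)
qed (simp add: totient_ratio_def)

text \<open>Cauchy-Schwarz for the fibre sizes \<open>r v\<close>, whose squares count the colliding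
  pairs. Few collisions force a large image.\<close>

lemma card_squared_le_card_image_collisions:
  fixes f :: "'a \<Rightarrow> 'b"
  assumes X: "finite X"
  shows "(real (card X))\<^sup>2 \<le> real (card {(x, y). x \<in> X \<and> y \<in> X \<and> f x = f y}) * real (card (f ` X))"
proof -
  define r where "r v = card {x \<in> X. f x = v}" for v
  have "card X = (\<Sum>v\<in>f ` X. r v)"
    unfolding r_def using X sum.group[of X "f ` X" f "\<lambda>_. 1::nat"] by simp
  then have "(real (card X))\<^sup>2 = (\<Sum>v\<in>f ` X. real (r v))\<^sup>2" by simp
  also have "\<dots> \<le> (\<Sum>v\<in>f ` X. (real (r v))\<^sup>2) * real (card (f ` X))"
    by (rule sum_squared_le_sum_of_squares)
  also have "(\<Sum>v\<in>f ` X. (real (r v))\<^sup>2) = real (\<Sum>v\<in>f ` X. card ({x \<in> X. f x = v} \<times> {x \<in> X. f x = v}))"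
    by (simp add: r_def card_cartesian_product power2_eq_square)
  also have "(\<Sum>v\<in>f ` X. card ({x \<in> X. f x = v} \<times> {x \<in> X. f x = v}))
      = card (\<Union>v\<in>f ` X. {x \<in> X. f x = v} \<times> {x \<in> X. f x = v})"
    using X by (intro card_UN_disjoint[symmetric]) auto
  also have "(\<Union>v\<in>f ` X. {x \<in> X. f x = v} \<times> {x \<in> X. f x = v}) = {(x, y). x \<in> X \<and> y \<in> X \<and> f x = f y}"
    by auto
  finally show ?thesis .
qed

section \<open>Romanoff's theorem\<close>

text \<open>Oddness is built in so that this is exactly the complement of \<open>\<U>\<close> among
  the odd numbers.\<close>

definition sums_prime_power2 :: "nat set" where
  "sums_prime_power2 = {n. odd n \<and> (\<exists>p k. prime p \<and> 0 < k \<and> n = p + 2 ^ k)}"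

text \<open>The constants come from \<open>2/3 \<le> ln 2 \<le> 1\<close>; \<open>N \<ge> 8\<close>
  gives \<open>ln N \<ge> 2\<close>, which absorbs the rounding of \<open>K\<close>.\<close>

lemma power2_bracket:
  fixes N :: nat
  assumes "N \<ge> 8"
  obtains K where "2 ^ K \<le> N" "N < 2 ^ (K + 1)" "ln N / 2 \<le> real K" "real K \<le> 2 * ln N"
proof -
  obtain K where K: "2 ^ K \<le> N" "N < 2 ^ (K + 1)" using ex_power_ivl1[of 2 N] assms by auto
  have ln2: "2/3 \<le> ln (2::real)" "ln (2::real) \<le> 1" using ln2_ge_two_thirds ln_le_minus_one[of 2] by auto
  have "real (2 ^ K) \<le> real N" "real N \<le> real (2 ^ (K + 1))" "real (2 ^ 3) \<le> real N"
    using K assms by (simp_all only: of_nat_le_iff less_imp_le) simp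
  then have "ln (real (2 ^ K)) \<le> ln (real N)" "ln (real N) \<le> ln (real (2 ^ (K + 1)))" "ln (real (2 ^ 3)) \<le> ln (real N)"
    using assms by (auto intro!: ln_mono simp del: of_nat_power power_Suc)
  moreover have "ln (8::real) = 3 * ln 2" using ln_realpow[of 2 3] by simp
  ultimately have l: "real K * ln 2 \<le> ln N" "ln N \<le> (real K + 1) * ln 2" "3 * ln 2 \<le> ln N"
    by (simp_all add: ln_realpow ln_mult add.commute distrib_right)
  have "real K * (2/3) \<le> real K * ln 2" using ln2 by (intro mult_left_mono) auto
  then have 1: "real K \<le> 2 * ln N" using l(1) by (simp add: field_simps)
  have "(real K + 1) * ln 2 \<le> (real K + 1) * 1" using ln2 by (intro mult_left_mono) auto
  from order_trans[OF l(2) this] have "ln N \<le> real K + 1" by simp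
  moreover have "ln N \<ge> 2" using l(3) ln2(1) by linarith
  ultimately have "ln N / 2 \<le> real K" by simp
  with 1 K that show ?thesis by blast
qed

lemma sum_dist_le:
  fixes g :: "nat \<Rightarrow> real"
  assumes g: "\<And>j. g j \<ge> 0"
  shows "(\<Sum>k | k \<in> {1..K} \<and> k < l. g (l - k)) \<le> (\<Sum>j=1..<l. g j)"
    and "(\<Sum>k | k \<in> {1..K} \<and> l < k. g (k - l)) \<le> (\<Sum>j=1..K. g j)"
proof -
  have "(\<Sum>k | k \<in> {1..K} \<and> k < l. g (l - k)) = (\<Sum>j\<in>(\<lambda>k. l - k) ` {k. k \<in> {1..K} \<and> k < l}. g j)"
    by (subst sum.reindex) (auto simp: inj_on_def)
  also have "\<dots> \<le> (\<Sum>j=1..<l. g j)" by (intro sum_mono2) (auto simp: g)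
  finally show "(\<Sum>k | k \<in> {1..K} \<and> k < l. g (l - k)) \<le> (\<Sum>j=1..<l. g j)" .
  have "(\<Sum>k | k \<in> {1..K} \<and> l < k. g (k - l)) = (\<Sum>j\<in>(\<lambda>k. k - l) ` {k. k \<in> {1..K} \<and> l < k}. g j)"
    by (subst sum.reindex) (auto simp: inj_on_def)
  also have "\<dots> \<le> (\<Sum>j=1..K. g j)" by (intro sum_mono2) (auto simp: g)
  finally show "(\<Sum>k | k \<in> {1..K} \<and> l < k. g (k - l)) \<le> (\<Sum>j=1..K. g j)" .
qed

text \<open>In \<open>2 ^ k - 2 ^ l = 2 ^ l * (2 ^ (k - l) - 1)\<close> the power of 2 costs at most
  a factor 2, so the bound depends on the exponents only through \<open>k - l\<close>, as the
  average over Mersenne numbers requires.\<close>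

lemma card_prime_pairs_power2_diff_le:
  fixes k l N :: nat
  assumes kl: "1 \<le> l" "l < k" and N: "N \<ge> 2"
  shows "real (card {p. p < N \<and> prime p \<and> prime (p + (2 ^ k - 2 ^ l))}) \<le> 576 * real N / (ln N)\<^sup>2 * totient_ratio (2 ^ (k - l) - 1)"
proof -
  have eq: "2 ^ k - 2 ^ l = (2 ^ l * (2 ^ (k - l) - 1) :: nat)"
    using kl by (simp add: diff_mult_distrib2 flip: power_add)
  have pos: "(2::nat) ^ (k - l) - 1 > 0" using kl one_less_power[of "2::nat" "k - l"] by simp
  have "real (card {p. p < N \<and> prime p \<and> prime (p + (2 ^ k - 2 ^ l))}) \<le> 288 * totient_ratio (2 ^ k - 2 ^ l) * real N / (ln N)\<^sup>2"
    using pos kl N unfolding eq by (intro card_prime_pairs_le) auto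
  also have "\<dots> = 288 * real N / (ln N)\<^sup>2 * totient_ratio (2 ^ k - 2 ^ l)" by simp
  also have "\<dots> \<le> 288 * real N / (ln N)\<^sup>2 * (2 * totient_ratio (2 ^ (k - l) - 1))"
  proof (intro mult_left_mono)
    have "totient_ratio (2 ^ k - 2 ^ l) \<le> totient_ratio (2 ^ l) * totient_ratio (2 ^ (k - l) - 1)"
      unfolding eq using pos by (intro totient_ratio_mult_le) auto
    also have "\<dots> \<le> 2 * totient_ratio (2 ^ (k - l) - 1)"
      using totient_ratio_ge_1[of "2 ^ (k - l) - 1"] by (intro mult_right_mono totient_ratio_power_2_le) simp
    finally show "totient_ratio (2 ^ k - 2 ^ l) \<le> 2 * totient_ratio (2 ^ (k - l) - 1)" .
  qed simp
  finally show ?thesis by simp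
qed

text \<open>For equal exponents a collision is a single prime: about \<open>ln N\<close> exponents
  times \<open>N / ln N\<close> primes. For different exponents it is a prime pair: about
  \<open>(ln N)\<^sup>2\<close> pairs of exponents times \<open>N / (ln N)\<^sup>2\<close>, once
  \<open>totient_ratio\<close> is averaged over the differences. The constants are
  \<open>96 = 48 * 2\<close> and \<open>4608 = 2 * 576 * 2\<^sup>2\<close>.\<close>

lemma card_collisions_le:
  fixes N K :: nat and C :: real
  assumes N: "N \<ge> 2" and K: "real K \<le> 2 * ln N"
    and C: "\<And>K. (\<Sum>j=1..K. totient_ratio (2 ^ j - 1)) \<le> C * real K"
  defines "A \<equiv> {p. prime p \<and> p \<noteq> 2 \<and> p < N}"
  shows "real (card {(x, y). x \<in> A \<times> {1..K} \<and> y \<in> A \<times> {1..K} \<and> fst x + 2 ^ snd x = fst y + 2 ^ snd y})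
    \<le> (96 + 4608 * C) * real N"
proof -
  let ?E = "{(x, y). x \<in> A \<times> {1..K} \<and> y \<in> A \<times> {1..K} \<and> fst x + 2 ^ snd x = fst y + 2 ^ snd y}"
  \<comment> \<open>The second prime is determined by \<open>p\<close>, \<open>k\<close> and
    \<open>l\<close>, so collisions can be counted by their first prime.\<close>
  define S where "S k l = {p \<in> A. \<exists>q\<in>A. p + 2 ^ k = q + 2 ^ l}" for k l :: nat
  define W where "W = 576 * real N / (ln N)\<^sup>2"
  define g where "g j = totient_ratio (2 ^ j - 1)" for j
  have g0: "g j \<ge> 0" for j using totient_ratio_ge_1[of "2 ^ j - 1"] by (simp add: g_def)
  have lnN: "ln N > 0" using N by simp
  have W0: "W \<ge> 0" by (simp add: W_def)
  have C0: "C \<ge> 0" using C[of 1] totient_ratio_ge_1[of 1] by simp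
  have finA: "finite A" unfolding A_def by (rule finite_subset[of _ "{..N}"]) auto
  have finS: "finite (S k l)" for k l using finA by (auto simp: S_def)
  \<comment> \<open>With modulus 1 the Brun-Titchmarsh bound becomes Chebyshev's upper
    bound.\<close>
  have cardA: "real (card A) \<le> 48 * real N / ln N"
  proof -
    have "card A \<le> card {p. prime p \<and> p \<le> N \<and> p mod 1 = 0}" unfolding A_def
      by (intro card_mono) (auto intro: finite_subset[of _ "{..N}"])
    also have "real \<dots> \<le> 48 * totient_ratio 1 * real N / (real 1 * ln N)"
      using N by (intro card_primes_residue_class_le) auto
    finally show ?thesis by (simp add: totient_ratio_def)
  qed
  have diag: "real (card (S k l)) \<le> 48 * real N / ln N" if "k = l" for k l
    using card_mono[OF finA, of "S k l"] cardA by (auto simp: S_def)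
  have less: "real (card (S k l)) \<le> W * g (k - l)" if "1 \<le> l" "l < k" for k l
  proof -
    have "S k l \<subseteq> {p. p < N \<and> prime p \<and> prime (p + (2 ^ k - 2 ^ l))}"
    proof
      fix p assume "p \<in> S k l"
      then obtain q where q: "p \<in> A" "q \<in> A" "p + 2 ^ k = q + 2 ^ l" by (auto simp: S_def)
      moreover have "(2::nat) ^ l \<le> 2 ^ k" using that by simp
      ultimately have "q = p + (2 ^ k - 2 ^ l)" by linarith
      then show "p \<in> {p. p < N \<and> prime p \<and> prime (p + (2 ^ k - 2 ^ l))}" using q by (auto simp: A_def)
    qed
    then have "card (S k l) \<le> card {p. p < N \<and> prime p \<and> prime (p + (2 ^ k - 2 ^ l))}"
      by (intro card_mono) auto
    then show ?thesis using card_prime_pairs_power2_diff_le[OF that N] unfolding W_def g_def by linarith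
  qed
  have greater: "real (card (S k l)) \<le> W * g (l - k)" if "1 \<le> k" "k < l" for k l
  proof -
    have "S k l \<subseteq> (\<lambda>q. q + (2 ^ l - 2 ^ k)) ` {p. p < N \<and> prime p \<and> prime (p + (2 ^ l - 2 ^ k))}"
    proof
      fix p assume "p \<in> S k l"
      then obtain q where q: "p \<in> A" "q \<in> A" "p + 2 ^ k = q + 2 ^ l" by (auto simp: S_def)
      moreover have "(2::nat) ^ k \<le> 2 ^ l" using that by simp
      ultimately have "p = q + (2 ^ l - 2 ^ k)" by linarith
      then show "p \<in> (\<lambda>q. q + (2 ^ l - 2 ^ k)) ` {p. p < N \<and> prime p \<and> prime (p + (2 ^ l - 2 ^ k))}"
        using q by (intro image_eqI[of _ _ q]) (auto simp: A_def)
    qed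
    then have "card (S k l) \<le> card {p. p < N \<and> prime p \<and> prime (p + (2 ^ l - 2 ^ k))}"
      by (rule surj_card_le[rotated]) auto
    then show ?thesis using card_prime_pairs_power2_diff_le[OF that N] unfolding W_def g_def by linarith
  qed
  have "card ?E \<le> card (SIGMA u:{1..K} \<times> {1..K}. S (fst u) (snd u))"
  proof (rule card_inj_on_le[where f = "\<lambda>(x, y). ((snd x, snd y), fst x)"])
    show "inj_on (\<lambda>(x, y). ((snd x, snd y), fst x)) ?E" by (auto simp: inj_on_def)
    show "(\<lambda>(x, y). ((snd x, snd y), fst x)) ` ?E \<subseteq> (SIGMA u:{1..K} \<times> {1..K}. S (fst u) (snd u))"
      by (auto simp: S_def)
    show "finite (SIGMA u:{1..K} \<times> {1..K}. S (fst u) (snd u))" using finS by auto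
  qed
  also have "card (SIGMA u:{1..K} \<times> {1..K}. S (fst u) (snd u)) = (\<Sum>u\<in>{1..K} \<times> {1..K}. card (S (fst u) (snd u)))"
    using finS by (intro card_SigmaI) auto
  also have "\<dots> = (\<Sum>l\<in>{1..K}. \<Sum>k\<in>{1..K}. card (S l k))"
    by (simp add: sum.cartesian_product case_prod_unfold)
  finally have "real (card ?E) \<le> real (\<Sum>l\<in>{1..K}. \<Sum>k\<in>{1..K}. card (S l k))" by (simp only: of_nat_le_iff)
  also have "\<dots> = (\<Sum>l\<in>{1..K}. \<Sum>k\<in>{1..K}. real (card (S l k)))" by simp
  also have "\<dots> \<le> (\<Sum>l\<in>{1..K}. 48 * real N / ln N + 2 * (W * (C * real K)))"
  proof (rule sum_mono)
    fix l assume l: "l \<in> {1..K}"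
    have "{1..K} = {l} \<union> ({k. k \<in> {1..K} \<and> k < l} \<union> {k. k \<in> {1..K} \<and> l < k})" using l by auto
    then have "(\<Sum>k\<in>{1..K}. real (card (S l k))) = (\<Sum>k\<in>{l} \<union> ({k. k \<in> {1..K} \<and> k < l} \<union> {k. k \<in> {1..K} \<and> l < k}). real (card (S l k)))"
      by (simp only:)
    also have "\<dots> = real (card (S l l)) + ((\<Sum>k | k \<in> {1..K} \<and> k < l. real (card (S l k))) + (\<Sum>k | k \<in> {1..K} \<and> l < k. real (card (S l k))))"
      by (subst sum.union_disjoint, simp, simp, force, subst sum.union_disjoint) auto
    also have "\<dots> \<le> 48 * real N / ln N + ((\<Sum>k | k \<in> {1..K} \<and> k < l. W * g (l - k)) + (\<Sum>k | k \<in> {1..K} \<and> l < k. W * g (k - l)))"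
      using l by (intro add_mono diag sum_mono less greater) auto
    also have "(\<Sum>k | k \<in> {1..K} \<and> k < l. W * g (l - k)) \<le> W * (C * real K)"
    proof -
      have "(\<Sum>k | k \<in> {1..K} \<and> k < l. g (l - k)) \<le> (\<Sum>j=1..<l. g j)" by (rule sum_dist_le(1)[OF g0])
      also have "\<dots> \<le> (\<Sum>j=1..K. g j)" using l by (intro sum_mono2) (auto simp: g0)
      also have "\<dots> \<le> C * real K" unfolding g_def by (rule C)
      finally show ?thesis using W0 by (simp add: mult_left_mono flip: sum_distrib_left)
    qed
    also have "(\<Sum>k | k \<in> {1..K} \<and> l < k. W * g (k - l)) \<le> W * (C * real K)"
    proof -
      have "(\<Sum>k | k \<in> {1..K} \<and> l < k. g (k - l)) \<le> (\<Sum>j=1..K. g j)" by (rule sum_dist_le(2)[OF g0])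
      also have "\<dots> \<le> C * real K" unfolding g_def by (rule C)
      finally show ?thesis using W0 by (simp add: mult_left_mono flip: sum_distrib_left)
    qed
    finally show "(\<Sum>k\<in>{1..K}. real (card (S l k))) \<le> 48 * real N / ln N + 2 * (W * (C * real K))" by linarith
  qed
  also have "\<dots> = 48 * real N / ln N * real K + 2 * W * C * (real K)\<^sup>2"
    by (simp add: algebra_simps power2_eq_square)
  also have "\<dots> \<le> 48 * real N / ln N * (2 * ln N) + 2 * W * C * (2 * ln N)\<^sup>2"
    using K lnN W0 C0 by (intro add_mono mult_left_mono power_mono) auto
  also have "\<dots> = (96 + 4608 * C) * real N"
    using lnN by (simp add: W_def field_simps power2_eq_square)
  finally show ?thesis .
qed

text \<open>About \<open>N / ln N\<close> primes and \<open>ln N\<close> exponents give at least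
  \<open>N / 24\<close> pairs, while collisions number at most \<open>B * N\<close>; hence the
  constant \<open>(1 / 24)\<^sup>2 / B\<close>.\<close>

lemma romanoff:
  "\<exists>c>0. \<forall>\<^sub>F N in sequentially. c * real N \<le> real (card {n \<in> sums_prime_power2. n \<le> 2 * N})"
proof -
  obtain C where C: "C > 0" "\<And>K. (\<Sum>j=1..K. totient_ratio (2 ^ j - 1)) \<le> C * real K"
    using sum_totient_ratio_mersenne_le by blast
  define B where "B = 96 + 4608 * C"
  have B: "B > 0" using C by (simp add: B_def)
  \<comment> \<open>This makes \<open>N / (12 * ln N)\<close> at least 2 and so absorbs the loss of
    2 and \<open>N\<close> as members of \<open>A\<close>. The prime 2 is left out to keep
    \<open>p + 2 ^ k\<close> odd.\<close>
  have "\<forall>\<^sub>F N in sequentially. 24 * ln (real N) \<le> real N" by real_asymp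
  then have "\<forall>\<^sub>F N in sequentially. 1 / (576 * B) * real N \<le> real (card {n \<in> sums_prime_power2. n \<le> 2 * N})"
    using eventually_ge_at_top[of 8]
  proof eventually_elim
    case (elim N)
    then have N: "N \<ge> 8" and lnN: "24 * ln N \<le> N" by auto
    obtain K where K: "2 ^ K \<le> N" "ln N / 2 \<le> real K" "real K \<le> 2 * ln N"
      using power2_bracket[OF N] by blast
    define A where "A = {p. prime p \<and> p \<noteq> 2 \<and> p < N}"
    let ?f = "\<lambda>x::nat \<times> nat. fst x + 2 ^ snd x"
    let ?X = "A \<times> {1..K}"
    have finA: "finite A" unfolding A_def by (rule finite_subset[of _ "{..N}"]) auto
    have ln0: "ln N > 0" using N by simp
    have "real N / (12 * ln N) \<le> real (card A)"
    proof -
      have "{p. prime p \<and> p \<le> N} \<subseteq> A \<union> {2, N}" by (auto simp: A_def)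
      then have "card {p. prime p \<and> p \<le> N} \<le> card (A \<union> {2, N})" using finA by (intro card_mono) auto
      also have "\<dots> \<le> card A + card {2, N}" by (rule card_Un_le)
      also have "card {2, N} \<le> 2" by (simp add: card_insert_if)
      finally have "real N / (6 * ln N) \<le> real (card A) + 2" using card_primes_ge[of N] N by simp
      moreover have "2 \<le> real N / (12 * ln N)" using lnN ln0 by (simp add: field_simps)
      moreover have "real N / (6 * ln N) = real N / (12 * ln N) + real N / (12 * ln N)" by simp
      ultimately show ?thesis by linarith
    qed
    then have "real N / (12 * ln N) * (ln N / 2) \<le> real (card A) * real K"
      using K ln0 by (intro mult_mono) auto
    then have X: "real N / 24 \<le> real (card ?X)" using ln0 by (simp add: card_cartesian_product)
    have "(real N / 24)\<^sup>2 \<le> (real (card ?X))\<^sup>2" using X by (intro power_mono) auto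
    also have "\<dots> \<le> real (card {(x, y). x \<in> ?X \<and> y \<in> ?X \<and> ?f x = ?f y}) * real (card (?f ` ?X))"
      using finA by (intro card_squared_le_card_image_collisions) auto
    also have "\<dots> \<le> (B * real N) * real (card {n \<in> sums_prime_power2. n \<le> 2 * N})"
    proof (intro mult_mono)
      show "real (card {(x, y). x \<in> ?X \<and> y \<in> ?X \<and> ?f x = ?f y}) \<le> B * real N"
        unfolding B_def A_def using N K C(2) by (intro card_collisions_le) auto
      have "?f ` ?X \<subseteq> {n \<in> sums_prime_power2. n \<le> 2 * N}"
      proof
        fix n assume "n \<in> ?f ` ?X"
        then obtain p k where pk: "p \<in> A" "1 \<le> k" "k \<le> K" "n = p + 2 ^ k" by auto
        have "odd p" using pk(1) primes_dvd_imp_eq[of 2 p] by (auto simp: A_def)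
        then have "odd n" using pk by simp
        moreover have "(2::nat) ^ k \<le> 2 ^ K" "p < N" using pk by (auto simp: A_def)
        then have "n \<le> 2 * N" using pk(4) K(1) by linarith
        ultimately show "n \<in> {n \<in> sums_prime_power2. n \<le> 2 * N}"
          using pk unfolding sums_prime_power2_def A_def by auto
      qed
      then have "card (?f ` ?X) \<le> card {n \<in> sums_prime_power2. n \<le> 2 * N}"
        by (intro card_mono) auto
      then show "real (card (?f ` ?X)) \<le> real (card {n \<in> sums_prime_power2. n \<le> 2 * N})" by simp
    qed (use B in auto)
    finally have "real N * (real N / 576) \<le> real N * (B * real (card {n \<in> sums_prime_power2. n \<le> 2 * N}))"
      by (simp add: power2_eq_square mult_ac)
    then have "real N / 576 \<le> B * real (card {n \<in> sums_prime_power2. n \<le> 2 * N})"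
      using N by (subst (asm) mult_le_cancel_left_pos) auto
    then show ?case using B by (simp add: field_simps)
  qed
  moreover have "1 / (576 * B) > 0" using B by simp
  ultimately show ?thesis by blast
qed

section \<open>Nearly covering the exponents\<close>

text \<open>The product of \<open>q / (q - 1)\<close> over the primes up to \<open>z\<close> is at
  least \<open>ln z\<close>, hence unbounded, and the primes up to \<open>n\<close> account for only
  the fixed factor \<open>c\<close>.\<close>

lemma prod_one_minus_inverse_primes_small:
  fixes \<epsilon> :: real and n :: nat
  assumes \<epsilon>: "\<epsilon> > 0"
  shows "\<exists>\<Lambda>. finite \<Lambda> \<and> (\<forall>l\<in>\<Lambda>. prime l \<and> l > n) \<and> (\<Prod>l\<in>\<Lambda>. 1 - 1 / real l) < \<epsilon>"
proof -
  define R where "R = {q. prime q \<and> q \<le> n}"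
  define c where "c = (\<Prod>q\<in>R. real q / (real q - 1))"
  have finR: "finite R" unfolding R_def by (rule finite_subset[of _ "{..n}"]) auto
  have c: "c > 0" unfolding c_def R_def by (intro prod_pos) (auto dest: prime_gt_1_nat)
  define z where "z = exp (c / \<epsilon> + 1)"
  have z: "z \<ge> 1" "ln z > c / \<epsilon>" using c \<epsilon> by (simp_all add: z_def)
  define P where "P = {q. prime q \<and> real q \<le> z} \<union> R"
  have "finite {q. prime q \<and> real q \<le> z}"
    by (rule finite_subset[of _ "{..nat \<lfloor>z\<rfloor>}"]) (auto simp: le_nat_iff le_floor_iff)
  then have finP: "finite P" using finR by (simp add: P_def)
  have prP: "prime q" if "q \<in> P" for q using that by (auto simp: P_def R_def)
  have "ln z \<le> (\<Sum>D\<in>bounded_prime_sets P z. \<Prod>q\<in>D. 1 / (real q - 1))"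
    by (rule ln_le_sum_bounded_prime_sets[OF z(1) finP prP]) (auto simp: P_def)
  also have "\<dots> \<le> (\<Sum>D\<in>Pow P. \<Prod>q\<in>D. 1 / (real q - 1))"
  proof (rule sum_mono2)
    fix D assume D: "D \<in> Pow P - bounded_prime_sets P z"
    show "0 \<le> (\<Prod>q\<in>D. 1 / (real q - 1))"
    proof (rule prod_nonneg)
      fix q assume "q \<in> D"
      then have "prime q" using D prP by blast
      from prime_gt_1_nat[OF this] show "0 \<le> 1 / (real q - 1)" by simp
    qed
  qed (use finP in \<open>auto simp: bounded_prime_sets_def\<close>)
  also have "\<dots> = (\<Prod>q\<in>P. 1 + 1 / (real q - 1))" by (rule sum_Pow_prod[OF finP])
  also have "\<dots> = (\<Prod>q\<in>P. real q / (real q - 1))"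
  proof (intro prod.cong refl)
    fix q assume "q \<in> P"
    from prime_gt_1_nat[OF prP[OF this]] show "1 + 1 / (real q - 1) = real q / (real q - 1)"
      by (simp add: field_simps)
  qed
  also have "\<dots> = (\<Prod>q\<in>P - R. real q / (real q - 1)) * c"
    unfolding c_def using finP by (intro prod.subset_diff) (auto simp: P_def)
  finally have "c / \<epsilon> < (\<Prod>q\<in>P - R. real q / (real q - 1)) * c" using z(2) by linarith
  then have "1 / \<epsilon> * c < (\<Prod>q\<in>P - R. real q / (real q - 1)) * c" by simp
  then have 1: "1 / \<epsilon> < (\<Prod>q\<in>P - R. real q / (real q - 1))" using c by (simp only: mult_less_cancel_right_pos)
  have inv: "(\<Prod>l\<in>P - R. 1 - 1 / real l) = 1 / (\<Prod>q\<in>P - R. real q / (real q - 1))"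
  proof -
    have "(\<Prod>l\<in>P - R. 1 - 1 / real l) = (\<Prod>l\<in>P - R. 1 / (real l / (real l - 1)))"
    proof (intro prod.cong refl)
      fix l assume "l \<in> P - R"
      then have "l > 1" using prP prime_gt_1_nat by blast
      then show "1 - 1 / real l = 1 / (real l / (real l - 1))" by (simp add: field_simps)
    qed
    then show ?thesis by (simp add: prod_dividef)
  qed
  have "1 / \<epsilon> > 0" using \<epsilon> by simp
  then have "1 / (\<Prod>q\<in>P - R. real q / (real q - 1)) < 1 / (1 / \<epsilon>)"
    by (intro divide_strict_left_mono 1 mult_pos_pos less_trans[OF _ 1]) auto
  then have "(\<Prod>l\<in>P - R. 1 - 1 / real l) < \<epsilon>" unfolding inv by simp
  moreover have "\<forall>l\<in>P - R. prime l \<and> l > n" by (auto simp: P_def R_def)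
  ultimately show ?thesis using finP by (intro exI[of _ "P - R"]) auto
qed

text \<open>For \<open>u = 1 / l\<close> the square of \<open>(1 - u) * (1 + u / 2)\<close> is at
  most \<open>1 - u\<close>, so the loss consumes at most half of the gain in the exponent; hence
  the call with \<open>\<epsilon>\<^sup>2\<close>.\<close>

lemma prod_covering_factor_small:
  fixes \<epsilon> :: real and n :: nat
  assumes \<epsilon>: "\<epsilon> > 0"
  shows "\<exists>\<Lambda>. finite \<Lambda> \<and> (\<forall>l\<in>\<Lambda>. prime l \<and> l > n) \<and>
    (\<Prod>l\<in>\<Lambda>. 1 - 1 / real l) * (\<Prod>l\<in>\<Lambda>. 1 + 1 / (2 * real l)) < \<epsilon>"
proof -
  obtain \<Lambda> where \<Lambda>: "finite \<Lambda>" "\<forall>l\<in>\<Lambda>. prime l \<and> l > n" "(\<Prod>l\<in>\<Lambda>. 1 - 1 / real l) < \<epsilon>\<^sup>2"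
    using prod_one_minus_inverse_primes_small[of "\<epsilon>\<^sup>2" n] \<epsilon> by auto
  let ?p = "(\<Prod>l\<in>\<Lambda>. 1 - 1 / real l) * (\<Prod>l\<in>\<Lambda>. 1 + 1 / (2 * real l))"
  have "?p\<^sup>2 = (\<Prod>l\<in>\<Lambda>. ((1 - 1 / real l) * (1 + 1 / (2 * real l)))\<^sup>2)"
    by (simp only: prod.distrib[symmetric] prod_power_distrib)
  also have "\<dots> \<le> (\<Prod>l\<in>\<Lambda>. 1 - 1 / real l)"
  proof (intro prod_mono conjI)
    fix l assume "l \<in> \<Lambda>"
    then have "l > 1" using \<Lambda>(2) prime_gt_1_nat by blast
    define u where "u = 1 / real l"
    have u: "0 \<le> u" "u \<le> 1" using \<open>l > 1\<close> by (auto simp: u_def)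
    have "((1 - u) * (1 + u / 2))\<^sup>2 = (1 - u) * (1 - (3 * u\<^sup>2 / 4 + u ^ 3 / 4))"
      by (simp add: power2_eq_square power3_eq_cube field_simps)
    also have "\<dots> \<le> (1 - u) * 1"
    proof (intro mult_left_mono)
      have "0 \<le> 3 * u\<^sup>2 / 4 + u ^ 3 / 4" using u(1) by simp
      then show "1 - (3 * u\<^sup>2 / 4 + u ^ 3 / 4) \<le> 1" by linarith
    qed (use u in simp)
    finally show "((1 - 1 / real l) * (1 + 1 / (2 * real l)))\<^sup>2 \<le> 1 - 1 / real l"
      by (simp add: u_def mult.commute)
  qed simp
  finally have "?p\<^sup>2 < \<epsilon>\<^sup>2" using \<Lambda>(3) by linarith
  then have "?p < \<epsilon>" using \<epsilon> by (intro power_less_imp_less_base[of ?p 2 \<epsilon>]) auto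
  then show ?thesis using \<Lambda> by blast
qed

text \<open>The order of 2 modulo a prime factor \<open>q\<close> divides the prime
  \<open>l\<close>, and order 1 would mean that \<open>q\<close> divides 1. Fermat then gives
  \<open>l dvd q - 1\<close>, and oddness of \<open>q\<close> adds the factor 2.\<close>

lemma mersenne_prime_factor:
  fixes l :: nat
  assumes l: "prime l" "l > 2"
  shows "\<exists>q. prime q \<and> q dvd 2 ^ l - 1 \<and> ord q 2 = l \<and> 2 * l + 1 \<le> q"
proof -
  have "(2::nat) ^ 2 \<le> 2 ^ l" using l by (intro power_increasing) auto
  then have "(2::nat) ^ l - 1 \<noteq> 1" by simp
  then obtain q :: nat where q: "prime q" "q dvd 2 ^ l - 1" using prime_factor_nat by blast
  have "ord q 2 dvd l" using q(2) by (simp only: dvd_mersenne_iff_ord)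
  then have "ord q 2 = 1 \<or> ord q 2 = l" using l(1) by (simp add: prime_nat_iff)
  moreover have "ord q 2 \<noteq> 1"
  proof
    assume "ord q 2 = 1"
    then have "q dvd 2 ^ 1 - 1" by (simp only: dvd_mersenne_iff_ord dvd_refl)
    then show False using q(1) by simp
  qed
  ultimately have ord: "ord q 2 = l" by blast
  have "q \<noteq> 2"
  proof
    assume "q = 2"
    moreover have "odd ((2::nat) ^ l - 1)" using l by simp
    ultimately show False using q(2) by simp
  qed
  then have oddq: "odd q" using q(1) primes_dvd_imp_eq[of 2 q] by auto
  have "\<not> q dvd 2" using q(1) \<open>q \<noteq> 2\<close> primes_dvd_imp_eq[of q 2] by auto
  then have "[2 ^ (q - 1) = 1] (mod q)" using fermat_theorem[OF q(1)] by blast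
  then have "l dvd q - 1" using ord by (simp only: ord_divides)
  moreover have "2 dvd q - 1" using oddq by simp
  moreover have "coprime 2 l" using l primes_coprime[of 2 l] by auto
  ultimately have "2 * l dvd q - 1" by (simp add: divides_mult)
  then have "2 * l \<le> q - 1" using prime_gt_1_nat[OF q(1)] by (intro dvd_imp_le) auto
  then have "2 * l + 1 \<le> q" using prime_gt_1_nat[OF q(1)] by simp
  with q ord show ?thesis by blast
qed

section \<open>Choice of the residue classes covering the exponents\<close>

lemma popular_residue:
  fixes B :: "nat set" and l :: nat
  assumes B: "finite B" and l: "l > 0"
  shows "\<exists>r. real (card {k \<in> B. k mod l \<noteq> r}) \<le> (1 - 1 / real l) * real (card B)"
proof -
  have "\<exists>r<l. real (card B) / real l \<le> real (card {k \<in> B. k mod l = r})"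
  proof (rule ccontr)
    assume "\<not> ?thesis"
    then have less: "real (card {k \<in> B. k mod l = r}) < real (card B) / real l" if "r < l" for r
      using that by (auto simp: not_le)
    have img: "(\<lambda>k. k mod l) ` B \<subseteq> {..<l}" using l by auto
    have "card B = (\<Sum>r<l. card {k \<in> B. k mod l = r})"
      using sum.group[OF B _ img, of "\<lambda>_. 1::nat"] by simp
    then have "real (card B) = (\<Sum>r<l. real (card {k \<in> B. k mod l = r}))" by simp
    also have "\<dots> < (\<Sum>r<l. real (card B) / real l)"
      using l less by (intro sum_strict_mono) auto
    also have "\<dots> = real (card B)" using l by simp
    finally show False by simp
  qed
  then obtain r where r: "real (card B) / real l \<le> real (card {k \<in> B. k mod l = r})" by blast
  have "B = {k \<in> B. k mod l = r} \<union> {k \<in> B. k mod l \<noteq> r}" by auto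
  then have "card B = card ({k \<in> B. k mod l = r} \<union> {k \<in> B. k mod l \<noteq> r})" by (simp only:)
  also have "\<dots> = card {k \<in> B. k mod l = r} + card {k \<in> B. k mod l \<noteq> r}"
    using B by (intro card_Un_disjoint) auto
  finally have "real (card {k \<in> B. k mod l \<noteq> r}) \<le> real (card B) - real (card B) / real l" using r by simp
  then show ?thesis by (intro exI[of _ r]) (simp add: algebra_simps)
qed

text \<open>For each \<open>x\<close> in turn, the class chosen holds at least the average share of
  the exponents still uncovered, which therefore shrink by the factor
  \<open>1 - 1 / real x\<close>.\<close>

lemma greedy_residues:
  fixes \<Lambda> B :: "nat set"
  assumes "finite \<Lambda>" "\<And>l. l \<in> \<Lambda> \<Longrightarrow> l > 0" "finite B"
  shows "\<exists>r. real (card {k \<in> B. \<forall>l\<in>\<Lambda>. k mod l \<noteq> r l}) \<le> (\<Prod>l\<in>\<Lambda>. 1 - 1 / real l) * real (card B)"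
  using assms
proof (induction \<Lambda> rule: finite_induct)
  case (insert x F)
  then obtain r where r: "real (card {k \<in> B. \<forall>l\<in>F. k mod l \<noteq> r l}) \<le> (\<Prod>l\<in>F. 1 - 1 / real l) * real (card B)"
    by auto
  obtain s where s: "real (card {k \<in> {k \<in> B. \<forall>l\<in>F. k mod l \<noteq> r l}. k mod x \<noteq> s})
      \<le> (1 - 1 / real x) * real (card {k \<in> B. \<forall>l\<in>F. k mod l \<noteq> r l})"
    using popular_residue[of "{k \<in> B. \<forall>l\<in>F. k mod l \<noteq> r l}" x] insert by auto
  have "{k \<in> B. \<forall>l\<in>insert x F. k mod l \<noteq> (r(x := s)) l} = {k \<in> {k \<in> B. \<forall>l\<in>F. k mod l \<noteq> r l}. k mod x \<noteq> s}"
    using insert(2) by auto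
  then have "real (card {k \<in> B. \<forall>l\<in>insert x F. k mod l \<noteq> (r(x := s)) l}) \<le> (1 - 1 / real x) * real (card {k \<in> B. \<forall>l\<in>F. k mod l \<noteq> r l})"
    using s by (simp only:)
  also have "\<dots> \<le> (1 - 1 / real x) * ((\<Prod>l\<in>F. 1 - 1 / real l) * real (card B))"
    using r insert.prems(1)[of x] by (intro mult_left_mono) auto
  also have "\<dots> = (\<Prod>l\<in>insert x F. 1 - 1 / real l) * real (card B)" using insert by simp
  finally show ?case by blast
qed simp

text \<open>Being uncovered is periodic modulo the product of \<open>\<Lambda>\<close>, so the
  greedy choice is made on one period and works for all \<open>K\<close> at once; the last
  incomplete period costs the constant \<open>L\<close>.\<close>

lemma uncovered_exponents_sparse:
  fixes \<Lambda> :: "nat set"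
  assumes \<Lambda>: "finite \<Lambda>" "\<And>l. l \<in> \<Lambda> \<Longrightarrow> l > 0"
  shows "\<exists>r L. \<forall>K. real (card {k. k < K \<and> (\<forall>l\<in>\<Lambda>. k mod l \<noteq> r l)}) \<le> (\<Prod>l\<in>\<Lambda>. 1 - 1 / real l) * real K + L"
proof -
  let ?L = "\<Prod>\<Lambda>"
  have L: "?L > 0" using \<Lambda> by (intro prod_pos) auto
  obtain r where r: "real (card {k \<in> {..<?L}. \<forall>l\<in>\<Lambda>. k mod l \<noteq> r l}) \<le> (\<Prod>l\<in>\<Lambda>. 1 - 1 / real l) * real (card {..<?L})"
    using greedy_residues[OF \<Lambda>, of "{..<?L}"] by auto
  define V where "V = {k \<in> {..<?L}. \<forall>l\<in>\<Lambda>. k mod l \<noteq> r l}"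
  have V: "V \<subseteq> {..<?L}" by (auto simp: V_def)
  have mm: "k mod ?L mod l = k mod l" if "l \<in> \<Lambda>" for k l
    using dvd_prodI[OF \<Lambda>(1) that, of "\<lambda>x. x"] by (simp add: mod_mod_cancel)
  have "real (card {k. k < K \<and> (\<forall>l\<in>\<Lambda>. k mod l \<noteq> r l)}) \<le> (\<Prod>l\<in>\<Lambda>. 1 - 1 / real l) * real K + real (card V)" for K
  proof -
    have eq: "{k. k < K \<and> (\<forall>l\<in>\<Lambda>. k mod l \<noteq> r l)} = {k. k < K \<and> k mod ?L \<in> V}" using mm L by (auto simp: V_def)
    have "real (card {k. k < K \<and> (\<forall>l\<in>\<Lambda>. k mod l \<noteq> r l)}) \<le> real (card V) * (real K / real ?L) + real (card V)"
      unfolding eq using card_residues_less[OF V, of K] by linarith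
    also have "real (card V) * (real K / real ?L) \<le> (\<Prod>l\<in>\<Lambda>. 1 - 1 / real l) * real (card {..<?L}) * (real K / real ?L)"
      using r unfolding V_def by (rule mult_right_mono) (intro divide_nonneg_nonneg of_nat_0_le_iff)
    also have "\<dots> = (\<Prod>l\<in>\<Lambda>. 1 - 1 / real l) * (real ?L * (real K / real ?L))"
      by (simp only: card_lessThan mult.assoc)
    also have "real ?L * (real K / real ?L) = real K"
    proof -
      have "real ?L \<noteq> 0" using L by (simp only: of_nat_eq_0_iff neq0_conv)
      then show ?thesis by (metis nonzero_mult_div_cancel_left times_divide_eq_right)
    qed
    finally show ?thesis by simp
  qed
  then show ?thesis by blast
qed

section \<open>Progressions with few representable elements\<close>

lemma eventually_error_terms_small:
  fixes A B c :: real
  assumes "c > 0"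
  shows "\<forall>\<^sub>F x in sequentially. A * ln (real x) + B * real x / ln (real x) \<le> c * real x"
proof -
  have 1: "(\<lambda>x::nat. ln (real x) / real x) \<longlonglongrightarrow> 0" by real_asymp
  have 2: "(\<lambda>x::nat. 1 / ln (real x)) \<longlonglongrightarrow> 0" by real_asymp
  have "(\<lambda>x::nat. A * (ln (real x) / real x) + B * (1 / ln (real x))) \<longlonglongrightarrow> A * 0 + B * 0"
    by (intro tendsto_intros 1 2)
  then have "\<forall>\<^sub>F x in sequentially. A * (ln (real x) / real x) + B * (1 / ln (real x)) < c"
    using assms by (intro order_tendstoD) auto
  then show ?thesis using eventually_gt_at_top[of 0]
  proof eventually_elim
    case (elim x)
    have "(A * (ln (real x) / real x) + B * (1 / ln (real x))) * real x \<le> c * real x"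
      using elim by (intro mult_right_mono) auto
    moreover have "(A * (ln (real x) / real x) + B * (1 / ln (real x))) * real x = A * ln (real x) + B * real x / ln (real x)"
      using elim by (simp add: field_simps)
    ultimately show ?case by simp
  qed
qed

text \<open>Any solution \<open>p0\<close> names the residue class of \<open>b - 2 ^ k\<close>
  without a subtraction of natural numbers.\<close>

lemma card_primes_shifted_cong_le:
  fixes M b k x :: nat
  assumes M: "M > 0" and x: "x \<ge> 2" "x \<ge> M ^ 2"
  shows "real (card {p. prime p \<and> p \<le> x \<and> [p + 2 ^ k = b] (mod M)}) \<le> 48 * totient_ratio M * real x / (real M * ln x)"
proof (cases "{p. prime p \<and> p \<le> x \<and> [p + 2 ^ k = b] (mod M)} = {}")
  case True
  then show ?thesis using totient_ratio_ge_1[of M] x by (simp only: card.empty) simp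
next
  case False
  then obtain p0 where p0: "[p0 + 2 ^ k = b] (mod M)" by auto
  have "{p. prime p \<and> p \<le> x \<and> [p + 2 ^ k = b] (mod M)} \<subseteq> {p. prime p \<and> p \<le> x \<and> p mod M = p0 mod M}"
  proof safe
    fix p assume "[p + 2 ^ k = b] (mod M)"
    then have "[p + 2 ^ k = p0 + 2 ^ k] (mod M)" using p0 cong_sym cong_trans by blast
    then show "p mod M = p0 mod M" by (simp only: cong_add_rcancel_nat) (simp add: Cong.cong_def)
  qed
  then have "card {p. prime p \<and> p \<le> x \<and> [p + 2 ^ k = b] (mod M)} \<le> card {p. prime p \<and> p \<le> x \<and> p mod M = p0 mod M}"
    by (intro card_mono) (auto intro: finite_subset[of _ "{..x}"])
  then show ?thesis using card_primes_residue_class_le[OF assms, of "p0 mod M"] by linarith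
qed

lemma totient_ratio_prod_primes_le:
  fixes q :: "nat \<Rightarrow> nat"
  assumes "finite \<Lambda>" "\<And>l. l \<in> \<Lambda> \<Longrightarrow> prime (q l)" "m > 0"
  shows "totient_ratio (m * (\<Prod>l\<in>\<Lambda>. q l)) \<le> totient_ratio m * (\<Prod>l\<in>\<Lambda>. real (q l) / (real (q l) - 1))"
  using assms
proof (induction \<Lambda> rule: finite_induct)
  case (insert x F)
  have pos: "m * (\<Prod>l\<in>F. q l) > 0"
    using insert.prems by (intro mult_pos_pos prod_pos) (auto intro!: prime_gt_0_nat)
  have qx: "prime (q x)" using insert.prems by simp
  have "totient_ratio (m * (\<Prod>l\<in>insert x F. q l)) = totient_ratio (q x * (m * (\<Prod>l\<in>F. q l)))"
    using insert.hyps by (simp add: mult_ac)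
  also have "\<dots> \<le> totient_ratio (q x) * totient_ratio (m * (\<Prod>l\<in>F. q l))"
    using pos prime_gt_0_nat[OF qx] by (intro totient_ratio_mult_le) auto
  also have "\<dots> \<le> totient_ratio (q x) * (totient_ratio m * (\<Prod>l\<in>F. real (q l) / (real (q l) - 1)))"
    using insert totient_ratio_ge_1[of "q x"] by (intro mult_left_mono) auto
  also have "totient_ratio (q x) = real (q x) / (real (q x) - 1)"
    using qx by (simp add: totient_ratio_def prime_prime_factors)
  finally show ?case using insert.hyps by (simp add: mult_ac)
qed simp

text \<open>Fixing the residues of \<open>b\<close> modulo prime factors \<open>q l\<close> of \<open>2 ^ l - 1\<close>, for many primes \<open>l\<close>, forces
  \<open>q l\<close> to divide \<open>b - 2 ^ k\<close> for all \<open>k\<close> outside a set of density \<open>\<Prod>(1 - 1 / l)\<close>. Since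
  \<open>q l > 2 * l\<close>, the factor \<open>\<Prod>(1 + 1 / (2 * l))\<close> lost in the Brun-Titchmarsh bound is smaller than
  what is gained.\<close>

lemma sparse_subprogression:
  fixes m a :: nat
  assumes m: "m > 0"
  shows "\<exists>M b. M > 0 \<and> m dvd M \<and> [b = a] (mod m) \<and>
    (\<forall>\<^sub>F x in sequentially. real (card {n. n \<le> x \<and> [n = b] (mod M) \<and> n \<in> sums_prime_power2}) \<le> real x / (2 * real M))"
proof -
  have tm: "totient_ratio m \<ge> 1" by (rule totient_ratio_ge_1)
  \<comment> \<open>Since \<open>l > m\<close>, also \<open>q l > m\<close>, so \<open>q l\<close>
    does not divide \<open>m\<close>. The 576 is \<open>4 * 48 * 3\<close>: at most
    \<open>3 * ln x\<close> exponents, the Brun-Titchmarsh constant 48, and a quarter of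
    \<open>x / M\<close> as the target.\<close>
  obtain \<Lambda> where \<Lambda>: "finite \<Lambda>" "\<forall>l\<in>\<Lambda>. prime l \<and> l > max m 2"
    and small: "(\<Prod>l\<in>\<Lambda>. 1 - 1 / real l) * (\<Prod>l\<in>\<Lambda>. 1 + 1 / (2 * real l)) < 1 / (576 * totient_ratio m)"
    using prod_covering_factor_small[of "1 / (576 * totient_ratio m)" "max m 2"] tm by auto
  have "\<forall>l\<in>\<Lambda>. \<exists>q. prime q \<and> q dvd 2 ^ l - 1 \<and> ord q 2 = l \<and> 2 * l + 1 \<le> q"
    using \<Lambda>(2) by (intro ballI mersenne_prime_factor) auto
  then obtain q where q: "\<And>l. l \<in> \<Lambda> \<Longrightarrow> prime (q l)" "\<And>l. l \<in> \<Lambda> \<Longrightarrow> q l dvd 2 ^ l - 1"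
    "\<And>l. l \<in> \<Lambda> \<Longrightarrow> ord (q l) 2 = l" "\<And>l. l \<in> \<Lambda> \<Longrightarrow> 2 * l + 1 \<le> q l"
    by metis
  have lpos: "l > 0" if "l \<in> \<Lambda>" for l using \<Lambda>(2) that by auto
  obtain r L where rL: "\<And>K. real (card {k. k < K \<and> (\<forall>l\<in>\<Lambda>. k mod l \<noteq> r l)}) \<le> (\<Prod>l\<in>\<Lambda>. 1 - 1 / real l) * real K + L"
    using uncovered_exponents_sparse[OF \<Lambda>(1) lpos] by blast
  define \<delta> where "\<delta> = (\<Prod>l\<in>\<Lambda>. 1 - 1 / real l)"
  have \<delta>0: "\<delta> \<ge> 0" unfolding \<delta>_def using lpos by (intro prod_nonneg) (auto simp: Suc_le_eq)
  define M where "M = m * (\<Prod>l\<in>\<Lambda>. q l)"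
  have M: "M > 0" unfolding M_def using m q(1) by (intro mult_pos_pos prod_pos) (auto intro!: prime_gt_0_nat)
  have "0 \<notin> \<Lambda>" using lpos by auto
  \<comment> \<open>The index 0, which is not in \<open>\<Lambda>\<close>, stands for the modulus
    \<open>m\<close>.\<close>
  define mo where "mo i = (if i = 0 then m else q i)" for i
  have cop: "\<forall>i\<in>insert 0 \<Lambda>. \<forall>j\<in>insert 0 \<Lambda>. i \<noteq> j \<longrightarrow> coprime (mo i) (mo j)"
  proof (intro ballI impI)
    fix i j assume ij: "i \<in> insert 0 \<Lambda>" "j \<in> insert 0 \<Lambda>" "i \<noteq> j"
    have qm: "coprime (q l) m" if "l \<in> \<Lambda>" for l
    proof (rule prime_imp_coprime[OF q(1)[OF that]])
      have "m < q l" using q(4)[OF that] \<Lambda>(2) that by fastforce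
      then show "\<not> q l dvd m" using m by (auto dest: dvd_imp_le)
    qed
    \<comment> \<open>Different \<open>l\<close> give different primes \<open>q l\<close>, because 2
      has order \<open>l\<close> modulo \<open>q l\<close>.\<close>
    have qq: "coprime (q i) (q j)" if "i \<in> \<Lambda>" "j \<in> \<Lambda>"
      using q(1,3) that ij(3) by (intro primes_coprime) metis+
    show "coprime (mo i) (mo j)"
      using ij qm[of i] qm[of j] qq \<open>0 \<notin> \<Lambda>\<close> by (auto simp: mo_def coprime_commute)
  qed
  obtain b where b: "\<forall>i\<in>insert 0 \<Lambda>. [b = (if i = 0 then a else 2 ^ r i)] (mod mo i)"
    using chinese_remainder_nat[of "insert 0 \<Lambda>" mo "\<lambda>i. if i = 0 then a else 2 ^ r i"] cop \<Lambda>(1) by blast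
  have ba: "[b = a] (mod m)" using b by (auto simp: mo_def)
  have bq: "[b = 2 ^ r l] (mod q l)" if "l \<in> \<Lambda>" for l
    using b[rule_format, of l] that lpos[OF that] by (simp add: mo_def)
  have dvdM: "q l dvd M" if "l \<in> \<Lambda>" for l
    unfolding M_def using dvd_prodI[OF \<Lambda>(1) that, of q] by simp
  define R where "R x k = {p. prime p \<and> p \<le> x \<and> [p + 2 ^ k = b] (mod M)}" for x k :: nat
  \<comment> \<open>For a covered exponent \<open>2 ^ k\<close>, \<open>2 ^ r l\<close> and
    \<open>b\<close> agree modulo \<open>q l\<close>, so \<open>q l\<close> divides \<open>p\<close>
    and the prime \<open>p\<close> equals \<open>q l\<close>. Such an exponent contributes at most
    \<open>card \<Lambda>\<close> primes.\<close>
  have covered: "R x k \<subseteq> q ` \<Lambda>" if kl: "l \<in> \<Lambda>" "k mod l = r l" for x k l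
  proof
    fix p assume "p \<in> R x k"
    then have p: "prime p" "[p + 2 ^ k = b] (mod M)" by (auto simp: R_def)
    have ql: "[2 ^ l = 1] (mod q l)" using ord[of 2 "q l"] q(3)[OF kl(1)] by simp
    have "(2::nat) ^ k = (2 ^ l) ^ (k div l) * 2 ^ r l"
      unfolding kl(2)[symmetric] by (simp flip: power_mult power_add)
    also have "[(2 ^ l) ^ (k div l) * 2 ^ r l = 1 ^ (k div l) * 2 ^ r l] (mod q l)"
      by (intro cong_mult cong_pow ql cong_refl)
    finally have "[2 ^ k = 2 ^ r l] (mod q l)" by simp
    then have "[b = 2 ^ k] (mod q l)" using bq[OF kl(1)] cong_sym cong_trans by blast
    moreover have "[p + 2 ^ k = b] (mod q l)" using p(2) dvdM[OF kl(1)] cong_dvd_modulus_nat by blast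
    ultimately have "[p + 2 ^ k = 0 + 2 ^ k] (mod q l)" using cong_trans by fastforce
    then have "[p = 0] (mod q l)" by (simp only: cong_add_rcancel_nat)
    then have "q l dvd p" by (simp add: cong_0_iff)
    then have "p = q l" using p(1) q(1)[OF kl(1)] primes_dvd_imp_eq by metis
    then show "p \<in> q ` \<Lambda>" using kl(1) by blast
  qed
  define t where "t = totient_ratio M"
  have t0: "t \<ge> 1" unfolding t_def by (rule totient_ratio_ge_1)
  have t\<delta>: "576 * (t * \<delta>) \<le> 1"
  proof -
    have "t \<le> totient_ratio m * (\<Prod>l\<in>\<Lambda>. real (q l) / (real (q l) - 1))"
      unfolding t_def M_def using \<Lambda>(1) q(1) m by (intro totient_ratio_prod_primes_le) auto
    also have "\<dots> \<le> totient_ratio m * (\<Prod>l\<in>\<Lambda>. 1 + 1 / (2 * real l))"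
    proof (intro mult_left_mono prod_mono conjI)
      fix l assume l: "l \<in> \<Lambda>"
      have "real (2 * l + 1) \<le> real (q l)" using q(4)[OF l] by (simp only: of_nat_le_iff)
      then have ql: "2 * real l \<le> real (q l) - 1" by simp
      have "real (q l) / (real (q l) - 1) = 1 + 1 / (real (q l) - 1)" using ql lpos[OF l] by (simp add: field_simps)
      also have "\<dots> \<le> 1 + 1 / (2 * real l)" using ql lpos[OF l] by (intro add_left_mono divide_left_mono) auto
      finally show "real (q l) / (real (q l) - 1) \<le> 1 + 1 / (2 * real l)" .
      show "0 \<le> real (q l) / (real (q l) - 1)" using ql lpos[OF l] by simp
    qed (use tm in simp)
    finally have "t * \<delta> \<le> totient_ratio m * (\<Prod>l\<in>\<Lambda>. 1 + 1 / (2 * real l)) * \<delta>" using \<delta>0 by (intro mult_right_mono)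
    also have "\<dots> = totient_ratio m * (\<delta> * (\<Prod>l\<in>\<Lambda>. 1 + 1 / (2 * real l)))" by (simp add: mult_ac)
    also have "\<dots> \<le> totient_ratio m * (1 / (576 * totient_ratio m))"
      using small tm unfolding \<delta>_def by (intro mult_left_mono) auto
    also have "\<dots> = 1 / 576" using tm by simp
    finally show ?thesis by simp
  qed
  \<comment> \<open>The lower-order terms: up to \<open>card \<Lambda>\<close> primes for each of at
    most \<open>3 * ln x\<close> exponents, and the additive constant \<open>L\<close> times the
    bound for a single exponent.\<close>
  have "\<forall>\<^sub>F x in sequentially. 3 * real (card \<Lambda>) * ln (real x) + (48 * t * L / real M) * real x / ln (real x) \<le> 1 / (4 * real M) * real x"
    using M by (intro eventually_error_terms_small) simp
  then have "\<forall>\<^sub>F x in sequentially. real (card {n. n \<le> x \<and> [n = b] (mod M) \<and> n \<in> sums_prime_power2}) \<le> real x / (2 * real M)"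
    using eventually_ge_at_top[of "max 8 (M ^ 2)"]
  proof eventually_elim
    case (elim x)
    then have x: "x \<ge> 8" "x \<ge> M ^ 2" by auto
    obtain K where K: "x < 2 ^ (K + 1)" "ln x / 2 \<le> real K" "real K \<le> 2 * ln x"
      using power2_bracket[OF x(1)] by blast
    have lnx: "ln x \<ge> 1"
    proof -
      have "exp 1 \<le> (3::real)" by (rule exp_le)
      then have "ln (exp 1) \<le> ln (real x)" using x by (intro ln_mono) auto
      then show ?thesis by simp
    qed
    define V where "V = {k. k < K + 1 \<and> (\<forall>l\<in>\<Lambda>. k mod l \<noteq> r l)}"
    define Y where "Y = 48 * t * real x / (real M * ln x)"
    have Y0: "Y \<ge> 0" unfolding Y_def using t0 lnx by simp
    have finR: "finite (R x k)" for k unfolding R_def by (rule finite_subset[of _ "{..x}"]) auto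
    have "{n. n \<le> x \<and> [n = b] (mod M) \<and> n \<in> sums_prime_power2} \<subseteq> (\<Union>k\<in>{..<K + 1}. (\<lambda>p. p + 2 ^ k) ` R x k)"
    proof
      fix n assume "n \<in> {n. n \<le> x \<and> [n = b] (mod M) \<and> n \<in> sums_prime_power2}"
      then obtain p k where n: "n \<le> x" "[n = b] (mod M)" "prime p" "n = p + 2 ^ k" by (auto simp: sums_prime_power2_def)
      have "2 ^ k \<le> x" using n(1,4) by simp
      then have "(2::nat) ^ k < 2 ^ (K + 1)" using K(1) by simp
      then have "k < K + 1" by (rule power_less_imp_less_exp[rotated]) simp
      then show "n \<in> (\<Union>k\<in>{..<K + 1}. (\<lambda>p. p + 2 ^ k) ` R x k)"
        using n unfolding R_def by (intro UN_I[of k] image_eqI[of _ _ p]) auto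
    qed
    then have "card {n. n \<le> x \<and> [n = b] (mod M) \<and> n \<in> sums_prime_power2} \<le> card (\<Union>k\<in>{..<K + 1}. (\<lambda>p. p + 2 ^ k) ` R x k)"
      using finR by (intro card_mono) auto
    also have "\<dots> \<le> (\<Sum>k<K + 1. card ((\<lambda>p. p + 2 ^ k) ` R x k))" by (intro card_UN_le) auto
    also have "\<dots> \<le> (\<Sum>k<K + 1. card (R x k))" using finR by (intro sum_mono card_image_le) auto
    finally have "real (card {n. n \<le> x \<and> [n = b] (mod M) \<and> n \<in> sums_prime_power2}) \<le> (\<Sum>k<K + 1. real (card (R x k)))"
      by (simp only: of_nat_le_iff flip: of_nat_sum)
    also have "\<dots> \<le> (\<Sum>k<K + 1. real (card \<Lambda>) + (if k \<in> V then Y else 0))"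
    proof (intro sum_mono)
      fix k assume k: "k \<in> {..<K + 1}"
      show "real (card (R x k)) \<le> real (card \<Lambda>) + (if k \<in> V then Y else 0)"
      proof (cases "k \<in> V")
        case True
        have "real (card (R x k)) \<le> Y" unfolding R_def Y_def t_def
          using card_primes_shifted_cong_le[OF M _ x(2)] x(1) by simp
        then show ?thesis using True by simp
      next
        case False
        then obtain l where "l \<in> \<Lambda>" "k mod l = r l" using k by (auto simp: V_def)
        then have "card (R x k) \<le> card (q ` \<Lambda>)" using covered \<Lambda>(1) by (intro card_mono) auto
        also have "\<dots> \<le> card \<Lambda>" using \<Lambda>(1) by (rule card_image_le)
        finally show ?thesis using False by simp
      qed
    qed
    also have "\<dots> = (real K + 1) * real (card \<Lambda>) + real (card V) * Y"
    proof -
      have "{..<K + 1} \<inter> {k. k \<in> V} = V" by (auto simp: V_def)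
      then show ?thesis by (simp only: sum.distrib sum.If_cases finite_lessThan) simp
    qed
    also have "\<dots> \<le> 3 * ln x * real (card \<Lambda>) + (\<delta> * (3 * ln x) + L) * Y"
    proof (intro add_mono mult_right_mono Y0)
      show "real K + 1 \<le> 3 * ln x" using K(3) lnx by linarith
      have "real (card V) \<le> \<delta> * real (K + 1) + L" unfolding V_def \<delta>_def by (rule rL)
      also have "\<delta> * real (K + 1) \<le> \<delta> * (3 * ln x)" using K(3) lnx \<delta>0 by (intro mult_left_mono) auto
      finally show "real (card V) \<le> \<delta> * (3 * ln x) + L" by simp
    qed simp
    also have "\<dots> = 144 * (t * \<delta>) * (real x / real M) + (3 * real (card \<Lambda>) * ln x + (48 * t * L / real M) * real x / ln x)"
      unfolding Y_def using lnx M by (simp add: field_simps)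
    also have "\<dots> \<le> 1 / 4 * (real x / real M) + 1 / (4 * real M) * real x"
      using t\<delta> elim by (intro add_mono mult_right_mono) auto
    also have "\<dots> = real x / (2 * real M)" by simp
    finally show ?case .
  qed
  then show ?thesis using M ba unfolding M_def by (intro exI[of _ M] exI[of _ b]) (auto simp: M_def)
qed

section \<open>Sets of density zero\<close>

lemma density_zeroD:
  assumes "has_asymp_density A 0" "c > 0"
  shows "\<forall>\<^sub>F x in sequentially. real (card {n \<in> A. 1 \<le> n \<and> n \<le> x}) \<le> c * real x"
proof -
  have "((\<lambda>x::real. real (card {n \<in> A. 1 \<le> n \<and> real n \<le> x}) / x) \<longlongrightarrow> 0) at_top"
    using assms(1) by (simp add: has_asymp_density_def)
  from filterlim_compose[OF this filterlim_real_sequentially]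
  have "(\<lambda>x::nat. real (card {n \<in> A. 1 \<le> n \<and> n \<le> x}) / real x) \<longlonglongrightarrow> 0" by simp
  then have "\<forall>\<^sub>F x in sequentially. real (card {n \<in> A. 1 \<le> n \<and> n \<le> x}) / real x < c"
    using assms(2) by (intro order_tendstoD)
  then show ?thesis using eventually_gt_at_top[of 0]
    by eventually_elim (simp add: field_simps)
qed

lemma odd_not_in_\<U>D: "odd n \<Longrightarrow> n \<notin> \<U> \<Longrightarrow> n \<in> sums_prime_power2"
  unfolding \<U>_def sums_prime_power2_def by (auto elim: oddE)

text \<open>The threshold \<open>n0\<close> is there because a progression contains its residue
  class only from its first term on.\<close>

lemma sums_prime_power2_not_subset_density_zero:
  assumes "has_asymp_density S 0"
  shows "\<exists>n\<ge>n0. n \<in> sums_prime_power2 \<and> n \<notin> S"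
proof (rule ccontr)
  assume "\<not> ?thesis"
  then have sub: "n \<in> S" if "n \<ge> n0" "n \<in> sums_prime_power2" for n using that by blast
  obtain c where c: "c > 0"
    and rom: "\<forall>\<^sub>F N in sequentially. c * real N \<le> real (card {n \<in> sums_prime_power2. n \<le> 2 * N})"
    using romanoff by blast
  have "\<forall>\<^sub>F x in sequentially. real (card {n \<in> S. 1 \<le> n \<and> n \<le> x}) \<le> c / 4 * real x"
    using c by (intro density_zeroD[OF assms]) simp
  then have "\<forall>\<^sub>F N in sequentially. real (card {n \<in> S. 1 \<le> n \<and> n \<le> 2 * N}) \<le> c / 4 * real (2 * N)"
    by (rule eventually_compose_filterlim) real_asymp
  moreover have "\<forall>\<^sub>F N in sequentially. real n0 < c / 2 * real N" using c by real_asymp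
  ultimately have "\<forall>\<^sub>F N::nat in sequentially. False" using rom
  proof eventually_elim
    case (elim N)
    have "{n \<in> sums_prime_power2. n \<le> 2 * N} \<subseteq> {..<n0} \<union> {n \<in> S. 1 \<le> n \<and> n \<le> 2 * N}"
    proof
      fix n assume n: "n \<in> {n \<in> sums_prime_power2. n \<le> 2 * N}"
      then have "odd n" by (simp add: sums_prime_power2_def)
      then have "1 \<le> n" by (auto elim: oddE)
      then show "n \<in> {..<n0} \<union> {n \<in> S. 1 \<le> n \<and> n \<le> 2 * N}" using n sub[of n] by (cases "n0 \<le> n") auto
    qed
    then have "card {n \<in> sums_prime_power2. n \<le> 2 * N} \<le> card ({..<n0} \<union> {n \<in> S. 1 \<le> n \<and> n \<le> 2 * N})"
      by (intro card_mono) auto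
    also have "\<dots> \<le> card {..<n0} + card {n \<in> S. 1 \<le> n \<and> n \<le> 2 * N}" by (rule card_Un_le)
    finally show False using elim by simp
  qed
  then show False by simp
qed

text \<open>If the class met \<open>\<U>\<close> only inside \<open>T\<close>, the elements of the
  class of \<open>b\<close> modulo \<open>M\<close> would lie in \<open>T\<close>, at most
  \<open>x / (4 * M)\<close> of them, or be representable, at most \<open>x / (2 * M)\<close>. The
  missing quarter of \<open>x / M\<close> exceeds the rounding error 1.\<close>

lemma progression_meets_\<U>_outside_density_zero:
  assumes m: "m > 0" "even m" and a: "odd a" and T: "has_asymp_density T 0"
  shows "\<exists>n. [n = a] (mod m) \<and> n \<in> \<U> \<and> n \<notin> T"
proof (rule ccontr)
  assume "\<not> ?thesis"
  then have sub: "n \<in> T" if "[n = a] (mod m)" "n \<in> \<U>" for n using that by blast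
  obtain M b where M: "M > 0" "m dvd M" and b: "[b = a] (mod m)"
    and sparse: "\<forall>\<^sub>F x in sequentially. real (card {n. n \<le> x \<and> [n = b] (mod M) \<and> n \<in> sums_prime_power2}) \<le> real x / (2 * real M)"
    using sparse_subprogression[OF m(1)] by blast
  have "\<forall>\<^sub>F x in sequentially. real (card {n \<in> T. 1 \<le> n \<and> n \<le> x}) \<le> 1 / (4 * real M) * real x"
    using M by (intro density_zeroD[OF T]) simp
  moreover have "\<forall>\<^sub>F x in sequentially. 1 < 1 / (4 * real M) * real x"
    using M by real_asymp
  ultimately have "\<forall>\<^sub>F x::nat in sequentially. False" using sparse
  proof eventually_elim
    case (elim x)
    let ?C = "{n. n < x \<and> n mod M = b mod M}"
    have "?C \<subseteq> {n \<in> T. 1 \<le> n \<and> n \<le> x} \<union> {n. n \<le> x \<and> [n = b] (mod M) \<and> n \<in> sums_prime_power2}"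
    proof
      fix n assume n: "n \<in> ?C"
      then have nb: "[n = b] (mod M)" by (simp add: Cong.cong_def)
      then have na: "[n = a] (mod m)" using M(2) b cong_dvd_modulus_nat cong_trans by blast
      then have "[n = a] (mod 2)" using m(2) cong_dvd_modulus_nat by blast
      then have "odd n" using a by (simp add: Cong.cong_def odd_iff_mod_2_eq_one)
      then have "1 \<le> n" by (auto elim: oddE)
      then show "n \<in> {n \<in> T. 1 \<le> n \<and> n \<le> x} \<union> {n. n \<le> x \<and> [n = b] (mod M) \<and> n \<in> sums_prime_power2}"
        using n nb sub[OF na] odd_not_in_\<U>D[OF \<open>odd n\<close>] by auto
    qed
    then have "card ?C \<le> card ({n \<in> T. 1 \<le> n \<and> n \<le> x} \<union> {n. n \<le> x \<and> [n = b] (mod M) \<and> n \<in> sums_prime_power2})"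
      by (intro card_mono) auto
    also have "\<dots> \<le> card {n \<in> T. 1 \<le> n \<and> n \<le> x} + card {n. n \<le> x \<and> [n = b] (mod M) \<and> n \<in> sums_prime_power2}"
      by (rule card_Un_le)
    finally have "real (card ?C) \<le> 1 / (4 * real M) * real x + real x / (2 * real M)" using elim by simp
    also have "\<dots> = real x / real M - 1 / (4 * real M) * real x" using M by (simp add: field_simps)
    also have "\<dots> < real x / real M - 1" using elim by simp
    finally have "real (card ?C) < real x / real M - 1" .
    moreover have "\<bar>real (card ?C) - real x / real M\<bar> \<le> 1" using M by (intro card_residue_class_less) simp
    ultimately show False by linarith
  qed
  then show False by simp
qed

theorem theorem1:
  fixes S :: "nat set"
  assumes "S \<subseteq> {0<..}" and "has_asymp_density S 0"
  shows "\<not> (\<exists>(P :: (nat \<times> nat) set) T.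
      finite P \<and> (\<forall>(m, a) \<in> P. 0 < m \<and> 0 < a) \<and>
      T \<subseteq> {0<..} \<and> has_asymp_density T 0 \<and>
      \<U> \<union> S = (\<Union>(m, a) \<in> P. arith_prog m a) \<union> T)"
proof
  assume "\<exists>(P :: (nat \<times> nat) set) T. finite P \<and> (\<forall>(m, a) \<in> P. 0 < m \<and> 0 < a) \<and>
      T \<subseteq> {0<..} \<and> has_asymp_density T 0 \<and> \<U> \<union> S = (\<Union>(m, a) \<in> P. arith_prog m a) \<union> T"
  then obtain P :: "(nat \<times> nat) set" and T where P: "finite P" "\<forall>(m, a) \<in> P. 0 < m \<and> 0 < a"
    and T: "has_asymp_density T 0" and eq: "\<U> \<union> S = (\<Union>(m, a) \<in> P. arith_prog m a) \<union> T" by blast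
  show False
  proof (cases "\<forall>n. odd n \<longrightarrow> (\<exists>(m, a)\<in>P. [n = a] (mod m))")
    case True
    \<comment> \<open>As a sum, \<open>n0\<close> dominates every first term, so from
      \<open>n0\<close> on a congruence modulo \<open>m\<close> means membership in the
      progression.\<close>
    define n0 where "n0 = (\<Sum>(m, a)\<in>P. a)"
    have le: "a \<le> n0" if "(m, a) \<in> P" for m a
      unfolding n0_def using member_le_sum[OF that, of "\<lambda>(m, a). a"] P(1) by auto
    obtain n where n: "n \<ge> n0" "n \<in> sums_prime_power2" "n \<notin> S"
      using sums_prime_power2_not_subset_density_zero[OF assms(2)] by blast
    then have "odd n" by (simp add: sums_prime_power2_def)
    then obtain m a where ma: "(m, a) \<in> P" "[n = a] (mod m)" using True by blast
    then obtain h where "n = m * h + a"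
      using le[OF ma(1)] n(1) by (metis cong_le_nat le_trans add.commute mult.commute)
    then have "n \<in> arith_prog m a" by (auto simp: arith_prog_def)
    then have "n \<in> \<U> \<union> S" unfolding eq using ma(1) by blast
    moreover have "n \<notin> \<U>" using n(2) by (auto simp: \<U>_def sums_prime_power2_def)
    ultimately show False using n(3) by blast
  next
    case False
    then obtain a where a: "odd a" and na: "\<And>m c. (m, c) \<in> P \<Longrightarrow> \<not> [a = c] (mod m)" by blast
    \<comment> \<open>The product makes every modulus divide \<open>m\<close>, so the class of
      \<open>a\<close> modulo \<open>m\<close> is disjoint from all progressions; the factor 2 keeps
      the class odd.\<close>
    define m where "m = 2 * (\<Prod>(k, c)\<in>P. k)"
    have "m > 0" unfolding m_def using P(2) by (auto intro!: prod_pos)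
    then obtain n where n: "[n = a] (mod m)" "n \<in> \<U>" "n \<notin> T"
      using progression_meets_\<U>_outside_density_zero[OF _ _ a T, of m] by (auto simp: m_def)
    then obtain k c where kc: "(k, c) \<in> P" "n \<in> arith_prog k c" using eq by blast
    have "k dvd (\<Prod>(k, c)\<in>P. k)" using dvd_prodI[OF P(1) kc(1), of "\<lambda>(k, c). k"] by simp
    then have "k dvd m" by (simp add: m_def)
    then have "[n = a] (mod k)" using n(1) cong_dvd_modulus_nat by blast
    moreover have "[n = c] (mod k)" using kc(2) by (auto simp: arith_prog_def Cong.cong_def)
    ultimately show False using na[OF kc(1)] cong_sym cong_trans by blast
  qed
qed

end
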